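(* Assume the Riemann Hypothesis. Let $a<c$ and $k$ be positive integers. Then for every $\varepsilon>0$ and $x\ge2$, $$\Delta_k(a;c;x)\ll x^{\frac{1}{a+c}+\varepsilon}.$$
   Context: $\zeta$ is the Riemann zeta-function and $\mu_k$ is defined by $\sum_{n\ge1}\mu_k(n)n^{-s}=\zeta(s)^{-k}$ for $\Re s>1$. For positive integers $a<c$ put $u_k(a;c;n)=\sum_{l^ad^c=n}\mu_k(d)$ (sum over positive integers $l,d$), and $$\Delta_k(a;c;x)=\sum_{n\le x}u_k(a;c;n)-\frac{x^{1/a}}{\zeta^k(c/a)}.$$ Implied constants depend only on $a,c,k,\varepsilon$. *)

theory Defs
  imports "HOL-Complex_Analysis.Complex_Analysis"
begin

text \<open>
  The analytic continuation is unique on \<open>- {1}\<close> by the identity theorem; the value at the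
  pole \<open>s = 1\<close> is left unspecified and is never used.
\<close>
definition zeta :: "complex \<Rightarrow> complex" where
  "zeta = (SOME f. f holomorphic_on (- {1}) \<and>
     (\<forall>s. Re s > 1 \<longrightarrow> ((\<lambda>n::nat. of_nat n powr (- s)) has_sum f s) {1..}))"

definition riemann_hypothesis :: bool where
  "riemann_hypothesis \<longleftrightarrow>
     (\<forall>s. zeta s = 0 \<longrightarrow> 0 < Re s \<longrightarrow> Re s < 1 \<longrightarrow> Re s = 1 / 2)"

text \<open>
  \<open>mu k n\<close> is \<open>\<mu>\<^sub>k(n)\<close>. For \<open>n \<ge> 1\<close> the coefficients are determined by the uniqueness theorem
  for Dirichlet series; the value at \<open>n = 0\<close> is left unspecified and is never used.
  The values are in fact integers, but the defining identity only refers to complex numbers.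
\<close>
definition mu :: "nat \<Rightarrow> nat \<Rightarrow> complex" where
  "mu k = (SOME f. \<forall>s. Re s > 1 \<longrightarrow>
     ((\<lambda>n. f n * of_nat n powr (- s)) has_sum (1 / zeta s ^ k)) {1..})"

text \<open>
  For \<open>a, c, n \<ge> 1\<close> the index set is finite.
\<close>
definition u :: "nat \<Rightarrow> nat \<Rightarrow> nat \<Rightarrow> nat \<Rightarrow> complex" where
  "u k a c n = (\<Sum>(l, d) \<in> {(l, d). 0 < l \<and> 0 < d \<and> l ^ a * d ^ c = n}. mu k d)"

definition Delta :: "nat \<Rightarrow> nat \<Rightarrow> nat \<Rightarrow> real \<Rightarrow> complex" where
  "Delta k a c x =
     (\<Sum>n | 1 \<le> n \<and> real n \<le> x. u k a c n)
     - of_real (x powr (1 / real a)) / zeta (of_real (real c / real a)) ^ k"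

end

theory Submission
  imports Defs "HOL-Number_Theory.Prime_Powers" "HOL-Computational_Algebra.Squarefree"
begin

text \<open>
  Split \<open>\<Sum> mu k d\<close> over the pairs \<open>(l, d)\<close> with \<open>l\<^sup>a d\<^sup>c \<le> x\<close> at \<open>d = Y\<close>, where \<open>Y \<approx> x\<^sup>1\<^sup>/\<^sup>(\<^sup>a\<^sup>+\<^sup>c\<^sup>)\<close>.
  The pairs with \<open>d \<le> Y\<close> are counted by rounding \<open>(x / d\<^sup>c)\<^sup>1\<^sup>/\<^sup>a\<close>, with total error at most
  \<open>\<Sum>\<^sub>d\<^sub>\<le>\<^sub>Y \<bar>mu k d\<bar>\<close>. The pairs with \<open>d > Y\<close> have the Dirichlet series \<open>\<zeta>(as) f(cs)\<close>, where
  \<open>f(s) = \<zeta>(s)\<^sup>-\<^sup>k - \<Sum>\<^sub>d\<^sub>\<le>\<^sub>Y mu k d d\<^sup>-\<^sup>s\<close>. Under the Riemann Hypothesis \<open>\<zeta>\<^sup>\<plusminus>\<^sup>1\<close> is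
  \<open>O(\<bar>Im s\<bar>\<^sup>\<epsilon>)\<close> to the right of the critical line, hence \<open>f(s)\<close> is about \<open>Y\<close> to the power \<open>1/2 - Re s\<close>
  up to factors \<open>(Y (1 + \<bar>Im s\<bar>))\<^sup>\<epsilon>\<close>. Moving the Perron integral of \<open>\<zeta>(as) f(cs)\<close> to \<open>Re s\<close> just above
  \<open>1 / (2a)\<close> (rather than to the edge \<open>1 / (2c)\<close> of the half-plane where \<open>f(cs)\<close> is controlled) bounds it
  by \<open>x\<close> to the power \<open>1/(2a)\<close> times \<open>Y\<close> to the power \<open>1/2 - c/(2a)\<close>, which balances \<open>Y\<close>.

  Only the absolute convergence of \<open>\<Sum> mu k d d\<^sup>-\<^sup>s\<close> for \<open>Re s > 1\<close> is used about the coefficients. This is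
  possible because all frequencies are integers, so that a smoothed Perron kernel is exact.
\<close>

section \<open>Perron's formula for integer frequencies\<close>

text \<open>With \<open>Y\<close> = x^(1/(a+c)) the two errors agree: 1/(2a) + (a - c)/(2a(a + c)) =
  1/(a + c), which is also the exponent of \<open>Y\<close> itself. A sharp Perron cut-off would
  leave terms near the cut that call for bounds on individual coefficients; a quadratically decaying
  kernel has an error proportional to |mu k d| d^-\<sigma>, which absolute convergence sums. Its
  decay costs a factor \<open>N\<close>, so it is interpolated with an estimate free of loss, which
  gives (1 + |v|)^(-1-\<eta>) at the price of \<open>N\<close>^\<eta>. Poles are the second
  obstacle: the kernel has one at w = 0 and \<zeta>(as) one at s = 1/a. Instead of collecting
  residues, the value of the series at the pole is subtracted at the single index d = 1, so every
  shift is free of poles. In the tail estimate the truncated sum then is minus the tail itself; in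
  the double sum the constant meets its share of the main term up to rounding. As
  \<open>zeta\<close> and \<open>mu\<close> are choices, the existence of the objects has to be
  proved, and as the hypothesis concerns the open critical strip only, the line Re s = 1 needs
  Mertens' argument.\<close>

definition vline :: "real \<Rightarrow> real \<Rightarrow> real \<Rightarrow> complex" where
  "vline \<sigma> T = linepath (Complex \<sigma> (-T)) (Complex \<sigma> T)"

lemma in_closed_segment_horizontal:
  "z \<in> closed_segment (Complex a y) (Complex b y) \<longleftrightarrow> Im z = y \<and> Re z \<in> closed_segment a b"
  by (subst closed_segment_same_Im) auto

lemma in_closed_segment_vertical:
  "z \<in> closed_segment (Complex x a) (Complex x b) \<longleftrightarrow> Re z = x \<and> Im z \<in> closed_segment a b"
  by (subst closed_segment_same_Re) auto

text \<open>Only the two horizontal sides, each of length \<open>b - a\<close>, separate the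
  vertical integrals from each other. Continuity is asked on the boundary alone, so that
  \<open>I\<close> may carry residues of poles inside the rectangle.\<close>

lemma rectangle_vline_bound:
  assumes "a \<le> b" "0 \<le> T" "0 \<le> B"
    and cont: "\<And>z. a \<le> Re z \<Longrightarrow> Re z \<le> b \<Longrightarrow> \<bar>Im z\<bar> \<le> T \<Longrightarrow>
                 Re z = a \<or> Re z = b \<or> \<bar>Im z\<bar> = T \<Longrightarrow> isCont f z"
    and int: "(f has_contour_integral I) (rectpath (Complex a (-T)) (Complex b T))"
    and bnd: "\<And>z. a \<le> Re z \<Longrightarrow> Re z \<le> b \<Longrightarrow> \<bar>Im z\<bar> = T \<Longrightarrow> norm (f z) \<le> B"
  shows "norm (contour_integral (vline b T) f - contour_integral (vline a T) f - I) \<le> 2 * B * (b - a)"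
proof -
  define l1 where "l1 = linepath (Complex a (-T)) (Complex b (-T))"
  define l2 where "l2 = linepath (Complex b (-T)) (Complex b T)"
  define l3 where "l3 = linepath (Complex b T) (Complex a T)"
  define l4 where "l4 = linepath (Complex a T) (Complex a (-T))"
  have seg: "closed_segment (-T) T = {-T..T}" "closed_segment T (-T) = {-T..T}"
            "closed_segment a b = {a..b}" "closed_segment b a = {a..b}"
    using assms by (auto simp: closed_segment_eq_real_ivl)
  have c1: "f contour_integrable_on l1" unfolding l1_def
    by (intro contour_integrable_continuous_linepath continuous_at_imp_continuous_on ballI cont)
       (use assms in \<open>auto simp: in_closed_segment_horizontal seg\<close>)
  have c2: "f contour_integrable_on l2" unfolding l2_def
    by (intro contour_integrable_continuous_linepath continuous_at_imp_continuous_on ballI cont)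
       (use assms in \<open>auto simp: in_closed_segment_vertical seg\<close>)
  have c3: "f contour_integrable_on l3" unfolding l3_def
    by (intro contour_integrable_continuous_linepath continuous_at_imp_continuous_on ballI cont)
       (use assms in \<open>auto simp: in_closed_segment_horizontal seg\<close>)
  have c4: "f contour_integrable_on l4" unfolding l4_def
    by (intro contour_integrable_continuous_linepath continuous_at_imp_continuous_on ballI cont)
       (use assms in \<open>auto simp: in_closed_segment_vertical seg\<close>)
  have v: "valid_path l1" "valid_path l2" "valid_path l3" "valid_path l4"
    by (auto simp: l1_def l2_def l3_def l4_def)
  have e: "pathfinish l1 = pathstart l2" "pathfinish l2 = pathstart l3" "pathfinish l3 = pathstart l4"
    by (auto simp: l1_def l2_def l3_def l4_def)
  have rp: "rectpath (Complex a (-T)) (Complex b T) = l1 +++ l2 +++ l3 +++ l4"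
    by (simp add: rectpath_def Let_def l1_def l2_def l3_def l4_def)
  have "I = contour_integral (l1 +++ l2 +++ l3 +++ l4) f"
    using int unfolding rp by (simp add: contour_integral_unique)
  also have "\<dots> = contour_integral l1 f + contour_integral l2 f + contour_integral l3 f + contour_integral l4 f"
    using c1 c2 c3 c4 v e by (simp add: valid_path_join contour_integrable_join)
  also have "contour_integral l4 f = - contour_integral (vline a T) f"
    using contour_integral_reversepath[of "vline a T" f] by (simp add: l4_def vline_def)
  finally have "contour_integral (vline b T) f - contour_integral (vline a T) f - I
                 = - contour_integral l1 f - contour_integral l3 f"
    by (simp add: vline_def l2_def)
  moreover have "norm (contour_integral l1 f) \<le> B * norm (Complex b (-T) - Complex a (-T))"
    unfolding l1_def
    by (rule contour_integral_bound_linepath)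
       (use c1 bnd assms in \<open>auto simp: in_closed_segment_horizontal seg l1_def\<close>)
  moreover have "norm (contour_integral l3 f) \<le> B * norm (Complex a T - Complex b T)"
    unfolding l3_def
    by (rule contour_integral_bound_linepath)
       (use c3 bnd assms in \<open>auto simp: in_closed_segment_horizontal seg l3_def\<close>)
  moreover have "norm (Complex b (-T) - Complex a (-T)) = b - a" "norm (Complex a T - Complex b T) = b - a"
    using assms by (simp_all add: cmod_def)
  ultimately show ?thesis
    using norm_triangle_ineq4[of "- contour_integral l1 f" "contour_integral l3 f"] by simp
qed

lemma vline_integral_bound:
  assumes "0 \<le> T" "0 \<le> B" "\<And>z. Re z = \<sigma> \<Longrightarrow> \<bar>Im z\<bar> \<le> T \<Longrightarrow> isCont f z"
    "\<And>z. Re z = \<sigma> \<Longrightarrow> \<bar>Im z\<bar> \<le> T \<Longrightarrow> norm (f z) \<le> B"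
  shows "norm (contour_integral (vline \<sigma> T) f) \<le> B * (2 * T)"
proof -
  have "f contour_integrable_on vline \<sigma> T" unfolding vline_def
    by (intro contour_integrable_continuous_linepath continuous_at_imp_continuous_on ballI assms)
       (use assms in \<open>auto simp: in_closed_segment_vertical closed_segment_eq_real_ivl\<close>)
  hence "norm (contour_integral (vline \<sigma> T) f) \<le> B * norm (Complex \<sigma> T - Complex \<sigma> (-T))"
    unfolding vline_def
    by (rule contour_integral_bound_linepath)
       (use assms in \<open>auto simp: in_closed_segment_vertical closed_segment_eq_real_ivl\<close>)
  also have "norm (Complex \<sigma> T - Complex \<sigma> (-T)) = 2 * T"
    using assms by (simp add: cmod_def real_sqrt_mult)
  finally show ?thesis .
qed

text \<open>For \<open>x \<le> 1\<close> the power does not grow to the right, so the contour is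
  closed at \<open>Re s = T\<close>, away from the poles 0 and -1. The added sides have |s| and |s +
  1| at least \<open>T\<close> and length at most \<open>2 * T\<close>. This gives the constant 4;
  the 12 is that of the case \<open>1 \<le> x\<close>.\<close>

lemma perron_small:
  fixes x \<sigma> T :: real
  assumes "0 < x" "x \<le> 1" "0 < \<sigma>" "\<sigma> \<le> T" "2 \<le> T"
  shows "norm (contour_integral (vline \<sigma> T) (\<lambda>s. of_real x powr s / (s * (s + 1)))) \<le> 12 * x powr \<sigma> / T"
proof -
  let ?f = "\<lambda>s. of_real x powr s / (s * (s + 1))"
  have nz: "z \<noteq> 0 \<and> z + 1 \<noteq> 0" if "Re z \<ge> \<sigma>" for z
    using that assms by (auto simp: complex_eq_iff)
  have cont: "isCont ?f z" if "\<sigma> \<le> Re z" for z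
    using nz[OF that] assms by (intro continuous_intros) auto
  have nb: "norm (?f z) \<le> x powr \<sigma> / T\<^sup>2" if "\<sigma> \<le> Re z" "T \<le> norm z" "T \<le> norm (z + 1)" for z
  proof -
    have "norm (?f z) = x powr Re z / (norm z * norm (z + 1))"
      using assms by (simp add: norm_divide norm_mult norm_powr_real_powr)
    also have "\<dots> \<le> x powr \<sigma> / (T * T)"
      using that assms by (intro frac_le mult_mono powr_mono') auto
    finally show ?thesis by (simp add: power2_eq_square mult_ac)
  qed
  have "(?f has_contour_integral 0) (rectpath (Complex \<sigma> (-T)) (Complex T T))"
  proof (rule Cauchy_theorem_convex_simple[where S = "{z. 0 < Re z}"])
    show "?f holomorphic_on {z. 0 < Re z}"
      using assms by (intro holomorphic_intros) (auto simp: mult_eq_0_iff simp del: complex_eq_iff, auto simp: complex_eq_iff)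
    show "convex {z. 0 < Re z}" by (rule convex_halfspace_Re_gt)
    show "path_image (rectpath (Complex \<sigma> (-T)) (Complex T T)) \<subseteq> {z. 0 < Re z}"
      using assms by (subst path_image_rectpath) auto
  qed auto
  hence "norm (contour_integral (vline T T) ?f - contour_integral (vline \<sigma> T) ?f - 0) \<le> 2 * (x powr \<sigma> / T\<^sup>2) * (T - \<sigma>)"
  proof (rule rectangle_vline_bound[rotated 4])
    fix z :: complex assume "\<sigma> \<le> Re z" "\<bar>Im z\<bar> = T"
    thus "norm (?f z) \<le> x powr \<sigma> / T\<^sup>2"
      using nb abs_Im_le_cmod[of z] abs_Im_le_cmod[of "z+1"] by auto
  qed (use assms cont in auto)
  also have "\<dots> \<le> 2 * (x powr \<sigma> / T\<^sup>2) * T" using assms by (intro mult_left_mono) auto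
  also have "\<dots> = 2 * (x powr \<sigma> / T)" using assms by (simp add: field_simps power2_eq_square)
  finally have 1: "norm (contour_integral (vline T T) ?f - contour_integral (vline \<sigma> T) ?f) \<le> 2 * (x powr \<sigma> / T)" by simp
  have "norm (contour_integral (vline T T) ?f) \<le> x powr \<sigma> / T\<^sup>2 * (2 * T)"
  proof (rule vline_integral_bound)
    fix z :: complex assume "Re z = T"
    thus "norm (?f z) \<le> x powr \<sigma> / T\<^sup>2"
      using nb complex_Re_le_cmod[of z] complex_Re_le_cmod[of "z+1"] assms by auto
  qed (use assms cont in auto)
  also have "\<dots> = 2 * (x powr \<sigma> / T)" using assms by (simp add: field_simps power2_eq_square)
  finally have 2: "norm (contour_integral (vline T T) ?f) \<le> 2 * (x powr \<sigma> / T)" .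
  have "norm (contour_integral (vline \<sigma> T) ?f) \<le> 4 * (x powr \<sigma> / T)"
    using 1 2 norm_triangle_ineq4[of "contour_integral (vline T T) ?f" "contour_integral (vline T T) ?f - contour_integral (vline \<sigma> T) ?f"]
    by simp
  also have "\<dots> \<le> 12 * x powr \<sigma> / T" using assms by (simp add: field_simps)
  finally show ?thesis .
qed

text \<open>For \<open>1 \<le> x\<close> the contour is closed on the left, at
  \<open>Re s = -T\<close>, and encloses the poles 0 and -1 with residues 1 and -1/x. On the far
  side \<open>2 \<le> T\<close> ensures that |s + 1| is at least T/2.\<close>

lemma perron_large:
  fixes x \<sigma> T :: real
  assumes "1 \<le> x" "0 < \<sigma>" "\<sigma> \<le> T" "2 \<le> T"
  shows "norm (contour_integral (vline \<sigma> T) (\<lambda>s. of_real x powr s / (s * (s + 1))) - 2 * pi * \<i> * (1 - 1 / x))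
           \<le> 12 * x powr \<sigma> / T"
proof -
  let ?f = "\<lambda>s. of_real x powr s / (s * (s + 1))"
  have cont: "isCont ?f z" if "z \<noteq> 0" "z + 1 \<noteq> 0" for z :: complex
    by (intro continuous_intros) (use that assms in auto)
  have nb: "norm (?f z) \<le> 2 * x powr \<sigma> / T\<^sup>2" if "Re z \<le> \<sigma>" "T \<le> norm z" "T / 2 \<le> norm (z + 1)" for z
  proof -
    have "norm (?f z) = x powr Re z / (norm z * norm (z + 1))"
      using assms by (simp add: norm_divide norm_mult norm_powr_real_powr)
    also have "\<dots> \<le> x powr \<sigma> / (T * (T / 2))"
      using that assms by (intro frac_le mult_mono powr_mono) auto
    finally show ?thesis by (simp add: power2_eq_square mult_ac)
  qed
  define R where "R = rectpath (Complex (-T) (-T)) (Complex \<sigma> T)"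
  have wn: "winding_number R z = 1" if "z = 0 \<or> z = -1" for z
    unfolding R_def by (rule winding_number_rectpath) (use that assms in \<open>auto simp: box_def Basis_complex_def inner_complex_def\<close>)
  have pi: "path_image R \<subseteq> UNIV - {z}" if "z = 0 \<or> z = -1" for z
    unfolding R_def by (subst path_image_rectpath) (use that assms in \<open>auto simp: complex_eq_iff\<close>)
  have hc: "((\<lambda>w. of_real x powr w / (w - z)) has_contour_integral (2*pi * \<i> * winding_number R z * (of_real x powr z))) R"
    if "z = 0 \<or> z = -1" for z
    by (rule Cauchy_integral_formula_convex_simple[where S = UNIV])
       (use that pi assms in \<open>auto intro!: holomorphic_intros simp: R_def\<close>)
  \<comment> \<open>Partial fractions, 1/(s(s+1)) = 1/s - 1/(s+1), split the integrand into two
    Cauchy kernels, one for each pole.\<close>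
  have "((\<lambda>w. of_real x powr w / (w - 0) - of_real x powr w / (w - (-1))) has_contour_integral
          (2*pi * \<i> * winding_number R 0 * (of_real x powr 0) - 2*pi * \<i> * winding_number R (-1) * (of_real x powr (-1)))) R"
    by (intro has_contour_integral_diff hc) auto
  also have "2*pi * \<i> * winding_number R 0 * (of_real x powr 0) - 2*pi * \<i> * winding_number R (-1) * (of_real x powr (-1))
     = 2 * pi * \<i> * (1 - 1 / of_real x)"
    using assms by (simp add: wn powr_minus field_simps)
  finally have "(?f has_contour_integral 2 * pi * \<i> * (1 - 1 / of_real x)) R"
  proof (rule has_contour_integral_eq)
    fix w assume "w \<in> path_image R"
    hence "w \<noteq> 0" "w + 1 \<noteq> 0"
      using pi[of 0] pi[of "-1"] by (auto simp: add_eq_0_iff2)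
    thus "of_real x powr w / (w - 0) - of_real x powr w / (w - (-1)) = ?f w"
      by (simp add: divide_simps) (simp add: algebra_simps)
  qed
  hence "norm (contour_integral (vline \<sigma> T) ?f - contour_integral (vline (-T) T) ?f - 2 * pi * \<i> * (1 - 1 / of_real x))
           \<le> 2 * (2 * x powr \<sigma> / T\<^sup>2) * (\<sigma> - (-T))" unfolding R_def
  proof (rule rectangle_vline_bound[rotated 4])
    fix z :: complex assume z: "- T \<le> Re z" "Re z \<le> \<sigma>" "\<bar>Im z\<bar> = T"
    thus "norm (?f z) \<le> 2 * x powr \<sigma> / T\<^sup>2"
      using abs_Im_le_cmod[of z] abs_Im_le_cmod[of "z+1"] assms by (intro nb) auto
  next
    fix z :: complex assume "Re z = - T \<or> Re z = \<sigma> \<or> \<bar>Im z\<bar> = T"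
    thus "isCont ?f z" using assms by (intro cont) (auto simp: complex_eq_iff)
  qed (use assms in auto)
  also have "\<dots> \<le> 2 * (2 * x powr \<sigma> / T\<^sup>2) * (2 * T)" using assms by (intro mult_left_mono) auto
  also have "\<dots> = 8 * x powr \<sigma> / T"  using assms by (simp add: field_simps power2_eq_square)
  finally have 1: "norm (contour_integral (vline \<sigma> T) ?f - contour_integral (vline (-T) T) ?f - 2 * pi * \<i> * (1 - 1 / of_real x))
                     \<le> 8 * x powr \<sigma> / T" .
  have "norm (contour_integral (vline (-T) T) ?f) \<le> 2 * x powr \<sigma> / T\<^sup>2 * (2 * T)"
  proof (rule vline_integral_bound)
    fix z :: complex assume z: "Re z = -T"
    have "norm (?f z) = x powr (-T) / (norm z * norm (z + 1))"
      using assms z by (simp add: norm_divide norm_mult norm_powr_real_powr)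
    also have "\<dots> \<le> 1 / (T * (T / 2))"
      using abs_Re_le_cmod[of z] abs_Re_le_cmod[of "z+1"] assms z
      by (intro frac_le mult_mono) (auto simp: powr_minus inverse_le_1_iff ge_one_powr_ge_zero)
    also have "\<dots> = 2 / T\<^sup>2"
      by (simp add: power2_eq_square)
    also have "\<dots> \<le> 2 * x powr \<sigma> / T\<^sup>2"
      using assms by (intro divide_right_mono) (auto intro: ge_one_powr_ge_zero)
    finally show "norm (?f z) \<le> 2 * x powr \<sigma> / T\<^sup>2" .
    show "isCont ?f z" using z assms by (intro cont) (auto simp: complex_eq_iff)
  qed (use assms in auto)
  also have "\<dots> = 4 * x powr \<sigma> / T" using assms by (simp add: field_simps power2_eq_square)
  finally have 2: "norm (contour_integral (vline (-T) T) ?f) \<le> 4 * x powr \<sigma> / T" .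
  let ?A = "contour_integral (vline \<sigma> T) ?f" and ?B = "contour_integral (vline (-T) T) ?f"
  have "norm (?A - 2 * pi * \<i> * (1 - 1 / x)) = norm ((?A - ?B - 2 * pi * \<i> * (1 - 1 / x)) + ?B)"
    by simp
  also have "\<dots> \<le> norm (?A - ?B - 2 * pi * \<i> * (1 - 1 / x)) + norm ?B"
    by (rule norm_triangle_ineq)
  also have "\<dots> \<le> 8 * x powr \<sigma> / T + 4 * x powr \<sigma> / T"
    using 1 2 by (intro add_mono) simp_all
  also have "\<dots> = 12 * x powr \<sigma> / T"
    by (simp add: add_divide_distrib[symmetric])
  finally show ?thesis .
qed

lemma Re_pos_imp_nonzero: "0 < Re s \<Longrightarrow> s \<noteq> 0 \<and> s + 1 \<noteq> 0"
  by (auto simp: complex_eq_iff)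

lemma perron:
  fixes x \<sigma> T :: real
  assumes "0 < x" "0 < \<sigma>" "\<sigma> \<le> T" "2 \<le> T"
  shows "norm (contour_integral (vline \<sigma> T) (\<lambda>s. of_real x powr s / (s * (s + 1)))
           - 2 * pi * \<i> * of_real (max 0 (1 - 1 / x))) \<le> 12 * x powr \<sigma> / T"
  using perron_small[of x \<sigma> T] perron_large[of x \<sigma> T] assms
  by (cases "x \<le> 1") (auto simp: max_def field_simps)

text \<open>\<open>pkern N s / s\<close> is the Perron kernel of the weight that is \<open>1\<close> up to \<open>N\<close> and falls linearly to \<open>0\<close>
  on \<open>[N, N + 1]\<close>. It decays quadratically, and on integers the weight is the indicator of \<open>n \<le> N\<close>.
  At \<open>s = -1\<close> the limit is inserted.\<close>

definition pkern :: "nat \<Rightarrow> complex \<Rightarrow> complex" where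
  "pkern N s = (if s = -1 then ln (of_nat (N + 1)) - ln (of_nat N)
     else (of_nat (N + 1) powr (s + 1) - of_nat N powr (s + 1)) / (s + 1))"

text \<open>The numerator \<open>E\<close> vanishes at -1, so \<open>pkern N\<close> is the
  difference quotient of \<open>E\<close> at that point, and the logarithms in its definition are
  the derivative there.\<close>

lemma holomorphic_pkern:
  assumes "0 < N" shows "pkern N holomorphic_on UNIV"
proof -
  define E where "E = (\<lambda>s. of_nat (N + 1) powr (s + 1) - of_nat N powr (s + 1) :: complex)"
  have [simp]: "(of_nat N :: complex) \<noteq> 0" "(1 + of_nat N :: complex) \<noteq> 0"
    using assms by (auto simp: of_nat_eq_0_iff[of "Suc N", simplified] simp del: of_nat_Suc)
  have "E holomorphic_on UNIV"
    unfolding E_def by (intro holomorphic_intros)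
  hence "(\<lambda>z. if z = -1 then deriv E (-1) else (E z - E (-1)) / (z - (-1))) holomorphic_on UNIV"
    by (rule pole_lemma_open[OF _ open_UNIV])
  moreover have "(E has_field_derivative (ln (of_nat (N + 1)) - ln (of_nat N))) (at (-1))"
  proof -
    have "((\<lambda>s. w powr (s + 1)) has_field_derivative ln w) (at (-1))" if "w \<noteq> 0" for w :: complex
      using that by (auto simp: powr_def intro!: derivative_eq_intros)
    from this[of "of_nat (N + 1)"] this[of "of_nat N"] assms show ?thesis
      unfolding E_def by (intro DERIV_diff) simp_all
  qed
  hence "deriv E (-1) = ln (of_nat (N + 1)) - ln (of_nat N)" by (rule DERIV_imp_deriv)
  moreover have "E (-1) = 0" using assms by (simp add: E_def)
  moreover have "E z = of_nat (N + 1) powr (z + 1) - of_nat N powr (z + 1)" for z by (simp add: E_def)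
  ultimately have "(\<lambda>z. if z = -1 then deriv E (-1) else (E z - E (-1)) / (z - (-1))) = pkern N"
    by (auto simp: pkern_def fun_eq_iff)
  with \<open>(\<lambda>z. if z = -1 then _ z else _ z) holomorphic_on UNIV\<close> show ?thesis by simp
qed

lemma isCont_pkern: "0 < N \<Longrightarrow> isCont (pkern N) s"
  using holomorphic_on_imp_continuous_on[OF holomorphic_pkern[of N]]
  by (simp add: continuous_on_eq_continuous_at)

lemma isCont_pkern_div: "0 < N \<Longrightarrow> s \<noteq> 0 \<Longrightarrow> isCont (\<lambda>s. pkern N s / s) s"
  by (intro continuous_intros isCont_pkern) auto

text \<open>The kernel combines x^s / (s(s+1)) at x = (N+1)/m and x = N/m with the factors
  \<open>N + 1\<close> and \<open>-N\<close>. Multiplied by n, the weight max(0, 1 - m/n) is max(0,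
  n - m), whose increment from n = N to n = N + 1 is exactly 0 or 1 for an integer \<open>m\<close>.
  The error depends on \<open>m\<close> only through m^-\<sigma>.\<close>

lemma perron_pkern:
  fixes m N :: nat
  assumes "0 < m" "0 < N" "0 < \<sigma>" "\<sigma> \<le> T" "2 \<le> T"
  shows "norm (contour_integral (vline \<sigma> T) (\<lambda>s. of_nat m powr (-s) * (pkern N s / s))
           - (if m \<le> N then 2 * pi * \<i> else 0))
         \<le> 12 * (real (N + 1) powr (\<sigma> + 1) + real N powr (\<sigma> + 1)) / T * real m powr (- \<sigma>)"
proof -
  define J where "J = (\<lambda>n. contour_integral (vline \<sigma> T) (\<lambda>s. of_real (real n / real m) powr s / (s * (s + 1))))"
  define g where "g = (\<lambda>n::nat. max 0 (1 - 1 / (real n / real m)))"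
  have J: "norm (J n - 2 * pi * \<i> * of_real (g n)) \<le> 12 * (real n / real m) powr \<sigma> / T" if "0 < n" for n
    unfolding J_def g_def by (rule perron) (use assms that in auto)
  have ig: "(\<lambda>s. of_real (real n / real m) powr s / (s * (s + 1))) contour_integrable_on vline \<sigma> T" if "0 < n" for n
    unfolding vline_def
    by (intro contour_integrable_continuous_linepath continuous_intros)
       (use assms that in \<open>auto simp: in_closed_segment_vertical dest!: Re_pos_imp_nonzero\<close>)
  have "contour_integral (vline \<sigma> T) (\<lambda>s. of_nat m powr (-s) * (pkern N s / s))
     = contour_integral (vline \<sigma> T) (\<lambda>s. of_nat (N + 1) * (of_real (real (N + 1) / real m) powr s / (s * (s + 1)))
          - of_nat N * (of_real (real N / real m) powr s / (s * (s + 1))))"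
  proof (rule contour_integral_eq)
    fix s assume "s \<in> path_image (vline \<sigma> T)"
    hence s: "Re s = \<sigma>" by (auto simp: vline_def in_closed_segment_vertical)
    hence nz: "s \<noteq> 0" "s + 1 \<noteq> 0" "s \<noteq> -1" using assms by (auto simp: complex_eq_iff)
    have p: "of_real (real n / real m) powr s = of_nat n powr s * of_nat m powr (-s)" if "n > 0" for n
    proof -
      have "of_real (real n / real m) powr s * of_real (real m) powr s = of_real (real n) powr s"
        by (subst powr_times_real[symmetric]) (use assms in auto)
      moreover have "(of_nat m :: complex) powr s \<noteq> 0" using assms by auto
      ultimately show ?thesis by (simp add: powr_minus field_simps)
    qed
    have q: "of_nat n powr (s + 1) = of_nat n * of_nat n powr s" if "n > 0" for n
      using that by (simp add: powr_add)
    show "of_nat m powr (-s) * (pkern N s / s) = of_nat (N + 1) * (of_real (real (N + 1) / real m) powr s / (s * (s + 1)))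
          - of_nat N * (of_real (real N / real m) powr s / (s * (s + 1)))"
      using nz assms p[of N] p[of "N + 1"] q[of N] q[of "N+1"]
      by (simp add: pkern_def divide_simps mult_ac del: of_nat_Suc of_nat_add of_real_divide) (simp add: algebra_simps)
  qed
  also have "\<dots> = of_nat (N + 1) * J (N + 1) - of_nat N * J N"
    unfolding J_def using ig[OF assms(2)] ig[of "N + 1"]
    by (simp only: contour_integral_diff contour_integral_lmul contour_integrable_lmul add_pos_pos zero_less_one assms
                   zero_less_Suc add_is_0 Suc_eq_plus1[symmetric])
  finally have 1: "contour_integral (vline \<sigma> T) (\<lambda>s. of_nat m powr (-s) * (pkern N s / s)) = of_nat (N + 1) * J (N + 1) - of_nat N * J N" .
  have "(if m \<le> N then 1 else 0) = real (N + 1) * g (N + 1) - real N * g N"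
  proof -
    have "real n * g n = max 0 (real n - real m)" if "n > 0" for n
      using that assms by (auto simp: g_def max_def field_simps)
    from this[of N] this[of "N + 1"] show ?thesis using assms by (auto simp: max_def)
  qed
  hence 2: "(if m \<le> N then 2 * pi * \<i> else 0) = 2 * pi * \<i> * of_real (real (N + 1) * g (N + 1) - real N * g N)"
    by (metis (full_types) mult.right_neutral mult_zero_right of_real_0 of_real_1)
  have "contour_integral (vline \<sigma> T) (\<lambda>s. of_nat m powr (-s) * (pkern N s / s)) - (if m \<le> N then 2 * pi * \<i> else 0)
     = of_nat (N + 1) * (J (N + 1) - 2 * pi * \<i> * of_real (g (N + 1))) - of_nat N * (J N - 2 * pi * \<i> * of_real (g N))"
    unfolding 1 2 by (simp add: algebra_simps)
  also have "norm \<dots> \<le> real (N + 1) * norm (J (N + 1) - 2 * pi * \<i> * of_real (g (N + 1))) + real N * norm (J N - 2 * pi * \<i> * of_real (g N))"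
    by (rule order_trans[OF norm_triangle_ineq4]) (simp add: norm_mult del: of_nat_Suc of_nat_add)
  also have "\<dots> \<le> real (N + 1) * (12 * (real (N + 1) / real m) powr \<sigma> / T) + real N * (12 * (real N / real m) powr \<sigma> / T)"
    by (intro add_mono mult_left_mono J) (use assms in auto)
  also have "\<dots> = 12 * (real (N + 1) powr (\<sigma> + 1) + real N powr (\<sigma> + 1)) / T * real m powr (- \<sigma>)"
    using assms by (simp add: powr_divide powr_minus powr_add field_simps)
  finally show ?thesis .
qed

text \<open>Absolute convergence on \<open>Re s = \<sigma>\<close> does two jobs: it allows sum and
  integral over the compact segment to be exchanged, and it sums the errors of
  \<open>perron_pkern\<close>, which are at most \<open>K / T\<close> times the absolute terms
  \<open>b i\<close>. Their total \<open>K * B / T\<close> vanishes in the limit.\<close>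

lemma perron_infsum:
  fixes a :: "'i \<Rightarrow> complex" and lam :: "'i \<Rightarrow> nat"
  assumes sum: "\<And>s. Re s = \<sigma> \<Longrightarrow> ((\<lambda>i. a i * of_nat (lam i) powr (-s)) has_sum A s) I"
    and lam: "\<And>i. i \<in> I \<Longrightarrow> 0 < lam i" and N: "0 < N" and \<sigma>: "0 < \<sigma>"
  shows "((\<lambda>T. contour_integral (vline \<sigma> T) (\<lambda>s. A s * (pkern N s / s)))
           \<longlongrightarrow> 2 * pi * \<i> * (\<Sum>\<^sub>\<infinity>i\<in>{i \<in> I. lam i \<le> N}. a i)) at_top"
proof -
  define b where "b = (\<lambda>i. norm (a i) * real (lam i) powr (-\<sigma>))"
  have nb: "norm (a i * of_nat (lam i) powr (-s)) = b i" if "Re s = \<sigma>" "i \<in> I" for i s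
    using that lam by (simp add: b_def norm_mult norm_powr_real_powr)
  have "(\<lambda>i. a i * of_nat (lam i) powr (-of_real \<sigma>)) summable_on I"
    using sum[of "of_real \<sigma>"] by (auto simp: has_sum_imp_summable)
  hence "(\<lambda>i. norm (a i * of_nat (lam i) powr (-of_real \<sigma>))) summable_on I"
    by (simp add: summable_on_iff_abs_summable_on_complex)
  also have "?this \<longleftrightarrow> b summable_on I" by (intro summable_on_cong nb) auto
  finally have bs: "b summable_on I" .
  define B where "B = infsum b I"
  define K where "K = 12 * (real (N + 1) powr (\<sigma> + 1) + real N powr (\<sigma> + 1))"
  define J where "J = {i \<in> I. lam i \<le> N}"
  \<comment> \<open>For a general index set \<open>J\<close> may be infinite; on it (N / lam
    i)^\<sigma> is at least 1, so a multiple of \<open>b\<close> is a majorant.\<close>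
  have "(\<lambda>i. norm (a i)) summable_on J"
  proof (rule summable_on_comparison_test)
    show "(\<lambda>i. b i * real N powr \<sigma>) summable_on J"
      by (intro summable_on_cmult_left summable_on_subset[OF bs]) (auto simp: J_def)
    show "norm (a i) \<le> b i * real N powr \<sigma>" if "i \<in> J" for i
    proof -
      have "real (lam i) powr \<sigma> \<le> real N powr \<sigma>" using that \<sigma> lam by (intro powr_mono2) (auto simp: J_def)
      moreover have "lam i > 0" using that lam by (auto simp: J_def)
      ultimately have "1 \<le> real (lam i) powr (-\<sigma>) * real N powr \<sigma>"
        by (simp add: powr_minus divide_simps)
      thus ?thesis unfolding b_def using mult_left_mono[of 1 _ "norm (a i)"] by (simp add: mult.assoc)
    qed
  qed auto
  hence "a summable_on J" by (simp add: summable_on_iff_abs_summable_on_complex)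
  hence "(a has_sum (infsum a J)) J" by simp
  hence sJ: "((\<lambda>i. (if lam i \<le> N then 2 * pi * \<i> else 0) * a i) has_sum 2 * pi * \<i> * infsum a J) I"
    by (intro iffD2[OF has_sum_cong_neutral has_sum_cmult_right]) (auto simp: J_def)
  have bound: "norm (contour_integral (vline \<sigma> T) (\<lambda>s. A s * (pkern N s / s)) - 2 * pi * \<i> * infsum a J) \<le> K * B / T"
    if T: "T \<ge> max 2 \<sigma>" for T
  proof -
    define P where "P = path_image (vline \<sigma> T)"
    have P: "Re s = \<sigma> \<and> s \<noteq> 0" if "s \<in> P" for s
      using that \<sigma> by (auto simp: P_def vline_def in_closed_segment_vertical complex_eq_iff)
    have cont: "continuous_on P (\<lambda>s. pkern N s / s)"
      by (intro continuous_at_imp_continuous_on ballI isCont_pkern_div) (use P N in auto)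
    have "compact P" by (simp add: P_def vline_def)
    from compact_imp_bounded[OF compact_continuous_image[OF cont this]]
    obtain M where M: "\<And>s. s \<in> P \<Longrightarrow> norm (pkern N s / s) \<le> M"
      by (auto simp: bounded_iff)
    have cn: "continuous_on P (\<lambda>s. of_nat n powr (-s) * (pkern N s / s))" if "n > 0" for n
      by (rule continuous_on_mult[OF _ cont]) (intro continuous_intros, use that in auto)
    define f where "f = (\<lambda>i s. a i * (of_nat (lam i) powr (-s) * (pkern N s / s)))"
    have "uniform_limit P (\<lambda>F s. \<Sum>i\<in>F. f i s) (\<lambda>s. A s * (pkern N s / s)) (finite_subsets_at_top I)"
    proof (rule Weierstrass_m_test_general')
      show "norm (f i s) \<le> b i * M" if "i \<in> I" "s \<in> P" for i s
      proof -
        have "norm (f i s) = b i * norm (pkern N s / s)"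
          using nb[of s i] P[of s] that by (simp add: f_def norm_mult norm_divide)
        also have "\<dots> \<le> b i * M" using M that by (intro mult_left_mono) (auto simp: b_def)
        finally show ?thesis .
      qed
      show "((\<lambda>i. f i s) has_sum A s * (pkern N s / s)) I" if "s \<in> P" for s
        using has_sum_cmult_left[OF sum, of s "pkern N s / s"] P[OF that] by (simp add: f_def mult.assoc)
      show "(\<lambda>i. b i * M) summable_on I" by (intro summable_on_cmult_left bs)
    qed
    have ci: "f i contour_integrable_on vline \<sigma> T" if "i \<in> I" for i
      unfolding f_def vline_def
      using continuous_on_mult[OF continuous_on_const cn, OF lam[OF that], of "a i"]
      by (intro contour_integrable_continuous_linepath) (simp add: P_def vline_def)
    have lim: "((\<lambda>F. contour_integral (vline \<sigma> T) (\<lambda>s. \<Sum>i\<in>F. f i s)) \<longlongrightarrow> contour_integral (vline \<sigma> T) (\<lambda>s. A s * (pkern N s / s))) (finite_subsets_at_top I)"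
    proof (rule contour_integral_uniform_limit(2))
      show "\<forall>\<^sub>F F in finite_subsets_at_top I. (\<lambda>s. \<Sum>i\<in>F. f i s) contour_integrable_on vline \<sigma> T"
        by (rule eventually_finite_subsets_at_top_weakI) (auto intro!: contour_integrable_sum ci)
      show "uniform_limit (path_image (vline \<sigma> T)) (\<lambda>F s. \<Sum>i\<in>F. f i s) (\<lambda>s. A s * (pkern N s / s)) (finite_subsets_at_top I)"
        using \<open>uniform_limit P _ _ _\<close> by (simp add: P_def)
      show "norm (vector_derivative (vline \<sigma> T) (at t)) \<le> norm (Complex \<sigma> T - Complex \<sigma> (-T))" for t
        by (simp add: vline_def)
    qed (auto simp: vline_def)
    have lim2: "((\<lambda>F. \<Sum>i\<in>F. (if lam i \<le> N then 2 * pi * \<i> else 0) * a i) \<longlongrightarrow> 2 * pi * \<i> * infsum a J) (finite_subsets_at_top I)"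
      using sJ by (simp add: has_sum_def)
    show ?thesis
    proof (rule tendsto_upperbound[OF tendsto_norm[OF tendsto_diff[OF lim lim2]]])
      show "\<forall>\<^sub>F F in finite_subsets_at_top I. norm (contour_integral (vline \<sigma> T) (\<lambda>s. \<Sum>i\<in>F. f i s)
              - (\<Sum>i\<in>F. (if lam i \<le> N then 2 * pi * \<i> else 0) * a i)) \<le> K * B / T"
      proof (rule eventually_finite_subsets_at_top_weakI)
        fix F assume F: "finite F" "F \<subseteq> I"
        have "contour_integral (vline \<sigma> T) (\<lambda>s. \<Sum>i\<in>F. f i s) = (\<Sum>i\<in>F. contour_integral (vline \<sigma> T) (f i))"
          by (intro contour_integral_sum) (use F ci in auto)
        also have "\<dots> = (\<Sum>i\<in>F. a i * contour_integral (vline \<sigma> T) (\<lambda>s. of_nat (lam i) powr (-s) * (pkern N s / s)))"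
        proof (intro sum.cong refl)
          fix i assume i: "i \<in> F"
          have "(\<lambda>s. of_nat (lam i) powr (-s) * (pkern N s / s)) contour_integrable_on vline \<sigma> T"
            unfolding vline_def using cn lam i F
            by (intro contour_integrable_continuous_linepath) (auto simp: P_def vline_def)
          thus "contour_integral (vline \<sigma> T) (f i) = a i * contour_integral (vline \<sigma> T) (\<lambda>s. of_nat (lam i) powr (-s) * (pkern N s / s))"
            unfolding f_def by (rule contour_integral_lmul)
        qed
        finally have "contour_integral (vline \<sigma> T) (\<lambda>s. \<Sum>i\<in>F. f i s)
              - (\<Sum>i\<in>F. (if lam i \<le> N then 2 * pi * \<i> else 0) * a i) =
            (\<Sum>i\<in>F. a i * (contour_integral (vline \<sigma> T) (\<lambda>s. of_nat (lam i) powr (-s) * (pkern N s / s)) - (if lam i \<le> N then 2 * pi * \<i> else 0)))"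
          by (simp add: sum_subtractf[symmetric] algebra_simps)
        also have "norm \<dots> \<le> (\<Sum>i\<in>F. norm (a i) * (K / T * real (lam i) powr (-\<sigma>)))"
        proof (intro sum_norm_le)
          fix i assume "i \<in> F"
          hence "norm (contour_integral (vline \<sigma> T) (\<lambda>s. of_nat (lam i) powr (-s) * (pkern N s / s)) - (if lam i \<le> N then 2 * pi * \<i> else 0))
                  \<le> K / T * real (lam i) powr (-\<sigma>)"
            unfolding K_def using F lam N \<sigma> T by (intro perron_pkern) auto
          thus "norm (a i * (contour_integral (vline \<sigma> T) (\<lambda>s. of_nat (lam i) powr (-s) * (pkern N s / s)) - (if lam i \<le> N then 2 * pi * \<i> else 0)))
                  \<le> norm (a i) * (K / T * real (lam i) powr (-\<sigma>))"
            unfolding norm_mult by (intro mult_left_mono) auto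
        qed
        also have "\<dots> = K / T * (\<Sum>i\<in>F. b i)" by (simp add: b_def sum_distrib_left mult_ac)
        also have "(\<Sum>i\<in>F. b i) \<le> B"
          unfolding B_def by (intro finite_sum_le_infsum bs) (use F in \<open>auto simp: b_def\<close>)
        finally show "norm (contour_integral (vline \<sigma> T) (\<lambda>s. \<Sum>i\<in>F. f i s)
              - (\<Sum>i\<in>F. (if lam i \<le> N then 2 * pi * \<i> else 0) * a i)) \<le> K * B / T"
          using T by (simp add: mult_left_mono K_def divide_right_mono)
      qed
    qed auto
  qed
  show ?thesis unfolding J_def[symmetric]
  proof (rule Lim_null_comparison[THEN LIM_zero_cancel])
    show "\<forall>\<^sub>F T in at_top. norm (contour_integral (vline \<sigma> T) (\<lambda>s. A s * (pkern N s / s)) - 2 * pi * \<i> * infsum a J) \<le> K * B / T"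
      using eventually_ge_at_top[of "max 2 \<sigma>"] by eventually_elim (rule bound)
    show "((\<lambda>T. K * B / T) \<longlongrightarrow> 0) at_top"
      by (intro real_tendsto_divide_at_top[OF tendsto_const] filterlim_ident)
  qed
qed

lemma integral_powr_tail:
  fixes \<eta> T :: real
  assumes "0 < \<eta>" "0 < T"
  shows "((\<lambda>v. (1 + \<bar>v\<bar>) powr (-1-\<eta>)) has_integral 2 * (1 - (1 + T) powr (-\<eta>)) / \<eta>) {-T..T}"
proof -
  have e: "-1 - \<eta> = -\<eta> - 1" by simp
  have pos: "((\<lambda>v. (1 + \<bar>v\<bar>) powr (-1-\<eta>)) has_integral (1 - (1 + T) powr (-\<eta>)) / \<eta>) {0..T}"
  proof -
    have "((\<lambda>v. (1 + v) powr (-1-\<eta>)) has_integral (- ((1 + T) powr (-\<eta>)) / \<eta> - (- ((1 + 0) powr (-\<eta>)) / \<eta>))) {0..T}"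
    proof (rule fundamental_theorem_of_calculus[where f = "\<lambda>v::real. - ((1 + v) powr (-\<eta>)) / \<eta>"])
      fix v assume "v \<in> {0..T}"
      thus "((\<lambda>v. - ((1 + v) powr (-\<eta>)) / \<eta>) has_vector_derivative (1 + v) powr (-1-\<eta>)) (at v within {0..T})"
        using assms unfolding has_real_derivative_iff_has_vector_derivative[symmetric]
        by (auto intro!: derivative_eq_intros simp: e)
    qed (use assms in auto)
    hence "((\<lambda>v. (1 + v) powr (-1-\<eta>)) has_integral (1 - (1 + T) powr (-\<eta>)) / \<eta>) {0..T}"
      by (simp add: diff_divide_distrib)
    thus ?thesis by (rule has_integral_eq[rotated]) auto
  qed
  have "((\<lambda>v. (1 + \<bar>-v\<bar>) powr (-1-\<eta>)) has_integral (1 - (1 + T) powr (-\<eta>)) / \<eta>) {-T..-0}"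
    using has_integral_reflect_real[of "\<lambda>v. (1 + \<bar>v\<bar>) powr (-1-\<eta>)" _ T 0] pos by simp
  hence neg: "((\<lambda>v. (1 + \<bar>v\<bar>) powr (-1-\<eta>)) has_integral (1 - (1 + T) powr (-\<eta>)) / \<eta>) {-T..0}" by simp
  have "((\<lambda>v. (1 + \<bar>v\<bar>) powr (-1-\<eta>)) has_integral (1 - (1 + T) powr (-\<eta>)) / \<eta> + (1 - (1 + T) powr (-\<eta>)) / \<eta>) {-T..T}"
    by (rule has_integral_combine[OF _ _ neg pos]) (use assms in auto)
  thus ?thesis by simp
qed

lemma vline_integral_powr_bound:
  assumes "0 < \<eta>" "0 < T" "0 \<le> B" "\<And>z. Re z = \<sigma> \<Longrightarrow> isCont f z"
    and bnd: "\<And>v. norm (f (Complex \<sigma> v)) \<le> B * (1 + \<bar>v\<bar>) powr (-1-\<eta>)"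
  shows "norm (contour_integral (vline \<sigma> T) f) \<le> 2 * B / \<eta>"
proof -
  have cont: "continuous_on {-T..T} (\<lambda>v. f (Complex \<sigma> v))"
  proof -
    have "continuous_on {z. Re z = \<sigma>} f"
      using assms(4) by (auto intro: continuous_at_imp_continuous_on)
    moreover have "continuous_on {-T..T} (\<lambda>v. of_real \<sigma> + \<i> * of_real v)"
      by (intro continuous_intros)
    ultimately have "continuous_on {-T..T} (\<lambda>v. f (of_real \<sigma> + \<i> * of_real v))"
      by (rule continuous_on_compose2) auto
    thus ?thesis by (simp add: Complex_eq)
  qed
  note hi = has_integral_mult_right[OF integral_powr_tail[OF assms(1,2)], of B]
  have "contour_integral (vline \<sigma> T) f = \<i> * integral {-T..T} (\<lambda>v. f (Complex \<sigma> v))"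
    unfolding vline_def by (rule contour_integral_linepath_same_Re) (use assms in auto)
  hence "norm (contour_integral (vline \<sigma> T) f) = norm (integral {-T..T} (\<lambda>v. f (Complex \<sigma> v)))"
    by (simp add: norm_mult)
  also have "\<dots> \<le> integral {-T..T} (\<lambda>v. B * (1 + \<bar>v\<bar>) powr (-1-\<eta>))"
    by (intro integral_norm_bound_integral integrable_continuous_real cont bnd has_integral_integrable[OF hi])
  also have "\<dots> = B * (2 * (1 - (1 + T) powr (-\<eta>)) / \<eta>)"
    by (rule integral_unique[OF hi])
  also have "\<dots> \<le> B * (2 * 1 / \<eta>)"
    using assms by (intro mult_left_mono divide_right_mono) auto
  finally show ?thesis by (simp add: mult_ac)
qed

text \<open>\<open>H\<close> is the integrand extended over its removable singularities: callers
  cancel the poles beforehand, so the rectangle contributes no residue. The assumption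
  \<open>dec\<close> makes the horizontal sides vanish as T grows, and its \<open>C\<close> does not
  enter the conclusion; the final bound comes from \<open>bnd\<close> on the new line.\<close>

theorem perron_shift:
  fixes a :: "'i \<Rightarrow> complex" and lam :: "'i \<Rightarrow> nat"
  assumes sum: "\<And>s. Re s = \<sigma> \<Longrightarrow> ((\<lambda>i. a i * of_nat (lam i) powr (-s)) has_sum A s) I"
    and lam: "\<And>i. i \<in> I \<Longrightarrow> 0 < lam i" and N: "0 < N" and \<sigma>: "0 < \<sigma>" "\<sigma>' \<le> \<sigma>"
    and H: "H holomorphic_on S" "open S" "\<And>s. \<sigma>' \<le> Re s \<Longrightarrow> Re s \<le> \<sigma> \<Longrightarrow> s \<in> S"
    and HA: "\<And>s. Re s = \<sigma> \<Longrightarrow> H s = A s * (pkern N s / s)"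
    and dec: "\<And>s. \<sigma>' \<le> Re s \<Longrightarrow> Re s \<le> \<sigma> \<Longrightarrow> \<bar>Im s\<bar> \<ge> T0 \<Longrightarrow> norm (H s) \<le> C / \<bar>Im s\<bar>"
    and \<eta>: "0 < \<eta>" and B: "0 \<le> B"
    and bnd: "\<And>v. norm (H (Complex \<sigma>' v)) \<le> B * (1 + \<bar>v\<bar>) powr (-1-\<eta>)"
  shows "norm (\<Sum>\<^sub>\<infinity>i\<in>{i \<in> I. lam i \<le> N}. a i) \<le> B / \<eta>"
proof -
  define X where "X = (\<Sum>\<^sub>\<infinity>i\<in>{i \<in> I. lam i \<le> N}. a i)"
  have cont: "isCont H z" if "\<sigma>' \<le> Re z" "Re z \<le> \<sigma>" for z
    using H that by (metis continuous_on_eq_continuous_at holomorphic_on_imp_continuous_on)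
  have lim: "((\<lambda>T. contour_integral (vline \<sigma> T) H) \<longlongrightarrow> 2 * pi * \<i> * X) at_top"
  proof (rule Lim_transform_eventually)
    show "((\<lambda>T. contour_integral (vline \<sigma> T) (\<lambda>s. A s * (pkern N s / s))) \<longlongrightarrow> 2 * pi * \<i> * X) at_top"
      unfolding X_def by (rule perron_infsum[OF sum]) (use lam N \<sigma> in auto)
    show "\<forall>\<^sub>F T in at_top. contour_integral (vline \<sigma> T) (\<lambda>s. A s * (pkern N s / s)) = contour_integral (vline \<sigma> T) H"
      by (intro always_eventually allI contour_integral_eq)
         (auto simp: HA vline_def in_closed_segment_vertical)
  qed
  define C' where "C' = \<bar>C\<bar>"
  have ev: "norm (contour_integral (vline \<sigma> T) H) \<le> 2 * B / \<eta> + 2 * (C' / T) * (\<sigma> - \<sigma>')" if T: "T \<ge> max 1 T0" for T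
  proof -
    have "(H has_contour_integral 0) (rectpath (Complex \<sigma>' (-T)) (Complex \<sigma> T))"
    proof (rule Cauchy_theorem_convex_simple[where S = "cbox (Complex \<sigma>' (-T)) (Complex \<sigma> T)"])
      show "H holomorphic_on cbox (Complex \<sigma>' (-T)) (Complex \<sigma> T)"
        by (rule holomorphic_on_subset[OF H(1)]) (auto simp: cbox_def Basis_complex_def inner_complex_def intro!: H(3))
      show "path_image (rectpath (Complex \<sigma>' (- T)) (Complex \<sigma> T)) \<subseteq> cbox (Complex \<sigma>' (- T)) (Complex \<sigma> T)"
        by (rule path_image_rectpath_subset_cbox) (use \<sigma> T in auto)
    qed auto
    hence "norm (contour_integral (vline \<sigma> T) H - contour_integral (vline \<sigma>' T) H - 0) \<le> 2 * (C' / T) * (\<sigma> - \<sigma>')"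
    proof (rule rectangle_vline_bound[rotated 4])
      fix z assume z: "\<sigma>' \<le> Re z" "Re z \<le> \<sigma>" "\<bar>Im z\<bar> = T"
      have "norm (H z) \<le> C / \<bar>Im z\<bar>" by (rule dec) (use z T in auto)
      also have "\<dots> \<le> C' / T" using z T by (auto simp: C'_def intro!: divide_right_mono)
      finally show "norm (H z) \<le> C' / T" .
    qed (use \<sigma> T in \<open>auto simp: C'_def intro!: cont\<close>)
    moreover have "norm (contour_integral (vline \<sigma>' T) H) \<le> 2 * B / \<eta>"
      by (rule vline_integral_powr_bound) (use \<eta> B \<sigma> T in \<open>auto intro!: cont bnd\<close>)
    ultimately show ?thesis
      using norm_triangle_ineq[of "contour_integral (vline \<sigma> T) H - contour_integral (vline \<sigma>' T) H" "contour_integral (vline \<sigma>' T) H"] by simp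
  qed
  have "((\<lambda>T. 2 * B / \<eta> + 2 * (C' / T) * (\<sigma> - \<sigma>')) \<longlongrightarrow> 2 * B / \<eta> + 2 * 0 * (\<sigma> - \<sigma>')) at_top"
    by (intro tendsto_intros real_tendsto_divide_at_top[OF tendsto_const] filterlim_ident)
  hence "norm (2 * pi * \<i> * X) \<le> 2 * B / \<eta> + 2 * 0 * (\<sigma> - \<sigma>')"
    by (rule tendsto_le[OF _ _ tendsto_norm[OF lim], rotated])
       (use eventually_ge_at_top[of "max 1 T0"] in \<open>rule eventually_mono\<close>, rule ev, auto)
  hence "pi * norm X \<le> B / \<eta>" by (simp add: norm_mult)
  moreover have "1 * norm X \<le> pi * norm X" using pi_gt3 by (intro mult_right_mono) auto
  ultimately show ?thesis by (simp add: X_def)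
qed

section \<open>Sums of holomorphic functions and the series of zeta\<close>

lemma
  fixes f :: "'i \<Rightarrow> complex \<Rightarrow> complex"
  assumes "open S" and hol: "\<And>i. i \<in> I \<Longrightarrow> f i holomorphic_on S"
    and le: "\<And>i z. i \<in> I \<Longrightarrow> z \<in> S \<Longrightarrow> norm (f i z) \<le> M i" and M: "M summable_on I"
  shows holomorphic_infsum: "(\<lambda>z. \<Sum>\<^sub>\<infinity>i\<in>I. f i z) holomorphic_on S"
    and deriv_infsum: "\<And>z. z \<in> S \<Longrightarrow> ((\<lambda>i. deriv (f i) z) has_sum deriv (\<lambda>z. \<Sum>\<^sub>\<infinity>i\<in>I. f i z) z) I"
proof -
  have ul: "uniform_limit S (\<lambda>F z. \<Sum>i\<in>F. f i z) (\<lambda>z. \<Sum>\<^sub>\<infinity>i\<in>I. f i z) (finite_subsets_at_top I)"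
    by (rule Weierstrass_m_test_general[OF le M])
  have ev: "\<forall>\<^sub>F F in finite_subsets_at_top I. (\<lambda>z. \<Sum>i\<in>F. f i z) holomorphic_on S"
    by (rule eventually_finite_subsets_at_top_weakI) (auto intro!: holomorphic_on_sum hol)
  show "(\<lambda>z. \<Sum>\<^sub>\<infinity>i\<in>I. f i z) holomorphic_on S"
  proof (subst holomorphic_on_open[OF \<open>open S\<close>], intro ballI)
    fix z assume "z \<in> S"
    then obtain r where r: "r > 0" "cball z r \<subseteq> S"
      using \<open>open S\<close> by (meson open_contains_cball)
    have "(\<lambda>z. \<Sum>\<^sub>\<infinity>i\<in>I. f i z) holomorphic_on ball z r"
    proof (rule holomorphic_uniform_limit)
      show "uniform_limit (cball z r) (\<lambda>F z. \<Sum>i\<in>F. f i z) (\<lambda>z. \<Sum>\<^sub>\<infinity>i\<in>I. f i z) (finite_subsets_at_top I)"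
        by (rule uniform_limit_on_subset[OF ul r(2)])
      show "\<forall>\<^sub>F F in finite_subsets_at_top I. continuous_on (cball z r) (\<lambda>z. \<Sum>i\<in>F. f i z) \<and>
              (\<lambda>z. \<Sum>i\<in>F. f i z) holomorphic_on ball z r"
        using ev
      proof eventually_elim
        case (elim F)
        thus ?case using r
          by (meson ball_subset_cball holomorphic_on_imp_continuous_on holomorphic_on_subset subset_trans)
      qed
    qed auto
    thus "\<exists>f'. ((\<lambda>z. \<Sum>\<^sub>\<infinity>i\<in>I. f i z) has_field_derivative f') (at z)"
      using r(1) by (auto simp: holomorphic_on_open)
  qed
  fix z assume z: "z \<in> S"
  have "((\<lambda>F. deriv (\<lambda>z. \<Sum>i\<in>F. f i z) z) \<longlongrightarrow> deriv (\<lambda>z. \<Sum>\<^sub>\<infinity>i\<in>I. f i z) z) (finite_subsets_at_top I)"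
    by (rule deriv_complex_uniform_limit[OF ul ev]) (use assms z in auto)
  also have "?this \<longleftrightarrow> ((\<lambda>F. \<Sum>i\<in>F. deriv (f i) z) \<longlongrightarrow> deriv (\<lambda>z. \<Sum>\<^sub>\<infinity>i\<in>I. f i z) z) (finite_subsets_at_top I)"
  proof (intro filterlim_cong refl eventually_finite_subsets_at_top_weakI)
    fix F assume "finite F" "F \<subseteq> I"
    thus "deriv (\<lambda>z. \<Sum>i\<in>F. f i z) z = (\<Sum>i\<in>F. deriv (f i) z)"
      using hol z \<open>open S\<close> by (intro DERIV_imp_deriv DERIV_sum) (auto intro: holomorphic_derivI)
  qed
  finally show "((\<lambda>i. deriv (f i) z) has_sum deriv (\<lambda>z. \<Sum>\<^sub>\<infinity>i\<in>I. f i z) z) I"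
    by (simp add: has_sum_def)
qed

lemma summable_on_nat_powr: "1 < \<sigma> \<Longrightarrow> (\<lambda>n::nat. real n powr (-\<sigma>)) summable_on A"
  by (rule summable_on_subset[OF norm_summable_imp_summable_on[where f = "\<lambda>n. real n powr (-\<sigma>)"]])
     (auto simp: summable_real_powr_iff)

lemma norm_nat_powr: "0 < n \<Longrightarrow> norm (of_nat n powr s :: complex) = real n powr Re s"
  by (simp add: norm_powr_real_powr)

lemma summable_on_nat_powr_complex:
  assumes "1 < Re s" shows "(\<lambda>n::nat. of_nat n powr (-s) :: complex) summable_on {1..}"
proof -
  have "(\<lambda>n::nat. norm (of_nat n powr (-s) :: complex)) summable_on {1..}"
    using summable_on_nat_powr[OF assms, of "{1..}"]
    by (rule summable_on_cong[THEN iffD1, rotated]) (simp add: norm_nat_powr)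
  thus ?thesis by (simp add: summable_on_iff_abs_summable_on_complex)
qed

text \<open>A separate name, because \<open>zeta\<close> is a choice: its properties become
  available only after some continuation of this series has been constructed.\<close>

definition zseries :: "complex \<Rightarrow> complex" where
  "zseries s = (\<Sum>\<^sub>\<infinity>n::nat\<in>{1..}. of_nat n powr (-s))"

lemma has_sum_zseries: "1 < Re s \<Longrightarrow> ((\<lambda>n::nat. of_nat n powr (-s)) has_sum zseries s) {1..}"
  unfolding zseries_def by (intro has_sum_infsum summable_on_nat_powr_complex)

section \<open>Continuation of the zeta function\<close>

text \<open>The remainder of the Taylor expansion of \<open>u\<^sup>-\<^sup>w\<close> around \<open>u = n\<close>, taken at \<open>u = n + 1\<close>.\<close>

definition taylor_rem :: "nat \<Rightarrow> nat \<Rightarrow> complex \<Rightarrow> complex" where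
  "taylor_rem N n w = of_nat (n + 1) powr (-w)
     - (\<Sum>j\<le>N. (-1) ^ j * pochhammer w j / fact j * of_nat n powr (-w - of_nat j))"

text \<open>The next derivative of u^-w has a nonpositive real exponent by the hypothesis on
  \<open>Re w\<close>, so on [n, n + 1] its modulus is largest at u = n.\<close>

lemma taylor_rem_bound:
  assumes n: "0 < n" and w: "-real N - 1 \<le> Re w"
  shows "norm (taylor_rem N n w) \<le> norm (pochhammer w (N + 1)) * real n powr (-Re w - real N - 1)"
proof -
  define f where "f = (\<lambda>i z. (-1) ^ i * pochhammer w i * z powr (-w - of_nat i))"
  define S where "S = closed_segment (complex_of_real (real n)) (of_real (real n + 1))"
  have S: "Im z = 0 \<and> real n \<le> Re z" if "z \<in> S" for z
    using that unfolding S_def closed_segment_of_real by (auto simp: closed_segment_eq_real_ivl)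
  define B where "B = norm (pochhammer w (N + 1)) * real n powr (-Re w - real N - 1)"
  have "norm (f 0 (of_real (real n + 1)) - (\<Sum>i\<le>N. f i (of_real (real n)) * (of_real (real n + 1) - of_real (real n)) ^ i / fact i))
          \<le> B * norm (complex_of_real (real n + 1) - of_real (real n)) ^ Suc N / fact N"
  proof (rule complex_Taylor)
    show "convex S" unfolding S_def by (rule convex_closed_segment)
    show "(f i has_field_derivative f (Suc i) z) (at z within S)" if "z \<in> S" for i z
    proof (rule has_field_derivative_at_within)
      have "z \<notin> \<real>\<^sub>\<le>\<^sub>0" using S[OF that] n by (auto simp: complex_nonpos_Reals_iff)
      hence "((\<lambda>z. (-1) ^ i * pochhammer w i * z powr (-w - of_nat i)) has_field_derivative
               (-1) ^ i * pochhammer w i * ((-w - of_nat i) * z powr (-w - of_nat i - 1))) (at z)"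
        by (intro DERIV_cmult has_field_derivative_powr)
      also have "(-1) ^ i * pochhammer w i * ((-w - of_nat i) * z powr (-w - of_nat i - 1)) = f (Suc i) z"
        unfolding f_def pochhammer_Suc by (simp add: algebra_simps)
      finally show "(f i has_field_derivative f (Suc i) z) (at z)" unfolding f_def .
    qed
    show "norm (f (Suc N) z) \<le> B" if "z \<in> S" for z
    proof -
      have z: "z = of_real (Re z)" using S[OF that] by (auto simp: complex_eq_iff)
      have "norm (f (Suc N) z) = norm (pochhammer w (N + 1)) * Re z powr (-Re w - real N - 1)"
        using S[OF that] n by (subst z) (simp add: f_def norm_mult norm_power norm_powr_real_powr algebra_simps)
      also have "\<dots> \<le> B" unfolding B_def
        using S[OF that] n w by (intro mult_left_mono powr_mono2') auto
      finally show ?thesis .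
    qed
  qed (auto simp: S_def)
  also have "B * norm (complex_of_real (real n + 1) - of_real (real n)) ^ Suc N / fact N = B / fact N" by simp
  also have "B / fact N \<le> B / 1"
    unfolding B_def by (intro divide_left_mono) (auto simp: fact_ge_1)
  also have "f 0 (of_real (real n + 1)) - (\<Sum>i\<le>N. f i (of_real (real n)) * (of_real (real n + 1) - of_real (real n)) ^ i / fact i) = taylor_rem N n w"
    by (simp add: f_def taylor_rem_def add.commute)
  finally show ?thesis by (simp add: B_def)
qed

lemma summable_on_taylor_rem:
  assumes "-real N < Re w"
  shows "(\<lambda>n. taylor_rem N n w) summable_on {1..}"
proof -
  have "(\<lambda>n. norm (taylor_rem N n w)) summable_on {1..}"
  proof (rule summable_on_comparison_test)
    show "(\<lambda>n. norm (pochhammer w (N + 1)) * real n powr (-(Re w + real N + 1))) summable_on {1..}"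
      by (intro summable_on_cmult_right summable_on_nat_powr) (use assms in auto)
    show "norm (taylor_rem N n w) \<le> norm (pochhammer w (N + 1)) * real n powr (-(Re w + real N + 1))"
      if "n \<in> {1..}" for n
    proof -
      have "-(Re w + real N + 1) = -Re w - real N - 1" by simp
      thus ?thesis using taylor_rem_bound[of n N w] that assms by (simp only:) simp
    qed
  qed auto
  thus ?thesis by (simp add: summable_on_iff_abs_summable_on_complex)
qed

definition zrem :: "nat \<Rightarrow> complex \<Rightarrow> complex" where
  "zrem N w = (\<Sum>\<^sub>\<infinity>n\<in>{1..}. taylor_rem N n w)"

lemma holomorphic_zrem: "zrem N holomorphic_on {w. -real N < Re w}"
proof (subst holomorphic_on_open, rule open_halfspace_Re_gt, intro ballI)
  fix w0 assume "w0 \<in> {w. -real N < Re w}"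
  hence w0: "-real N < Re w0" by simp
  \<comment> \<open>Half the distance from \<open>w0\<close> to the boundary line: on the disc
    \<open>Re w + real N\<close> exceeds \<open>r\<close>, so the terms are dominated by multiples
    of n^-(1 + r).\<close>
  define r where "r = (Re w0 + real N) / 2"
  define S where "S = ball w0 r"
  have "compact ((\<lambda>w. pochhammer w (N + 1)) ` cball w0 r)"
    unfolding pochhammer_prod by (intro compact_continuous_image continuous_intros) auto
  then obtain P where "\<forall>x\<in>(\<lambda>w. pochhammer w (N + 1)) ` cball w0 r. norm x \<le> P"
    unfolding bounded_iff[symmetric] using compact_imp_bounded bounded_iff by metis
  hence P: "norm (pochhammer w (N + 1)) \<le> P" if "w \<in> cball w0 r" for w
    using that by blast
  have "zrem N holomorphic_on S" unfolding zrem_def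
  proof (rule holomorphic_infsum)
    show "(\<lambda>n. P * real n powr (-(1 + r))) summable_on {1..}"
      by (intro summable_on_cmult_right summable_on_nat_powr) (use w0 in \<open>auto simp: r_def\<close>)
    fix n :: nat assume n: "n \<in> {1..}"
    thus "taylor_rem N n holomorphic_on S"
      unfolding taylor_rem_def pochhammer_prod by (intro holomorphic_intros) auto
    fix w assume w: "w \<in> S"
    have "\<bar>Re (w0 - w)\<bar> \<le> norm (w0 - w)" by (rule abs_Re_le_cmod)
    also have "\<dots> < r" using w by (simp add: S_def dist_norm)
    finally have Re: "Re w + real N > r" using w0 by (simp add: r_def abs_if field_simps split: if_splits)
    moreover have "r > 0" using w0 by (simp add: r_def)
    ultimately have "norm (taylor_rem N n w) \<le> norm (pochhammer w (N + 1)) * real n powr (-Re w - real N - 1)"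
      using n by (intro taylor_rem_bound) auto
    also have "\<dots> \<le> P * real n powr (-(1 + r))"
      using n Re w P[of w] order_trans[OF norm_ge_zero P[of w]]
      by (intro mult_mono powr_mono) (auto simp: S_def)
    finally show "norm (taylor_rem N n w) \<le> P * real n powr (-(1 + r))" .
  qed (auto simp: S_def)
  thus "\<exists>f'. (zrem N has_field_derivative f') (at w0)"
    unfolding S_def using w0 by (auto simp: holomorphic_on_open r_def)
qed

text \<open>The terms are those of \<open>taylor_rem 0\<close> with opposite sign, which yields
  unconditional summability; the value comes from the ordinary telescoping series, as n^-w tends to
  0.\<close>

lemma telescope_powr:
  assumes "0 < Re w"
  shows "((\<lambda>n::nat. of_nat n powr (-w) - of_nat (n + 1) powr (-w)) has_sum 1) {1..}"
proof -
  let ?f = "\<lambda>n::nat. of_nat n powr (-w) - of_nat (n + 1) powr (-w) :: complex"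
  have "(\<lambda>n. -taylor_rem 0 n w) summable_on {1..}"
    using summable_on_taylor_rem[of 0 w] assms by (simp add: summable_on_uminus)
  hence "?f summable_on {1..}" by (simp add: taylor_rem_def)
  hence "(?f has_sum infsum ?f {1..}) {1..}" by (rule has_sum_infsum)
  moreover have bij: "bij_betw Suc UNIV {1..}"
    by (rule bij_betwI[of _ _ _ "\<lambda>n. n - 1"]) auto
  ultimately have "((\<lambda>n. ?f (Suc n)) has_sum infsum ?f {1..}) UNIV"
    by (subst has_sum_reindex_bij_betw[OF bij, of ?f])
  hence "(\<lambda>n. ?f (Suc n)) sums infsum ?f {1..}" by (rule has_sum_imp_sums)
  moreover have "(\<lambda>n. ?f (Suc n)) sums (of_nat (Suc 0) powr (-w) - 0)"
  proof -
    have "(\<lambda>n. norm (of_nat (Suc n) powr (-w) :: complex)) \<longlonglongrightarrow> 0"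
    proof -
      have "(\<lambda>n. real (Suc n) powr (-Re w)) \<longlonglongrightarrow> 0"
        by (intro tendsto_neg_powr assms filterlim_compose[OF filterlim_real_sequentially] filterlim_Suc) (use assms in auto)
      thus ?thesis by (simp add: norm_nat_powr del: of_nat_Suc)
    qed
    hence "(\<lambda>n. of_nat (Suc n) powr (-w) :: complex) \<longlonglongrightarrow> 0" by (rule tendsto_norm_zero_cancel)
    from telescope_sums'[OF this] show ?thesis by simp
  qed
  ultimately have "infsum ?f {1..} = 1" by (simp add: sums_iff)
  with \<open>(?f has_sum infsum ?f {1..}) {1..}\<close> show ?thesis by simp
qed

lemma has_sum_sum_finite:
  fixes f :: "'i \<Rightarrow> 'j \<Rightarrow> 'b :: {topological_comm_monoid_add}"
  assumes "\<And>j. j \<in> J \<Longrightarrow> (f j has_sum s j) I"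
  shows "((\<lambda>i. \<Sum>j\<in>J. f j i) has_sum (\<Sum>j\<in>J. s j)) I"
  using assms by (induction J rule: infinite_finite_induct) (auto intro!: has_sum_add)

text \<open>Insert the Taylor expansions into the telescoping sum \<open>1 = \<Sum>\<^sub>n (n\<^sup>-\<^sup>w - (n + 1)\<^sup>-\<^sup>w)\<close>. Every
  term on the right-hand side except \<open>zrem\<close> is a value further to the right.\<close>

lemma zseries_recurrence:
  assumes w: "0 < Re w" and N: "1 \<le> N"
  shows "w * zseries (w + 1) = 1 + (\<Sum>j=2..N. (-1) ^ j * pochhammer w (j - 1) / fact j *
           ((w + of_nat (j - 1)) * zseries (w + of_nat (j - 1) + 1))) + zrem N w"
proof -
  define c where "c = (\<lambda>j. (-1) ^ j * pochhammer w j / fact j :: complex)"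
  have h: "((\<lambda>n::nat. c j * of_nat n powr (-w - of_nat j)) has_sum c j * zseries (w + of_nat j)) {1..}"
    if "j \<in> {1..N}" for j
    using has_sum_zseries[of "w + of_nat j"] w that by (intro has_sum_cmult_right) simp
  have "((\<lambda>n::nat. (\<Sum>j=1..N. c j * of_nat n powr (-w - of_nat j)) + taylor_rem N n w) has_sum
      ((\<Sum>j=1..N. c j * zseries (w + of_nat j)) + zrem N w)) {1..}"
    unfolding zrem_def
    by (intro has_sum_add has_sum_infsum summable_on_taylor_rem has_sum_sum_finite h) (use w in auto)
  also have "(\<lambda>n::nat. (\<Sum>j=1..N. c j * of_nat n powr (-w - of_nat j)) + taylor_rem N n w) =
             (\<lambda>n. - (of_nat n powr (-w) - of_nat (n + 1) powr (-w)))"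
  proof
    fix n :: nat
    have "(\<Sum>j\<le>N. c j * of_nat n powr (-w - of_nat j)) = of_nat n powr (-w) + (\<Sum>j=1..N. c j * of_nat n powr (-w - of_nat j))"
      by (simp add: atMost_atLeast0 sum.atLeast_Suc_atMost c_def)
    thus "(\<Sum>j=1..N. c j * of_nat n powr (-w - of_nat j)) + taylor_rem N n w = - (of_nat n powr (-w) - of_nat (n + 1) powr (-w))"
      by (simp add: taylor_rem_def c_def)
  qed
  finally have "((\<Sum>j=1..N. c j * zseries (w + of_nat j)) + zrem N w) = -1"
    by (rule has_sum_unique) (intro has_sum_uminusI telescope_powr w)
  \<comment> \<open>The term \<open>j = 1\<close> has the coefficient \<open>c 1 = -w\<close>; it is
    the one solved for.\<close>
  moreover have "(\<Sum>j=1..N. c j * zseries (w + of_nat j)) = - w * zseries (w + 1) + (\<Sum>j=2..N. c j * zseries (w + of_nat j))"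
    using N by (simp add: sum.atLeast_Suc_atMost c_def numeral_2_eq_2)
  \<comment> \<open>Splitting off the last factor of the Pochhammer symbol leaves every zeta value
    multiplied by the factor that cancels its pole, which is the shape of the left-hand
    side.\<close>
  moreover have "(\<Sum>j=2..N. c j * zseries (w + of_nat j)) = (\<Sum>j=2..N. (-1) ^ j * pochhammer w (j - 1) / fact j *
           ((w + of_nat (j - 1)) * zseries (w + of_nat (j - 1) + 1)))"
  proof (intro sum.cong refl)
    fix j assume "j \<in> {2..N}"
    then obtain i where [simp]: "j = Suc i" by (cases j) auto
    show "c j * zseries (w + of_nat j) = (-1) ^ j * pochhammer w (j - 1) / fact j *
           ((w + of_nat (j - 1)) * zseries (w + of_nat (j - 1) + 1))"
      by (simp add: c_def pochhammer_Suc add_ac)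
  qed
  moreover have "w * z = 1 + y' + r" if "x + r = -1" "x = -w * z + y" "y = y'" for x y y' z r
  proof -
    have "1 + y' + r = x + r + 1 + w * z" using that(2,3) by simp
    thus ?thesis using that(1) by simp
  qed
  ultimately show ?thesis by blast
qed

lemma holomorphic_zseries: "zseries holomorphic_on {s. 1 < Re s}"
proof (subst holomorphic_on_open, rule open_halfspace_Re_gt, intro ballI)
  fix s assume "s \<in> {s. 1 < Re s}"
  hence s: "1 < Re s" by simp
  define \<sigma> where "\<sigma> = (1 + Re s) / 2"
  have "\<sigma> < Re s" using s by (simp add: \<sigma>_def)
  have "zseries holomorphic_on {s. \<sigma> < Re s}" unfolding zseries_def
  proof (rule holomorphic_infsum)
    show "open {s. \<sigma> < Re s}" by (rule open_halfspace_Re_gt)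
    show "(\<lambda>n. real n powr (-\<sigma>)) summable_on {1..}"
      by (rule summable_on_nat_powr) (use s in \<open>auto simp: \<sigma>_def\<close>)
    show "norm (of_nat n powr (-z) :: complex) \<le> real n powr (-\<sigma>)" if "n \<in> {1..}" "z \<in> {s. \<sigma> < Re s}" for n z
      using that by (auto simp: norm_nat_powr intro!: powr_mono)
    show "(\<lambda>z. of_nat n powr (-z) :: complex) holomorphic_on {s. \<sigma> < Re s}" if "n \<in> {1..}" for n :: nat
      using that by (intro holomorphic_intros) auto
  qed
  thus "\<exists>f'. (zseries has_field_derivative f') (at s)"
    using \<open>\<sigma> < Re s\<close> by (auto simp: holomorphic_on_open open_halfspace_Re_gt)
qed

text \<open>Continuing \<open>w * zseries (w + 1)\<close> instead of the series itself removes the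
  pole. The recurrence expresses the value at \<open>w\<close> by those at \<open>w + 1\<close>,
  ..., \<open>w + m\<close> and by \<open>zrem (Suc m)\<close>, which is holomorphic one unit
  further left, so each induction step gains a strip of width 1.\<close>

lemma zseries_continuation_halfplane:
  "\<exists>E. E holomorphic_on {w. -real m < Re w} \<and> (\<forall>w. 0 < Re w \<longrightarrow> E w = w * zseries (w + 1))"
proof (induction m)
  case 0
  have "(zseries \<circ> (\<lambda>w. w + 1)) holomorphic_on {w. 0 < Re w}"
    by (rule holomorphic_on_compose_gen[OF _ holomorphic_zseries]) (auto intro!: holomorphic_intros)
  hence "(\<lambda>w. w * zseries (w + 1)) holomorphic_on {w. 0 < Re w}"
    by (intro holomorphic_intros) (simp add: o_def)
  thus ?case by auto
next
  case (Suc m)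
  then obtain E where E: "E holomorphic_on {w. -real m < Re w}" "\<And>w. 0 < Re w \<Longrightarrow> E w = w * zseries (w + 1)" by blast
  define E' where "E' = (\<lambda>w. 1 + (\<Sum>j=2..Suc m. (-1) ^ j * pochhammer w (j - 1) / fact j * E (w + of_nat (j - 1))) + zrem (Suc m) w)"
  have "(\<lambda>w. E (w + of_nat (j - 1))) holomorphic_on {w. -real (Suc m) < Re w}" if "j \<in> {2..Suc m}" for j
  proof -
    have "(E \<circ> (\<lambda>w. w + of_nat (j - 1))) holomorphic_on {w. -real (Suc m) < Re w}"
      by (rule holomorphic_on_compose_gen[OF _ E(1)]) (use that in \<open>auto intro!: holomorphic_intros\<close>)
    thus ?thesis by (simp add: o_def)
  qed
  hence "E' holomorphic_on {w. -real (Suc m) < Re w}"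
    unfolding E'_def pochhammer_prod by (intro holomorphic_intros holomorphic_zrem) auto
  moreover have "E' w = w * zseries (w + 1)" if "0 < Re w" for w
  proof -
    have "E (w + of_nat (j - 1)) = (w + of_nat (j - 1)) * zseries (w + of_nat (j - 1) + 1)" for j
      using that by (intro E(2)) simp
    thus ?thesis unfolding E'_def by (simp only:) (rule zseries_recurrence[symmetric], use that in auto)
  qed
  ultimately show ?case by blast
qed

text \<open>All the continuations agree with the series on \<open>0 < Re w\<close>, hence with each
  other by the identity theorem, and they glue.\<close>

lemma zseries_continuation:
  "\<exists>E. E holomorphic_on UNIV \<and> (\<forall>w. 0 < Re w \<longrightarrow> E w = w * zseries (w + 1))"
proof -
  obtain E where E: "\<And>m. E m holomorphic_on {w. -real m < Re w}" "\<And>m w. 0 < Re w \<Longrightarrow> E m w = w * zseries (w + 1)"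
    using zseries_continuation_halfplane by metis
  have eq: "E m w = E m' w" if "m \<le> m'" "-real m < Re w" for m m' w
  proof (rule analytic_continuation_open[where s = "{w. 0 < Re w}" and s' = "{w. -real m < Re w}" and f = "E m" and g = "E m'"])
    show "E m' holomorphic_on {w. -real m < Re w}"
      by (rule holomorphic_on_subset[OF E(1)]) (use that in auto)
    show "{w. 0 < Re w} \<noteq> {}" by (auto intro!: exI[of _ 1])
    show "connected {w. -real m < Re w}" by (intro convex_connected convex_halfspace_Re_gt)
  qed (use that E in \<open>auto simp: open_halfspace_Re_gt\<close>)
  \<comment> \<open>The index is chosen so that \<open>w\<close> lies in the half-plane on which the
    selected function is holomorphic.\<close>
  define F where "F = (\<lambda>w. E (nat \<lceil>-Re w\<rceil> + 1) w)"
  have F: "F w = E m w" if "-real m < Re w" for w m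
  proof -
    have "-real (nat \<lceil>-Re w\<rceil> + 1) < Re w" by linarith
    thus ?thesis unfolding F_def using eq[of m "nat \<lceil>-Re w\<rceil> + 1" w] eq[of "nat \<lceil>-Re w\<rceil> + 1" m w] that
      by (cases "m \<le> nat \<lceil>-Re w\<rceil> + 1") auto
  qed
  have "F holomorphic_on UNIV"
  proof (subst holomorphic_on_open, rule open_UNIV, intro ballI)
    fix w
    obtain m where m: "-Re w < real m" using reals_Archimedean2 by blast
    have "F holomorphic_on {w. -real m < Re w}"
      using E(1)[of m] by (rule holomorphic_transform) (auto simp: F)
    thus "\<exists>f'. (F has_field_derivative f') (at w)"
      using m by (auto simp: holomorphic_on_open open_halfspace_Re_gt)
  qed
  moreover have "F w = w * zseries (w + 1)" if "0 < Re w" for w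
    using F[of 0 w] E(2)[of w 0] that by simp
  ultimately show ?thesis by blast
qed

text \<open>Dividing the entire function \<open>E (s - 1)\<close> by \<open>s - 1\<close> produces a
  witness for the choice in \<open>zeta\<close>, from which its defining properties follow.\<close>

lemma
  holomorphic_zeta: "zeta holomorphic_on (-{1})" and
  has_sum_zeta: "1 < Re s \<Longrightarrow> ((\<lambda>n::nat. of_nat n powr (-s)) has_sum zeta s) {1..}"
proof -
  obtain E where E: "E holomorphic_on UNIV" "\<And>w. 0 < Re w \<Longrightarrow> E w = w * zseries (w + 1)"
    using zseries_continuation by blast
  define f where "f = (\<lambda>s. E (s - 1) / (s - 1))"
  have "(E \<circ> (\<lambda>s. s - 1)) holomorphic_on (-{1})"
    by (rule holomorphic_on_compose_gen[OF _ E(1)]) (auto intro!: holomorphic_intros)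
  hence "f holomorphic_on (-{1})"
    unfolding f_def by (intro holomorphic_intros) (auto simp: o_def)
  moreover have "((\<lambda>n::nat. of_nat n powr (-s)) has_sum f s) {1..}" if "1 < Re s" for s
  proof -
    have "s - 1 \<noteq> 0" using that by auto
    hence "f s = zseries s" using E(2)[of "s - 1"] that by (simp add: f_def)
    thus ?thesis using has_sum_zseries[OF that] by simp
  qed
  ultimately have "\<exists>f. f holomorphic_on (-{1}) \<and> (\<forall>s. 1 < Re s \<longrightarrow> ((\<lambda>n::nat. of_nat n powr (-s)) has_sum f s) {1..})"
    by blast
  from someI_ex[OF this] show "zeta holomorphic_on (-{1})"
    unfolding zeta_def by blast
  show "((\<lambda>n::nat. of_nat n powr (-s)) has_sum zeta s) {1..}" if "1 < Re s"
    using someI_ex[OF \<open>\<exists>f. f holomorphic_on (-{1}) \<and> _ f\<close>] that unfolding zeta_def by blast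
qed

text \<open>\<open>zeta1 s\<close> is \<open>(s - 1) \<zeta>(s)\<close> without the singularity at \<open>1\<close>, for \<open>Re s > 0\<close>.\<close>

definition zeta1 :: "complex \<Rightarrow> complex" where
  "zeta1 s = 1 + zrem 1 (s - 1)"

lemma holomorphic_zeta1: "zeta1 holomorphic_on {s. 0 < Re s}"
proof -
  have "(zrem 1 \<circ> (\<lambda>s. s - 1)) holomorphic_on {s. 0 < Re s}"
    by (rule holomorphic_on_compose_gen[OF _ holomorphic_zrem]) (auto intro!: holomorphic_intros)
  thus ?thesis unfolding zeta1_def[abs_def] by (intro holomorphic_intros) (simp add: o_def)
qed

lemma zeta1_1 [simp]: "zeta1 1 = 1"
proof -
  have "taylor_rem 1 n 0 = 0" if "n \<in> {1..}" for n
    using that of_nat_neq_0[of n, where 'a = complex] by (simp add: taylor_rem_def)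
  hence "zrem 1 0 = 0" unfolding zrem_def by (rule infsum_0)
  thus ?thesis by (simp add: zeta1_def)
qed

text \<open>On \<open>1 < Re s\<close> this is the recurrence with \<open>N = 1\<close>, where the
  middle sum is empty. The punctured half-plane is connected, so the identity theorem carries the
  equation over.\<close>

lemma zeta1_eq:
  assumes "0 < Re s" "s \<noteq> 1" shows "zeta1 s = (s - 1) * zeta s"
proof (rule analytic_continuation_open[where s = "{s. 1 < Re s}" and s' = "{s. 0 < Re s} - {1}"
      and f = zeta1 and g = "\<lambda>s. (s - 1) * zeta s"])
  show "connected ({s. 0 < Re s} - {1})"
    by (intro connected_open_delete open_halfspace_Re_gt convex_connected convex_halfspace_Re_gt) simp
  show "{s. 1 < Re s} \<noteq> {}" by (auto intro!: exI[of _ 2])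
  show "zeta1 holomorphic_on {s. 0 < Re s} - {1}"
    by (rule holomorphic_on_subset[OF holomorphic_zeta1]) auto
  show "(\<lambda>s. (s - 1) * zeta s) holomorphic_on {s. 0 < Re s} - {1}"
    by (intro holomorphic_intros holomorphic_on_subset[OF holomorphic_zeta]) auto
  fix z :: complex assume "z \<in> {s. 1 < Re s}"
  hence "1 < Re z" by simp
  hence "zeta z = zseries z" using has_sum_unique[OF has_sum_zeta has_sum_zseries] by blast
  thus "zeta1 z = (z - 1) * zeta z"
    using zseries_recurrence[of "z - 1" 1] \<open>1 < Re z\<close> by (simp add: zeta1_def)
qed (use assms in \<open>auto simp: open_halfspace_Re_gt open_delete\<close>)

text \<open>The Pochhammer symbol in the remainder is (s - 1) s, so on this half-plane the n-th term
  is at most |s - 1| |s| n^(-3/2). The resulting polynomial growth is the a priori bound for the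
  logarithm of zeta.\<close>

lemma zeta1_growth:
  "\<exists>C\<ge>0. \<forall>s. 1 / 2 \<le> Re s \<longrightarrow> norm (zeta1 s) \<le> 1 + C * norm (s - 1) * norm s"
proof -
  define C where "C = (\<Sum>\<^sub>\<infinity>n::nat\<in>{1..}. real n powr (-(3/2)))"
  have summ: "(\<lambda>n::nat. real n powr (-(3/2))) summable_on {1..}" by (rule summable_on_nat_powr) simp
  have "C \<ge> 0" unfolding C_def by (intro infsum_nonneg) auto
  moreover have "norm (zeta1 s) \<le> 1 + C * norm (s - 1) * norm s" if s: "1 / 2 \<le> Re s" for s
  proof -
    have "norm (zrem 1 (s - 1)) \<le> (\<Sum>\<^sub>\<infinity>n::nat\<in>{1..}. norm (s - 1) * norm s * real n powr (-(3/2)))"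
      unfolding zrem_def
    proof (rule norm_infsum_le)
      show "((\<lambda>n. taylor_rem 1 n (s - 1)) has_sum infsum (\<lambda>n. taylor_rem 1 n (s - 1)) {1..}) {1..}"
        by (intro has_sum_infsum summable_on_taylor_rem) (use s in auto)
      show "((\<lambda>n::nat. norm (s - 1) * norm s * real n powr (-(3/2))) has_sum
              infsum (\<lambda>n. norm (s - 1) * norm s * real n powr (-(3/2))) {1..}) {1..}"
        by (intro has_sum_infsum summable_on_cmult_right summ)
      fix n :: nat assume n: "n \<in> {1..}"
      have "norm (taylor_rem 1 n (s - 1)) \<le> norm (pochhammer (s - 1) (1 + 1)) * real n powr (-Re (s - 1) - real 1 - 1)"
        by (rule taylor_rem_bound) (use n s in auto)
      also have "norm (pochhammer (s - 1) (1 + 1)) = norm (s - 1) * norm s"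
        by (simp add: pochhammer_Suc norm_mult)
      also have "norm (s - 1) * norm s * real n powr (-Re (s - 1) - real 1 - 1) \<le> norm (s - 1) * norm s * real n powr (-(3/2))"
        using n s by (intro mult_left_mono powr_mono) auto
      finally show "norm (taylor_rem 1 n (s - 1)) \<le> norm (s - 1) * norm s * real n powr (-(3/2))" .
    qed
    also have "\<dots> = norm (s - 1) * norm s * C"
      unfolding C_def by (rule infsum_cmult_right')
    finally show ?thesis
      using norm_triangle_ineq[of 1 "zrem 1 (s - 1)"] by (simp add: zeta1_def mult_ac)
  qed
  ultimately show ?thesis by blast
qed

section \<open>Dirichlet series and zeros on the line of abscissa 1\<close>

lemma has_sum_product:
  fixes f :: "'i \<Rightarrow> complex" and g :: "'j \<Rightarrow> complex"
  assumes "(f has_sum F) I" "(g has_sum G) J"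
  shows "((\<lambda>(i, j). f i * g j) has_sum F * G) (I \<times> J)"
proof (rule has_sum_SigmaI)
  show "((\<lambda>j. case (i, j) of (i, j) \<Rightarrow> f i * g j) has_sum f i * G) J" for i
    by (simp add: has_sum_cmult_right assms)
  show "((\<lambda>i. f i * G) has_sum F * G) I"
    by (intro has_sum_cmult_left assms)
  have f: "(\<lambda>i. norm (f i)) summable_on I" and g: "(\<lambda>j. norm (g j)) summable_on J"
    using assms by (auto simp: summable_on_iff_abs_summable_on_complex[symmetric] dest: has_sum_imp_summable)
  have "Infinite_Sum.abs_summable_on (\<lambda>(i, j). f i * g j) (I \<times> J)"
  proof (subst Infinite_Sum.abs_summable_on_Sigma_iff, intro conjI ballI)
    show "(\<lambda>j. norm (case (i, j) of (i, j) \<Rightarrow> f i * g j)) summable_on J" for i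
      by (simp add: norm_mult summable_on_cmult_right g)
    have "(\<lambda>i. norm (norm (f i) * (\<Sum>\<^sub>\<infinity>j\<in>J. norm (g j)))) summable_on I"
      using f by (intro iffD1[OF summable_on_iff_abs_summable_on_real] summable_on_cmult_left)
    thus "(\<lambda>i. norm (\<Sum>\<^sub>\<infinity>j\<in>J. norm (case (i, j) of (i, j) \<Rightarrow> f i * g j))) summable_on I"
      by (simp add: norm_mult infsum_cmult_right')
  qed
  thus "(\<lambda>(i, j). f i * g j) summable_on (I \<times> J)"
    by (rule abs_summable_summable)
qed

lemma nat_powr_mult: "(of_nat (m * n) :: complex) powr s = of_nat m powr s * of_nat n powr s"
  using powr_times_real[of "of_nat m" "of_nat n" s] by simp

lemma has_sum_dirichlet_prod:
  fixes f g :: "nat \<Rightarrow> complex"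
  assumes "((\<lambda>n. f n * of_nat n powr s) has_sum F) {1..}" "((\<lambda>n. g n * of_nat n powr s) has_sum G) {1..}"
  shows "((\<lambda>n. (\<Sum>d | d dvd n. f d * g (n div d)) * of_nat n powr s) has_sum F * G) {1..}"
proof (rule has_sum_SigmaD[where B = "\<lambda>n. {d. d dvd n}" and f = "\<lambda>(n, d). f d * g (n div d) * of_nat n powr s"])
  have "((\<lambda>(d, m). (f d * of_nat d powr s) * (g m * of_nat m powr s)) has_sum F * G) ({1..} \<times> {1..})"
    by (rule has_sum_product[OF assms])
  also have "?this \<longleftrightarrow> ((\<lambda>(n, d). f d * g (n div d) * of_nat n powr s) has_sum F * G) (Sigma {1..} (\<lambda>n. {d. d dvd n}))"
    by (rule has_sum_reindex_bij_witness[where i = "\<lambda>(n, d). (d, n div d)" and j = "\<lambda>(d, m). (d * m, d)"])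
       (auto simp: nat_powr_mult mult_ac simp del: of_nat_mult Suc_le_eq dvd_div_eq_0_iff intro!: Nat.gr0I)
  finally show "((\<lambda>(n, d). f d * g (n div d) * of_nat n powr s) has_sum F * G) (Sigma {1..} (\<lambda>n. {d. d dvd n}))" .
  fix n :: nat assume "n \<in> {1..}"
  thus "((\<lambda>d. case (n, d) of (n, d) \<Rightarrow> f d * g (n div d) * of_nat n powr s) has_sum
          (\<Sum>d | d dvd n. f d * g (n div d)) * of_nat n powr s) {d. d dvd n}"
    by (intro has_sum_finiteI) (auto simp: sum_distrib_right)
qed

text \<open>An explicit candidate for the coefficients of 1/zeta, with absolute values at most 1;
  the choice \<open>mu\<close> displays no such bound.\<close>

definition moebius_mu :: "nat \<Rightarrow> complex" where
  "moebius_mu n = (if squarefree n then (-1) ^ card (prime_factors n) else 0)"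

lemma moebius_prime_mult:
  assumes "prime p" "\<not> p dvd d"
  shows "moebius_mu (p * d) = - moebius_mu d"
proof -
  have d: "d \<noteq> 0" using assms by (cases "d = 0") simp_all
  have "coprime p d" using assms by (simp add: prime_imp_coprime)
  hence "squarefree (p * d) \<longleftrightarrow> squarefree d"
    using assms by (auto intro: squarefree_mult_coprime squarefree_prime dest: squarefree_multD)
  moreover have "prime_factors (p * d) = insert p (prime_factors d)"
    using assms d by (simp add: prime_factors_product prime_prime_factors prime_gt_0_nat)
  moreover have "p \<notin> prime_factors d" using assms by auto
  ultimately show ?thesis by (simp add: moebius_mu_def)
qed

text \<open>For a prime \<open>p\<close> dividing \<open>n\<close>, multiplication by
  \<open>p\<close> pairs the squarefree divisors prime to \<open>p\<close> with the other squarefree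
  ones and flips the sign.\<close>

lemma sum_moebius_divisors:
  assumes "0 < n"
  shows "(\<Sum>d | d dvd n. moebius_mu d) = (if n = 1 then 1 else 0)"
proof (cases "n = 1")
  case True thus ?thesis by (simp add: moebius_mu_def)
next
  case False
  then obtain p where p: "prime p" "p dvd n" using prime_factor_nat by blast
  define A where "A = {d. d dvd n \<and> squarefree d \<and> \<not> p dvd d}"
  define B where "B = {d. d dvd n \<and> squarefree d \<and> p dvd d}"
  have fin: "finite {d. d dvd n}" using assms by (intro finite_divisors_nat) auto
  have finA: "finite A" "finite B" by (rule finite_subset[OF _ fin]; auto simp: A_def B_def)+
  have "(\<Sum>d | d dvd n. moebius_mu d) = (\<Sum>d\<in>A \<union> B. moebius_mu d)"
    by (rule sum.mono_neutral_right[OF fin]) (auto simp: A_def B_def moebius_mu_def)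
  also have "\<dots> = (\<Sum>d\<in>A. moebius_mu d) + (\<Sum>d\<in>B. moebius_mu d)"
    by (rule sum.union_disjoint[OF finA]) (auto simp: A_def B_def)
  also have "(\<Sum>d\<in>B. moebius_mu d) = (\<Sum>d\<in>A. moebius_mu (p * d))"
  proof (rule sum.reindex_bij_witness[where i = "\<lambda>d. p * d" and j = "\<lambda>d. d div p"])
    fix d assume d: "d \<in> B"
    then obtain e where [simp]: "d = p * e" by (auto simp: B_def elim: dvdE)
    have "p > 0" using p by (simp add: prime_gt_0_nat)
    thus "p * (d div p) = d" "moebius_mu (p * (d div p)) = moebius_mu d" by simp_all
    have "\<not> p dvd e"
    proof
      assume "p dvd e"
      hence "p\<^sup>2 dvd d" by (simp add: power2_eq_square)
      hence "p dvd 1" using d squarefreeD[of d p] by (simp add: B_def)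
      thus False using p by (simp add: prime_nat_iff)
    qed
    moreover have "e dvd n" "squarefree e"
      using d by (auto simp: B_def intro: dvd_trans[of e "p * e" n] squarefree_mono[of e "p * e"])
    ultimately show "d div p \<in> A" using \<open>p > 0\<close> by (simp add: A_def)
  next
    fix d assume d: "d \<in> A"
    have "p > 0" using p by (simp add: prime_gt_0_nat)
    thus "p * d div p = d" by simp
    have c: "coprime p d" using d p by (simp add: A_def prime_imp_coprime)
    thus "p * d \<in> B"
      using d p by (auto simp: A_def B_def intro: divides_mult squarefree_mult_coprime squarefree_prime)
  qed
  also have "\<dots> = (\<Sum>d\<in>A. - moebius_mu d)"
    by (intro sum.cong refl moebius_prime_mult p) (auto simp: A_def)
  finally show ?thesis using False by (simp add: sum_negf)
qed

text \<open>The Dirichlet product with zeta has the single nonzero coefficient 1 at n = 1; the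
  resulting equation \<open>M * zeta s = 1\<close> yields the value and the non-vanishing
  together.\<close>

lemma has_sum_moebius:
  assumes "1 < Re s"
  shows "((\<lambda>n. moebius_mu n * of_nat n powr (-s)) has_sum (1 / zeta s)) {1..}" and "zeta s \<noteq> 0"
proof -
  have "(\<lambda>n. norm (moebius_mu n * of_nat n powr (-s))) summable_on {1..}"
  proof (rule summable_on_comparison_test)
    show "(\<lambda>n::nat. real n powr (-Re s)) summable_on {1..}" by (rule summable_on_nat_powr) fact
    show "norm (moebius_mu n * of_nat n powr (-s)) \<le> real n powr (-Re s)" if "n \<in> {1..}" for n
      using that by (auto simp: moebius_mu_def norm_mult norm_nat_powr norm_power)
  qed auto
  hence "(\<lambda>n. moebius_mu n * of_nat n powr (-s)) summable_on {1..}"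
    by (simp add: summable_on_iff_abs_summable_on_complex)
  then obtain M where M: "((\<lambda>n. moebius_mu n * of_nat n powr (-s)) has_sum M) {1..}"
    by (auto simp: summable_on_def)
  have z: "((\<lambda>n. 1 * of_nat n powr (-s)) has_sum zeta s) {1..}"
    using has_sum_zeta[OF assms] by simp
  have "((\<lambda>n. (\<Sum>d | d dvd n. moebius_mu d * 1) * of_nat n powr (-s)) has_sum M * zeta s) {1..}"
    by (rule has_sum_dirichlet_prod[OF M z])
  moreover have one: "moebius_mu (Suc 0) = 1" by (simp add: moebius_mu_def)
  have "((\<lambda>n. (\<Sum>d | d dvd n. moebius_mu d * 1) * of_nat n powr (-s)) has_sum 1) {1..}"
    by (rule has_sum_finite_neutralI[where B = "{1}"]) (auto simp: sum_moebius_divisors one)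
  ultimately have "M * zeta s = 1" by (rule has_sum_unique)
  thus "zeta s \<noteq> 0" by auto
  with \<open>M * zeta s = 1\<close> have "M = 1 / zeta s" by (simp add: field_simps)
  with M show "((\<lambda>n. moebius_mu n * of_nat n powr (-s)) has_sum (1 / zeta s)) {1..}" by simp
qed

text \<open>A witness for the choice in \<open>mu\<close> is an iterated Dirichlet convolution of
  Moebius functions, one for each power of 1/zeta.\<close>

lemma has_sum_mu:
  assumes "1 < Re s"
  shows "((\<lambda>n. mu k n * of_nat n powr (-s)) has_sum (1 / zeta s ^ k)) {1..}"
proof -
  have "\<exists>f. \<forall>s. 1 < Re s \<longrightarrow> ((\<lambda>n. f n * of_nat n powr (-s)) has_sum (1 / zeta s ^ k)) {1..}"
  proof (induction k)
    case 0
    have "((\<lambda>n. (if n = 1 then 1 else 0) * of_nat n powr (-s)) has_sum (1 / zeta s ^ 0)) {1..}" for s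
      by (rule has_sum_finite_neutralI[where B = "{1}"]) auto
    thus ?case by (intro exI[of _ "\<lambda>n. if n = 1 then 1 else 0"]) blast
  next
    case (Suc k)
    then obtain f where f: "\<And>s. 1 < Re s \<Longrightarrow> ((\<lambda>n. f n * of_nat n powr (-s)) has_sum (1 / zeta s ^ k)) {1..}"
      by blast
    have "((\<lambda>n. (\<Sum>d | d dvd n. moebius_mu d * f (n div d)) * of_nat n powr (-s)) has_sum (1 / zeta s ^ Suc k)) {1..}"
      if "1 < Re s" for s
      using has_sum_dirichlet_prod[OF has_sum_moebius(1) f, OF that that] by simp
    thus ?case by (intro exI[of _ "\<lambda>n. \<Sum>d | d dvd n. moebius_mu d * f (n div d)"]) blast
  qed
  from someI_ex[OF this] assms show ?thesis unfolding mu_def by blast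
qed

lemma has_sum_deriv_zeta:
  assumes "1 < Re s"
  shows "((\<lambda>n::nat. of_real (ln (real n)) * of_nat n powr (-s)) has_sum (- deriv zeta s)) {1..}"
proof -
  define \<sigma> where "\<sigma> = (1 + Re s) / 2"
  define S where "S = {z. \<sigma> < Re z}"
  have S: "open S" "s \<in> S" using assms by (simp_all add: S_def open_halfspace_Re_gt, simp add: \<sigma>_def)
  have "((\<lambda>n::nat. deriv (\<lambda>z. of_nat n powr (-z)) s) has_sum deriv (\<lambda>z. \<Sum>\<^sub>\<infinity>n::nat\<in>{1..}. of_nat n powr (-z)) s) {1..}"
  proof (rule deriv_infsum[OF S(1) _ _ _ S(2)])
    show "(\<lambda>n. real n powr (-\<sigma>)) summable_on {1..}"
      by (rule summable_on_nat_powr) (use assms in \<open>auto simp: \<sigma>_def\<close>)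
    show "norm (of_nat n powr (-z) :: complex) \<le> real n powr (-\<sigma>)" if "n \<in> {1..}" "z \<in> S" for n z
      using that by (auto simp: S_def norm_nat_powr intro!: powr_mono)
    show "(\<lambda>z. of_nat n powr (-z) :: complex) holomorphic_on S" if "n \<in> {1..}" for n :: nat
      using that by (intro holomorphic_intros) auto
  qed
  moreover have "deriv (\<lambda>z. \<Sum>\<^sub>\<infinity>n::nat\<in>{1..}. of_nat n powr (-z)) s = deriv zeta s"
  proof (intro deriv_cong_ev refl)
    have "\<forall>\<^sub>F z in nhds s. z \<in> S" using S by (rule eventually_nhds_in_open)
    thus "\<forall>\<^sub>F z in nhds s. (\<Sum>\<^sub>\<infinity>n::nat\<in>{1..}. of_nat n powr (-z)) = zeta z"
    proof eventually_elim
      case (elim z)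
      hence "1 < Re z" using assms by (auto simp: S_def \<sigma>_def)
      thus ?case by (intro infsumI has_sum_zeta)
    qed
  qed
  ultimately have "((\<lambda>n::nat. - deriv (\<lambda>z. of_nat n powr (-z)) s) has_sum - deriv zeta s) {1..}"
    by (intro has_sum_uminusI) simp
  also have "?this \<longleftrightarrow> ?thesis"
  proof (rule has_sum_cong)
    fix n :: nat assume "n \<in> {1..}"
    hence "((\<lambda>z. of_nat n powr (-z)) has_field_derivative - of_real (ln (real n)) * of_nat n powr (-s)) (at s)"
      by (auto simp: powr_def intro!: derivative_eq_intros)
    thus "- deriv (\<lambda>z. of_nat n powr (-z)) s = of_real (ln (real n)) * of_nat n powr (-s)"
      by (simp add: DERIV_imp_deriv)
  qed
  finally show ?thesis .
qed

text \<open>The convolution of \<open>mangoldt\<close> with 1 is the logarithm, whose series is the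
  negative derivative of zeta; the same logarithm also serves as majorant.\<close>

lemma has_sum_mangoldt:
  assumes "1 < Re s"
  shows "((\<lambda>n. mangoldt n * of_nat n powr (-s)) has_sum (- deriv zeta s / zeta s)) {1..}"
proof -
  have "(\<lambda>n::nat. norm (of_real (ln (real n)) * of_nat n powr (-s) :: complex)) summable_on {1..}"
    using has_sum_deriv_zeta[OF assms]
    by (simp only: summable_on_iff_abs_summable_on_complex[symmetric] has_sum_imp_summable)
  hence "(\<lambda>n. norm (mangoldt n * of_nat n powr (-s) :: complex)) summable_on {1..}"
    by (rule summable_on_comparison_test) (auto simp: norm_mult mangoldt_le mangoldt_nonneg intro!: mult_right_mono)
  hence "(\<lambda>n. mangoldt n * of_nat n powr (-s) :: complex) summable_on {1..}"
    by (simp add: summable_on_iff_abs_summable_on_complex)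
  then obtain L where L: "((\<lambda>n. mangoldt n * of_nat n powr (-s)) has_sum L) {1..}"
    by (auto simp: summable_on_def)
  have z: "((\<lambda>n. 1 * of_nat n powr (-s)) has_sum zeta s) {1..}"
    using has_sum_zeta[OF assms] by simp
  have "((\<lambda>n. (\<Sum>d | d dvd n. mangoldt d * 1) * of_nat n powr (-s)) has_sum L * zeta s) {1..}"
    by (rule has_sum_dirichlet_prod[OF L z])
  also have "?this \<longleftrightarrow> ((\<lambda>n::nat. of_real (ln (real n)) * of_nat n powr (-s)) has_sum L * zeta s) {1..}"
    by (intro has_sum_cong) (auto simp: mangoldt_sum)
  finally have "L * zeta s = - deriv zeta s"
    using has_sum_deriv_zeta[OF assms] by (rule has_sum_unique)
  hence "L = - deriv zeta s / zeta s" using has_sum_moebius(2)[OF assms] by (simp add: field_simps)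
  with L show ?thesis by simp
qed

section \<open>Non-vanishing on the line \<open>Re s = 1\<close>\<close>

lemma three_four_one: "0 \<le> 3 + 4 * cos x + cos (2 * x)" for x :: real
proof -
  have "3 + 4 * cos x + cos (2 * x) = 2 * (1 + cos x)\<^sup>2"
    by (simp add: cos_double_cos power2_eq_square distrib_left distrib_right)
  thus ?thesis by simp
qed

lemma Re_nat_powr:
  assumes "0 < n" shows "Re (of_nat n powr (-Complex \<sigma> t)) = real n powr (-\<sigma>) * cos (t * ln (real n))"
proof -
  have "of_nat n powr (-Complex \<sigma> t) = exp (-Complex \<sigma> t * of_real (ln (real n)))"
    using assms by (simp add: powr_def)
  thus ?thesis using assms by (simp add: Re_exp powr_def)
qed

text \<open>The n-th term of the combination has real part \<open>mangoldt n\<close> n^-\<sigma> (3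
  + 4 cos \<theta> + cos 2\<theta>) with \<theta> = t ln n.\<close>

lemma mertens_inequality:
  assumes "1 < \<sigma>"
  shows "0 \<le> Re (3 * (- deriv zeta (Complex \<sigma> 0) / zeta (Complex \<sigma> 0))
                 + 4 * (- deriv zeta (Complex \<sigma> t) / zeta (Complex \<sigma> t))
                 + (- deriv zeta (Complex \<sigma> (2 * t)) / zeta (Complex \<sigma> (2 * t))))" (is "0 \<le> Re ?S")
proof -
  have h: "((\<lambda>n. mangoldt n * of_nat n powr (-Complex \<sigma> u)) has_sum (- deriv zeta (Complex \<sigma> u) / zeta (Complex \<sigma> u))) {1..}" for u
    using assms by (intro has_sum_mangoldt) simp
  have "((\<lambda>n. Re (3 * (mangoldt n * of_nat n powr (-Complex \<sigma> 0)) + 4 * (mangoldt n * of_nat n powr (-Complex \<sigma> t))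
           + mangoldt n * of_nat n powr (-Complex \<sigma> (2 * t)))) has_sum Re ?S) {1..}"
    by (intro has_sum_Re has_sum_add has_sum_cmult_right h)
  moreover have "0 \<le> Re (3 * (mangoldt n * of_nat n powr (-Complex \<sigma> 0)) + 4 * (mangoldt n * of_nat n powr (-Complex \<sigma> t))
           + mangoldt n * of_nat n powr (-Complex \<sigma> (2 * t)))" if "n \<in> {1..}" for n
  proof -
    have m: "Re (mangoldt n * z) = mangoldt n * Re z" for z
      by (metis Re_complex_of_real Im_complex_of_real mult_zero_left diff_zero times_complex.simps(1) of_real_mangoldt)
    have r: "Re (of_nat n powr (-Complex \<sigma> u)) = real n powr (-\<sigma>) * cos (u * ln (real n))" for u
      using that by (intro Re_nat_powr) simp
    have c: "Re (3 * (mangoldt n * z0) + 4 * (mangoldt n * z1) + mangoldt n * z2) = mangoldt n * (3 * Re z0 + 4 * Re z1 + Re z2)" for z0 z1 z2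
    proof -
      have "3 * (mangoldt n * z0) + 4 * (mangoldt n * z1) + mangoldt n * z2 = mangoldt n * (3 * z0 + 4 * z1 + z2)"
        by (simp add: algebra_simps)
      thus ?thesis by (simp only: m) simp
    qed
    have "Re (3 * (mangoldt n * of_nat n powr (-Complex \<sigma> 0)) + 4 * (mangoldt n * of_nat n powr (-Complex \<sigma> t))
           + mangoldt n * of_nat n powr (-Complex \<sigma> (2 * t)))
       = mangoldt n * real n powr (-\<sigma>) * (3 + 4 * cos (t * ln (real n)) + cos (2 * (t * ln (real n))))"
      unfolding c r by (simp add: algebra_simps)
    also have "\<dots> \<ge> 0" by (intro mult_nonneg_nonneg three_four_one mangoldt_nonneg) auto
    finally show ?thesis .
  qed
  ultimately show ?thesis by (rule has_sum_nonneg)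
qed

text \<open>\<open>m\<close> is the order of vanishing of \<open>f\<close> at \<open>z\<close>.
  Writing f = (w - z)^m g with g free of zeros nearby gives h f'/f = m + h g'/g at w = z + h, and
  the last term vanishes with \<open>h\<close>. Admitting m = 0 treats zeros and other points
  alike.\<close>

lemma log_deriv_order:
  assumes f: "f holomorphic_on S" "open S" "connected S" "z \<in> S" "\<not> f constant_on S"
  shows "\<exists>m::nat. (f z = 0 \<longrightarrow> 0 < m) \<and> (f z \<noteq> 0 \<longrightarrow> m = 0) \<and>
           ((\<lambda>h. of_real h * (deriv f (z + of_real h) / f (z + of_real h))) \<longlongrightarrow> of_nat m) (at_right 0)"
proof -
  have "\<exists>m g r. 0 < r \<and> ball z r \<subseteq> S \<and> g holomorphic_on ball z r \<and> (\<forall>w\<in>ball z r. f w = (w - z) ^ m * g w \<and> g w \<noteq> 0)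
     \<and> (f z = 0 \<longrightarrow> 0 < m) \<and> (f z \<noteq> 0 \<longrightarrow> m = 0)"
  proof (cases "f z = 0")
    case True
    obtain g r n where "0 < n" "0 < r" "ball z r \<subseteq> S" "g holomorphic_on ball z r"
       "\<And>w. w \<in> ball z r \<Longrightarrow> f w = (w - z) ^ n * g w" "\<And>w. w \<in> ball z r \<Longrightarrow> g w \<noteq> 0"
      using holomorphic_factor_zero_nonconstant[OF f(1-4) True f(5)] by metis
    thus ?thesis using True by (intro exI[of _ n] exI[of _ g] exI[of _ r]) auto
  next
    case False
    have "isCont f z" using f by (meson continuous_on_eq_continuous_at holomorphic_on_imp_continuous_on)
    then obtain e where e: "e > 0" "\<And>w. dist z w < e \<Longrightarrow> f w \<noteq> 0"
      using continuous_at_avoid[of z f 0] False by auto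
    obtain r where r: "r > 0" "ball z r \<subseteq> S" using f by (meson openE)
    have "f holomorphic_on ball z (min e r)"
      by (rule holomorphic_on_subset[OF f(1)]) (use r in auto)
    thus ?thesis using False e r by (intro exI[of _ 0] exI[of _ f] exI[of _ "min e r"]) auto
  qed
  then obtain m g r where m: "f z = 0 \<longrightarrow> 0 < m" "f z \<noteq> 0 \<longrightarrow> m = 0" and r: "0 < r" "ball z r \<subseteq> S"
    and g: "g holomorphic_on ball z r" "\<And>w. w \<in> ball z r \<Longrightarrow> f w = (w - z) ^ m * g w" "\<And>w. w \<in> ball z r \<Longrightarrow> g w \<noteq> 0"
    by blast
  have eq: "of_real h * (deriv f (z + of_real h) / f (z + of_real h)) = of_nat m + of_real h * (deriv g (z + of_real h) / g (z + of_real h))"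
    if h: "0 < h" "h < r" for h
  proof -
    define w where "w = z + of_real h"
    have w: "w \<in> ball z r" "w - z = of_real h" "w - z \<noteq> 0" using h by (auto simp: w_def dist_norm)
    have "(f has_field_derivative (of_nat m * (w - z) ^ (m - 1) * g w + (w - z) ^ m * deriv g w)) (at w)"
    proof (rule has_field_derivative_transform_within_open)
      have "(g has_field_derivative deriv g w) (at w)"
        using g(1) w(1) by (intro holomorphic_derivI) auto
      thus "((\<lambda>w. (w - z) ^ m * g w) has_field_derivative (of_nat m * (w - z) ^ (m - 1) * g w + (w - z) ^ m * deriv g w)) (at w)"
        by (auto intro!: derivative_eq_intros)
      show "(x - z) ^ m * g x = f x" if "x \<in> ball z r" for x using g(2)[OF that] by simp
    qed (use w in auto)
    hence "deriv f w = of_nat m * (w - z) ^ (m - 1) * g w + (w - z) ^ m * deriv g w" by (rule DERIV_imp_deriv)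
    moreover define v where "v = w - z"
    ultimately have D: "deriv f w = of_nat m * v ^ (m - 1) * g w + v ^ m * deriv g w" by simp
    \<comment> \<open>\<open>m - 1\<close> is truncated at \<open>m = 0\<close>; the extra factor
      \<open>v\<close> makes the formula uniform.\<close>
    have "v * (of_nat m * v ^ (m - 1)) = of_nat m * v ^ m" by (cases m) auto
    moreover have "v * deriv f w = (v * (of_nat m * v ^ (m - 1))) * g w + v * v ^ m * deriv g w"
      by (simp add: D distrib_left mult.assoc)
    ultimately have "v * deriv f w = of_nat m * v ^ m * g w + v * v ^ m * deriv g w" by simp
    moreover have "f w = v ^ m * g w" "g w \<noteq> 0" "v \<noteq> 0"
      using g(2,3)[OF w(1)] w(3) by (auto simp: v_def)
    ultimately have "v * (deriv f w / f w) = of_nat m + v * (deriv g w / g w)"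
      by (simp add: field_simps)
    thus ?thesis using w(2) by (simp add: w_def v_def)
  qed
  have "isCont (\<lambda>w. deriv g w / g w) z"
  proof -
    have "(\<lambda>w. deriv g w / g w) holomorphic_on ball z r"
      by (intro holomorphic_intros g) (use g in auto)
    thus ?thesis using r by (meson centre_in_ball continuous_on_eq_continuous_at holomorphic_on_imp_continuous_on open_ball)
  qed
  hence "((\<lambda>h. deriv g (z + of_real h) / g (z + of_real h)) \<longlongrightarrow> deriv g z / g z) (at_right (0::real))"
    by (rule isCont_tendsto_compose) (auto intro!: tendsto_eq_intros)
  hence "((\<lambda>h. of_nat m + of_real h * (deriv g (z + of_real h) / g (z + of_real h))) \<longlongrightarrow> of_nat m + of_real 0 * (deriv g z / g z)) (at_right (0::real))"
    by (intro tendsto_add tendsto_mult tendsto_const tendsto_of_real tendsto_ident_at)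
  hence "((\<lambda>h. of_real h * (deriv f (z + of_real h) / f (z + of_real h))) \<longlongrightarrow> of_nat m + of_real 0 * (deriv g z / g z)) (at_right 0)"
    by (rule Lim_transform_eventually)
       (use eventually_at_right_real[OF r(1)] in \<open>rule eventually_mono\<close>, use eq in auto)
  thus ?thesis using m by (intro exI[of _ m]) auto
qed

text \<open>Multiply Mertens' inequality at \<sigma> = 1 + h by \<open>h\<close> and let
  \<open>h\<close> tend to 0: the pole contributes 3, a zero at 1 + it of order m \<ge> 1
  contributes -4m, and a zero at 1 + 2it can only lower the value. The limit would be
  negative.\<close>

lemma zeta1_nonzero_1_line:
  assumes "t \<noteq> 0" shows "zeta1 (Complex 1 t) \<noteq> 0"
proof
  assume zero: "zeta1 (Complex 1 t) = 0"
  define S where "S = {s. 0 < Re s}"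
  have S: "zeta1 holomorphic_on S" "open S" "connected S"
    unfolding S_def by (auto intro: holomorphic_zeta1 open_halfspace_Re_gt convex_connected convex_halfspace_Re_gt)
  have "\<not> zeta1 constant_on S"
  proof
    assume "zeta1 constant_on S"
    then obtain c where "\<And>s. s \<in> S \<Longrightarrow> zeta1 s = c" by (auto simp: constant_on_def)
    from this[of 1] this[of "Complex 1 t"] zero show False by (simp add: S_def)
  qed
  hence "\<exists>m::nat. (zeta1 (Complex 1 u) = 0 \<longrightarrow> 0 < m) \<and> (zeta1 (Complex 1 u) \<noteq> 0 \<longrightarrow> m = 0) \<and>
           ((\<lambda>h. of_real h * (deriv zeta1 (Complex 1 u + of_real h) / zeta1 (Complex 1 u + of_real h))) \<longlongrightarrow> of_nat m) (at_right 0)" for u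
    by (intro log_deriv_order[OF S]) (auto simp: S_def)
  then obtain m :: "real \<Rightarrow> nat" where m: "\<And>u. zeta1 (Complex 1 u) = 0 \<Longrightarrow> 0 < m u" "\<And>u. zeta1 (Complex 1 u) \<noteq> 0 \<Longrightarrow> m u = 0"
    "\<And>u. ((\<lambda>h. of_real h * (deriv zeta1 (Complex 1 u + of_real h) / zeta1 (Complex 1 u + of_real h))) \<longlongrightarrow> of_nat (m u)) (at_right 0)"
    by metis
  define L where "L = (\<lambda>u h. of_real h * (- deriv zeta (Complex (1 + h) u) / zeta (Complex (1 + h) u)))"
  have L: "(L u \<longlongrightarrow> (if u = 0 then 1 else 0) - of_nat (m u)) (at_right 0)" for u
  proof (rule Lim_transform_eventually)
    \<comment> \<open>The logarithmic derivative splits as -zeta'/zeta = 1/(s - 1) - zeta1'/zeta1: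
      the first summand accounts for the pole at \<open>u = 0\<close>, the second for the order
      \<open>m u\<close>.\<close>
    have "((\<lambda>h. of_real h / (of_real h + \<i> * of_real u)) \<longlongrightarrow> (if u = 0 then 1 else 0)) (at_right 0)"
    proof (cases "u = 0")
      case True
      have "((\<lambda>h. of_real h / (of_real h + \<i> * of_real u) :: complex) \<longlongrightarrow> 1) (at_right 0)"
        by (rule Lim_transform_eventually[OF tendsto_const])
           (use eventually_at_right_less[of 0] in \<open>rule eventually_mono\<close>, use True in auto)
      thus ?thesis using True by simp
    next
      case False
      have "((\<lambda>h. of_real h / (of_real h + \<i> * of_real u) :: complex) \<longlongrightarrow> of_real 0 / (of_real 0 + \<i> * of_real u)) (at_right 0)"
        by (intro tendsto_intros tendsto_ident_at) (use False in auto)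
      thus ?thesis using False by simp
    qed
    from tendsto_diff[OF this m(3)[of u]]
    show "((\<lambda>h. of_real h / (of_real h + \<i> * of_real u) - of_real h * (deriv zeta1 (Complex 1 u + of_real h) / zeta1 (Complex 1 u + of_real h)))
             \<longlongrightarrow> (if u = 0 then 1 else 0) - of_nat (m u)) (at_right 0)" .
    have "of_real h / (of_real h + \<i> * of_real u) - of_real h * (deriv zeta1 (Complex 1 u + of_real h) / zeta1 (Complex 1 u + of_real h)) = L u h"
      if h: "0 < h" for h
    proof -
      define s where "s = Complex (1 + h) u"
      have s: "s = Complex 1 u + of_real h" "s - 1 = of_real h + \<i> * of_real u" "1 < Re s" "s \<noteq> 1" "s - 1 \<noteq> 0"
        using h by (auto simp: s_def complex_eq_iff)
      have "(zeta1 has_field_derivative (zeta s + (s - 1) * deriv zeta s)) (at s)"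
      proof (rule has_field_derivative_transform_within_open)
        have "(zeta has_field_derivative deriv zeta s) (at s)"
          by (rule holomorphic_derivI[OF holomorphic_zeta]) (use s in auto)
        thus "((\<lambda>s. (s - 1) * zeta s) has_field_derivative (zeta s + (s - 1) * deriv zeta s)) (at s)"
          by (auto intro!: derivative_eq_intros)
        show "(x - 1) * zeta x = zeta1 x" if "x \<in> {x. 1 < Re x}" for x
          using that by (subst zeta1_eq) auto
      qed (use s in \<open>auto simp: open_halfspace_Re_gt\<close>)
      hence d: "deriv zeta1 s = zeta s + (s - 1) * deriv zeta s" by (rule DERIV_imp_deriv)
      have z: "zeta1 s = (s - 1) * zeta s" using s by (intro zeta1_eq) auto
      have "1 / a - (Z + a * D) / (a * Z) = - D / Z" if "a \<noteq> 0" "Z \<noteq> 0" for a Z D :: complex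
        using that by (simp add: field_simps)
      hence "1 / (s - 1) - deriv zeta1 s / zeta1 s = - deriv zeta s / zeta s"
        unfolding d z using s(3,5) has_sum_moebius(2) by blast
      hence "of_real h * (1 / (s - 1) - deriv zeta1 s / zeta1 s) = of_real h * (- deriv zeta s / zeta s)" by simp
      thus ?thesis unfolding L_def s_def[symmetric] s(1)[symmetric] s(2)[symmetric] by (simp add: algebra_simps)
    qed
    thus "\<forall>\<^sub>F h in at_right 0. of_real h / (of_real h + \<i> * of_real u) - of_real h * (deriv zeta1 (Complex 1 u + of_real h) / zeta1 (Complex 1 u + of_real h)) = L u h"
      by (intro eventually_mono[OF eventually_at_right_less[of 0]]) blast
  qed
  have "((\<lambda>h. Re (3 * L 0 h + 4 * L t h + L (2 * t) h)) \<longlongrightarrow>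
          Re (3 * ((if (0::real) = 0 then 1 else 0) - of_nat (m 0)) + 4 * ((if t = 0 then 1 else 0) - of_nat (m t))
           + ((if 2 * t = 0 then 1 else 0) - of_nat (m (2 * t))))) (at_right 0)"
    by (intro tendsto_intros L)
  moreover have "\<forall>\<^sub>F h in at_right 0. 0 \<le> Re (3 * L 0 h + 4 * L t h + L (2 * t) h)"
  proof (rule eventually_mono[OF eventually_at_right_less[of 0]])
    fix h :: real assume h: "0 < h"
    define X where "X = (\<lambda>u. - deriv zeta (Complex (1 + h) u) / zeta (Complex (1 + h) u))"
    have "3 * L 0 h + 4 * L t h + L (2 * t) h = of_real h * (3 * X 0 + 4 * X t + X (2 * t))"
      by (simp add: L_def X_def algebra_simps)
    hence "Re (3 * L 0 h + 4 * L t h + L (2 * t) h) = h * Re (3 * X 0 + 4 * X t + X (2 * t))" by simp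
    also have "\<dots> \<ge> 0" using mertens_inequality[of "1 + h" t] h by (intro mult_nonneg_nonneg) (auto simp: X_def)
    finally show "0 \<le> Re (3 * L 0 h + 4 * L t h + L (2 * t) h)" .
  qed
  ultimately have "0 \<le> Re (3 * ((if (0::real) = 0 then 1 else 0) - of_nat (m 0)) + 4 * ((if t = 0 then 1 else 0) - of_nat (m t))
           + ((if 2 * t = 0 then 1 else 0) - of_nat (m (2 * t))))"
    by (rule tendsto_lowerbound) auto
  moreover have "m 0 = 0" using m(2)[of 0] by (simp add: Complex_eq)
  moreover have "0 < m t" using m(1) zero by blast
  ultimately show False using assms by simp
qed

text \<open>\<open>riemann_hypothesis\<close> speaks of the open strip; the line Re s = 1 is covered
  by Mertens' argument, the half-plane to its right by the Moebius series, and at 1 the value is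
  1.\<close>

lemma zeta1_nonzero:
  assumes "riemann_hypothesis" "1 / 2 < Re s"
  shows "zeta1 s \<noteq> 0"
proof (cases "1 \<le> Re s")
  case True
  show ?thesis
  proof (cases "Re s = 1")
    case True
    show ?thesis
    proof (cases "Im s = 0")
      case True
      hence "s = 1" using \<open>Re s = 1\<close> by (simp add: complex_eq_iff)
      thus ?thesis by simp
    next
      case False
      thus ?thesis using zeta1_nonzero_1_line[of "Im s"] \<open>Re s = 1\<close> by (metis complex_surj)
    qed
  next
    case False
    hence "1 < Re s" "s \<noteq> 1" using True by auto
    thus ?thesis using has_sum_moebius(2)[of s] by (simp add: zeta1_eq)
  qed
next
  case False
  hence "s \<noteq> 1" by auto
  moreover have "zeta s \<noteq> 0"
    using assms False unfolding riemann_hypothesis_def by force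
  ultimately show ?thesis using assms by (simp add: zeta1_eq)
qed

section \<open>Growth under the Riemann Hypothesis\<close>

text \<open>Since Re f < A, the function f / (2A - f) maps the disc into the unit disc, and it
  vanishes at 0. Rescaled to radius 1, the Schwarz lemma bounds it by r/R, and the inequality is
  solved for |f|.\<close>

lemma borel_caratheodory:
  assumes f: "f holomorphic_on ball 0 R" "f 0 = 0" and A: "\<And>w. w \<in> ball 0 R \<Longrightarrow> Re (f w) < A"
    and z: "norm z \<le> r" "r < R"
  shows "norm (f z) \<le> 2 * A * r / (R - r)"
proof -
  have "0 \<le> r" using z norm_ge_zero[of z] by linarith
  hence R: "0 < R" "0 \<le> r" using z by auto
  have A0: "0 < A" using A[of 0] f R by simp
  define h where "h = (\<lambda>w. f (of_real R * w) / (2 * of_real A - f (of_real R * w)))"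
  have mem: "of_real R * w \<in> ball 0 R" if "norm w < 1" for w :: complex
    using that R by (simp add: norm_mult)
  have nz: "2 * of_real A - f w \<noteq> 0" if "w \<in> ball 0 R" for w
  proof
    assume "2 * of_real A - f w = 0"
    hence "Re (f w) = 2 * A" by (auto simp: complex_eq_iff)
    thus False using A[OF that] A0 by simp
  qed
  have lt: "norm (f w) < norm (2 * of_real A - f w)" if "w \<in> ball 0 R" for w
  proof -
    have "(norm (2 * of_real A - f w))\<^sup>2 - (norm (f w))\<^sup>2 = 4 * A * (A - Re (f w))"
      by (simp only: cmod_power2) (simp add: power2_eq_square algebra_simps)
    moreover have "0 < 4 * A * (A - Re (f w))" using A[OF that] A0 by simp
    ultimately have "(norm (f w))\<^sup>2 < (norm (2 * of_real A - f w))\<^sup>2" by linarith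
    thus ?thesis by (rule power2_less_imp_less) auto
  qed
  have hlt: "norm (h w) < 1" if "norm w < 1" for w
    using lt[OF mem[OF that]] nz[OF mem[OF that]] by (simp add: h_def norm_divide divide_less_eq)
  have hol: "h holomorphic_on ball 0 1"
  proof -
    have "(f \<circ> (\<lambda>w. of_real R * w)) holomorphic_on ball 0 1"
      by (rule holomorphic_on_compose_gen[OF _ f(1)]) (use mem in \<open>auto intro!: holomorphic_intros\<close>)
    thus ?thesis unfolding h_def by (intro holomorphic_intros) (use nz mem in \<open>auto simp: o_def\<close>)
  qed
  have w: "norm (z / of_real R) < 1" "of_real R * (z / of_real R) = z"
    using R z by (auto simp: norm_divide)
  have zR: "z \<in> ball 0 R" using z by simp
  have "norm (h (z / of_real R)) \<le> norm (z / of_real R)"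
    by (rule Schwarz_Lemma(1)[OF hol]) (use hlt w f in \<open>auto simp: h_def\<close>)
  also have "\<dots> \<le> r / R" using z R by (simp add: norm_divide divide_right_mono)
  finally have "norm (f z) \<le> r / R * norm (2 * of_real A - f z)"
    using nz[OF zR] by (simp only: h_def w(2) norm_divide) (simp add: divide_le_eq)
  also have "\<dots> \<le> r / R * (2 * A + norm (f z))"
    using norm_triangle_ineq4[of "2 * of_real A" "f z"] A0 R by (intro mult_left_mono) (auto simp: norm_mult)
  finally have "norm (f z) * R \<le> r * (2 * A + norm (f z))"
    using R by (simp add: field_simps)
  thus ?thesis using z by (simp add: field_simps)
qed

text \<open>A substitute for Hadamard's three circles theorem: a one-sided bound \<open>A1\<close> on a small disc bounds
  the first Taylor coefficients, and the bound on the large disc only enters through the tail of the series.\<close>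

lemma two_discs_bound:
  fixes r1 r R A1 \<epsilon> :: real
  assumes r: "0 < r1" "r1 < r" "r < R" and \<epsilon>: "0 < \<epsilon>"
  shows "\<exists>C. \<forall>f A z. f holomorphic_on ball 0 R \<longrightarrow> f 0 = 0 \<longrightarrow> (\<forall>w\<in>ball 0 R. Re (f w) < A) \<longrightarrow>
           (\<forall>w\<in>ball 0 r1. Re (f w) < A1) \<longrightarrow> norm z \<le> r \<longrightarrow> norm (f z) \<le> C + \<epsilon> * A"
proof -
  \<comment> \<open>An intermediate circle: on it Borel-Caratheodory turns the one-sided bound
    \<open>A\<close> into coefficient bounds \<open>c * A / R' ^ j\<close>, so the series at radius
    \<open>r\<close> has ratio \<open>q < 1\<close>.\<close>
  define R' where "R' = (r + R) / 2"
  have R': "r < R'" "R' < R" "0 < R'" using r by (auto simp: R'_def)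
  define q where "q = r / R'"
  have q: "0 < q" "q < 1" using R' r by (auto simp: q_def)
  define c where "c = 2 * R' / (R - R')"
  have c: "0 < c" using R' by (simp add: c_def)
  have "(\<lambda>m. c * q ^ m / (1 - q)) \<longlonglongrightarrow> c * 0 / (1 - q)"
    by (intro tendsto_intros LIMSEQ_realpow_zero) (use q in auto)
  hence "(\<lambda>m. c * q ^ m / (1 - q)) \<longlonglongrightarrow> 0" by simp
  hence "eventually (\<lambda>m. c * q ^ m / (1 - q) < \<epsilon>) sequentially"
    using \<epsilon> by (rule order_tendstoD)
  \<comment> \<open>From the index \<open>m\<close> on the series amounts to at most
    \<open>\<epsilon> * A\<close>; the earlier terms are estimated through \<open>A1\<close> on the
    circle of radius \<open>r1 / 2\<close> and contribute at most \<open>C\<close>.\<close>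
  then obtain m where m: "c * q ^ m / (1 - q) < \<epsilon>" by (auto simp: eventually_sequentially)
  define C where "C = (\<Sum>j<m. 2 * A1 * (2 * r / r1) ^ j)"
  show ?thesis
  proof (intro exI[of _ C] allI impI)
    fix f :: "complex \<Rightarrow> complex" and A :: real and z :: complex
    assume f: "f holomorphic_on ball 0 R" "f 0 = 0" and A: "\<forall>w\<in>ball 0 R. Re (f w) < A"
      and A1: "\<forall>w\<in>ball 0 r1. Re (f w) < A1" and z: "norm z \<le> r"
    have A0: "0 < A" using A f r by (auto dest: bspec[of _ _ 0])
    have coeff: "norm ((deriv ^^ j) f 0 / fact j) \<le> B / \<rho> ^ j"
      if "0 < \<rho>" "\<rho> < R" "\<And>w. norm w = \<rho> \<Longrightarrow> norm (f w) \<le> B" for \<rho> B j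
    proof -
      have "norm ((deriv ^^ j) f 0) \<le> fact j * B / \<rho> ^ j"
      proof (rule Cauchy_inequality)
        show "f holomorphic_on ball 0 \<rho>" "continuous_on (cball 0 \<rho>) f"
          using that by (auto intro!: holomorphic_on_imp_continuous_on holomorphic_on_subset[OF f(1)])
      qed (use that in auto)
      thus ?thesis by (simp add: norm_divide field_simps)
    qed
    have c1: "norm ((deriv ^^ j) f 0 / fact j) \<le> c * A / R' ^ j" for j
    proof (rule coeff)
      fix w :: complex assume "norm w = R'"
      hence "norm (f w) \<le> 2 * A * R' / (R - R')"
        using A R' by (intro borel_caratheodory[OF f]) auto
      thus "norm (f w) \<le> c * A" by (simp add: c_def mult_ac)
    qed (use R' in auto)
    have c2: "norm ((deriv ^^ j) f 0 / fact j) \<le> 2 * A1 / (r1 / 2) ^ j" for j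
    proof (rule coeff)
      fix w :: complex assume "norm w = r1 / 2"
      moreover have "f holomorphic_on ball 0 r1" using r by (intro holomorphic_on_subset[OF f(1)]) auto
      ultimately have "norm (f w) \<le> 2 * A1 * (r1 / 2) / (r1 - r1 / 2)"
        using A1 r f by (intro borel_caratheodory) auto
      thus "norm (f w) \<le> 2 * A1" using r by simp
    qed (use r in auto)
    define g where "g = (\<lambda>j. (if j \<in> {..<m} then 2 * A1 * (2 * r / r1) ^ j else 0) + (if j < m then 0 else c * A * q ^ j))"
    have "(\<lambda>j. c * A * q ^ m * q ^ j) sums (c * A * q ^ m * (1 / (1 - q)))"
      using q by (intro sums_mult geometric_sums) auto
    hence "(\<lambda>j. if j + m < m then 0 else c * A * q ^ (j + m)) sums (c * A * q ^ m * (1 / (1 - q)))"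
      by (simp add: power_add mult_ac)
    hence "(\<lambda>j. if j < m then 0 else c * A * q ^ j) sums (c * A * q ^ m * (1 / (1 - q)))"
      by (subst (asm) sums_zero_iff_shift) auto
    hence g: "g sums (C + c * A * q ^ m * (1 / (1 - q)))"
      unfolding g_def C_def by (intro sums_add sums_If_finite_set) auto
    have "norm (f z) \<le> C + c * A * q ^ m * (1 / (1 - q))"
    proof (rule norm_sums_le[OF _ g])
      show "(\<lambda>n. (deriv ^^ n) f 0 / fact n * (z - 0) ^ n) sums f z"
        by (rule holomorphic_power_series[OF f(1)]) (use z r in auto)
      fix j
      have "norm ((deriv ^^ j) f 0 / fact j * (z - 0) ^ j) = norm ((deriv ^^ j) f 0 / fact j) * norm z ^ j"
        by (simp add: norm_mult norm_power norm_divide)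
      also have "\<dots> \<le> norm ((deriv ^^ j) f 0 / fact j) * r ^ j"
        using z by (intro mult_left_mono power_mono) auto
      also have "\<dots> \<le> g j"
      proof (cases "j < m")
        case True
        have "norm ((deriv ^^ j) f 0 / fact j) * r ^ j \<le> 2 * A1 / (r1 / 2) ^ j * r ^ j"
          using r by (intro mult_right_mono c2) auto
        thus ?thesis using True r by (simp add: g_def power_divide power_mult_distrib)
      next
        case False
        have "norm ((deriv ^^ j) f 0 / fact j) * r ^ j \<le> c * A / R' ^ j * r ^ j"
          using r by (intro mult_right_mono c1) auto
        thus ?thesis using False R' by (simp add: g_def q_def power_divide)
      qed
      finally show "norm ((deriv ^^ j) f 0 / fact j * (z - 0) ^ j) \<le> g j" .
    qed
    also have "c * A * q ^ m * (1 / (1 - q)) = A * (c * q ^ m / (1 - q))" by simp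
    also have "\<dots> \<le> A * \<epsilon>" using m A0 by (intro mult_left_mono) auto
    finally show "norm (f z) \<le> C + \<epsilon> * A" by (simp add: mult.commute)
  qed
qed

section \<open>Bounds for zeta and its inverse\<close>

lemma norm_has_sum_nat_powr_le:
  fixes f :: "nat \<Rightarrow> complex"
  assumes "((\<lambda>n. f n * of_nat n powr (-s)) has_sum F) {1..}" "\<And>n. norm (f n) \<le> 1" "1 < \<sigma>" "\<sigma> \<le> Re s"
  shows "norm F \<le> (\<Sum>\<^sub>\<infinity>n::nat\<in>{1..}. real n powr (-\<sigma>))"
proof (rule norm_infsum_le[OF assms(1)])
  show "((\<lambda>n::nat. real n powr (-\<sigma>)) has_sum (\<Sum>\<^sub>\<infinity>n::nat\<in>{1..}. real n powr (-\<sigma>))) {1..}"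
    by (intro has_sum_infsum summable_on_nat_powr assms)
  fix n :: nat assume n: "n \<in> {1..}"
  have "norm (f n * of_nat n powr (-s)) = norm (f n) * real n powr (-Re s)"
    using n by (simp add: norm_mult norm_nat_powr)
  also have "\<dots> \<le> 1 * real n powr (-\<sigma>)"
    using n assms by (intro mult_mono powr_mono) auto
  finally show "norm (f n * of_nat n powr (-s)) \<le> real n powr (-\<sigma>)" by simp
qed

lemma
  assumes "1 < \<sigma>" "\<sigma> \<le> Re s"
  shows norm_zeta_le: "norm (zeta s) \<le> (\<Sum>\<^sub>\<infinity>n::nat\<in>{1..}. real n powr (-\<sigma>))"
    and norm_inverse_zeta_le: "norm (1 / zeta s) \<le> (\<Sum>\<^sub>\<infinity>n::nat\<in>{1..}. real n powr (-\<sigma>))"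
proof -
  show "norm (zeta s) \<le> (\<Sum>\<^sub>\<infinity>n::nat\<in>{1..}. real n powr (-\<sigma>))"
    by (rule norm_has_sum_nat_powr_le[of "\<lambda>_. 1" s]) (use assms has_sum_zeta[of s] in auto)
  show "norm (1 / zeta s) \<le> (\<Sum>\<^sub>\<infinity>n::nat\<in>{1..}. real n powr (-\<sigma>))"
    by (rule norm_has_sum_nat_powr_le[of moebius_mu s])
       (use assms has_sum_moebius[of s] in \<open>auto simp: moebius_mu_def norm_power\<close>)
qed

lemma zeta_growth_half:
  "\<exists>C>0. \<forall>s. 1 / 2 \<le> Re s \<longrightarrow> 1 / 2 \<le> \<bar>Im s\<bar> \<longrightarrow> norm (zeta s) \<le> C * (1 + norm s)"
proof -
  obtain C where C: "0 \<le> C" "\<And>s. 1 / 2 \<le> Re s \<Longrightarrow> norm (zeta1 s) \<le> 1 + C * norm (s - 1) * norm s"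
    using zeta1_growth by blast
  have "norm (zeta s) \<le> (2 + C) * (1 + norm s)" if s: "1 / 2 \<le> Re s" "1 / 2 \<le> \<bar>Im s\<bar>" for s
  proof -
    have "s \<noteq> 1" using s by auto
    have d: "1 / 2 \<le> norm (s - 1)" using s abs_Im_le_cmod[of "s - 1"] by simp
    have "zeta1 s = (s - 1) * zeta s" using s \<open>s \<noteq> 1\<close> by (intro zeta1_eq) auto
    hence "norm (s - 1) * norm (zeta s) \<le> 1 + C * norm (s - 1) * norm s"
      using C(2)[OF s(1)] by (simp add: norm_mult)
    also have "\<dots> \<le> 2 * norm (s - 1) + C * norm (s - 1) * norm s"
      using d by simp
    also have "\<dots> = norm (s - 1) * (2 + C * norm s)" by (simp add: algebra_simps)
    finally have "norm (zeta s) \<le> 2 + C * norm s" using d \<open>s \<noteq> 1\<close> by (simp add: mult_le_cancel_left)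
    also have "\<dots> \<le> (2 + C) * (1 + norm s)" using C(1) by (simp add: algebra_simps)
    finally show ?thesis .
  qed
  moreover have "0 < 2 + C" using C by simp
  ultimately show ?thesis by blast
qed

text \<open>Around 2 + iT the open disc of radius 3/2 just reaches the critical line, so zeta has no
  zero in it and a holomorphic logarithm exists. Polynomial growth bounds its real part by O(ln |T|)
  there, absolute convergence by a constant on the disc of radius 1/2, and the two-disc inequality
  turns this into \<epsilon> ln |T| up to a constant on radius 3/2 - \<delta>.\<close>

lemma log_zeta_bound:
  assumes RH: riemann_hypothesis and \<delta>: "0 < \<delta>" "\<delta> < 1 / 2" and \<epsilon>: "0 < \<epsilon>"
  shows "\<exists>K. \<forall>s. 1 / 2 + \<delta> \<le> Re s \<longrightarrow> Re s \<le> 2 \<longrightarrow> 2 \<le> \<bar>Im s\<bar> \<longrightarrow>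
           zeta s \<noteq> 0 \<and> \<bar>ln (norm (zeta s))\<bar> \<le> K + \<epsilon> * ln \<bar>Im s\<bar>"
proof -
  define S2 where "S2 = (\<Sum>\<^sub>\<infinity>n::nat\<in>{1..}. real n powr (-2))"
  define S3 where "S3 = (\<Sum>\<^sub>\<infinity>n::nat\<in>{1..}. real n powr (-(3/2)))"
  obtain G where G: "0 < G" "\<And>s. 1 / 2 \<le> Re s \<Longrightarrow> 1 / 2 \<le> \<bar>Im s\<bar> \<Longrightarrow> norm (zeta s) \<le> G * (1 + norm s)"
    using zeta_growth_half by blast
  have ge: "1 \<le> (\<Sum>\<^sub>\<infinity>n::nat\<in>{1..}. real n powr (-\<sigma>))" if "1 < \<sigma>" for \<sigma>
    using finite_sum_le_infsum[of "\<lambda>n. real n powr (-\<sigma>)" "{1..}" "{1::nat}"] summable_on_nat_powr[OF that] by simp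
  have S: "1 \<le> S2" "1 \<le> S3" unfolding S2_def S3_def by (rule ge; simp)+
  \<comment> \<open>On the small disc Re s > 3/2, so ln |zeta| is at most \<open>ln S3\<close>;
    \<open>ln S2\<close> pays for subtracting the value at the centre, and 1 makes the inequality
    strict.\<close>
  define A1 where "A1 = ln S3 + ln S2 + 1"
  obtain C where C: "\<And>f A z. f holomorphic_on ball 0 (3 / 2) \<Longrightarrow> f 0 = 0 \<Longrightarrow> (\<And>w. w \<in> ball 0 (3 / 2) \<Longrightarrow> Re (f w) < A) \<Longrightarrow>
           (\<And>w. w \<in> ball 0 (1 / 2) \<Longrightarrow> Re (f w) < A1) \<Longrightarrow> norm z \<le> 3 / 2 - \<delta> \<Longrightarrow> norm (f z) \<le> C + \<epsilon> * A"
  proof -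
    have "0 < (1 / 2 :: real)" "1 / 2 < 3 / 2 - \<delta>" "3 / 2 - \<delta> < 3 / 2" using \<delta> by auto
    from two_discs_bound[OF this \<epsilon>, of A1] show ?thesis
    proof (rule exE)
      fix C
      assume C: "\<forall>f A z. f holomorphic_on ball 0 (3 / 2) \<longrightarrow> f 0 = 0 \<longrightarrow> (\<forall>w\<in>ball 0 (3 / 2). Re (f w) < A) \<longrightarrow>
            (\<forall>w\<in>ball 0 (1 / 2). Re (f w) < A1) \<longrightarrow> norm z \<le> 3 / 2 - \<delta> \<longrightarrow> norm (f z) \<le> C + \<epsilon> * A"
      show ?thesis
      proof (rule that[of C])
        fix f :: "complex \<Rightarrow> complex" and A and z :: complex
        assume "f holomorphic_on ball 0 (3 / 2)" "f 0 = 0" "\<And>w. w \<in> ball 0 (3 / 2) \<Longrightarrow> Re (f w) < A"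
          "\<And>w. w \<in> ball 0 (1 / 2) \<Longrightarrow> Re (f w) < A1" "norm z \<le> 3 / 2 - \<delta>"
        thus "norm (f z) \<le> C + \<epsilon> * A" using C by blast
      qed
    qed
  qed
  define K where "K = ln S2 + C + \<epsilon> * (ln (5 * G) + ln S2 + 1)"
  have "zeta s \<noteq> 0 \<and> \<bar>ln (norm (zeta s))\<bar> \<le> K + \<epsilon> * ln \<bar>Im s\<bar>"
    if s: "1 / 2 + \<delta> \<le> Re s" "Re s \<le> 2" "2 \<le> \<bar>Im s\<bar>" for s
  proof -
    define T where "T = Im s"
    define c where "c = Complex 2 T"
    have T: "2 \<le> \<bar>T\<bar>" using s by (simp add: T_def)
    \<comment> \<open>\<open>2 \<le> \<bar>T\<bar>\<close> keeps the disc away from the real axis,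
      hence off the pole at 1.\<close>
    have Re: "1 / 2 < Re (c + w) \<and> 1 / 2 < \<bar>Im (c + w)\<bar>" if "w \<in> ball 0 (3 / 2)" for w
      using that abs_Re_le_cmod[of w] abs_Im_le_cmod[of w] T abs_triangle_ineq2[of T "- Im w"] by (auto simp: c_def)
    have nz: "zeta (c + w) \<noteq> 0" if "w \<in> ball 0 (3 / 2)" for w
    proof -
      have "Im (c + w) \<noteq> 0" using Re[OF that] by auto
      hence "c + w \<noteq> 1" by (metis one_complex.sel(2))
      thus ?thesis using zeta1_nonzero[OF RH, of "c + w"] Re[OF that] by (simp add: zeta1_eq)
    qed
    have hol: "(\<lambda>w. zeta (c + w)) holomorphic_on ball 0 (3 / 2)"
    proof -
      have "(zeta \<circ> (\<lambda>w. c + w)) holomorphic_on ball 0 (3 / 2)"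
        by (rule holomorphic_on_compose_gen[OF _ holomorphic_zeta])
           (use Re in \<open>fastforce intro!: holomorphic_intros\<close>)+
      thus ?thesis by (simp add: o_def)
    qed
    obtain F where F: "F holomorphic_on ball 0 (3 / 2)" "\<And>w. w \<in> ball 0 (3 / 2) \<Longrightarrow> zeta (c + w) = exp (F w)"
      using contractible_imp_holomorphic_log[OF hol convex_imp_contractible[OF convex_ball] nz] by blast
    define f where "f = (\<lambda>w. F w - F 0)"
    have lnz: "ln (norm (zeta (c + w))) = Re (F w)" if "w \<in> ball 0 (3 / 2)" for w
      using F(2)[OF that] by simp
    have Ref: "Re (f w) = ln (norm (zeta (c + w))) - ln (norm (zeta c))" if "w \<in> ball 0 (3 / 2)" for w
      using lnz[OF that] lnz[of 0] by (simp add: f_def)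
    have c0: "zeta c \<noteq> 0" using nz[of 0] by simp
    have c1: "norm (zeta c) \<le> S2" "norm (1 / zeta c) \<le> S2" unfolding S2_def
      by (rule norm_zeta_le norm_inverse_zeta_le; simp add: c_def)+
    hence "1 / S2 \<le> norm (zeta c)" using c0 S by (simp add: norm_divide field_simps)
    hence "ln (1 / S2) \<le> ln (norm (zeta c))" using S c0 by (subst ln_le_cancel_iff) auto
    hence l1: "- ln S2 \<le> ln (norm (zeta c))" using S by (simp add: ln_div)
    have l2: "ln (norm (zeta c)) \<le> ln S2" using c1 c0 S by (subst ln_le_cancel_iff) auto
    \<comment> \<open>The 5 comes from 1 + |c + w| \<le> 1 + (2 + |T|) + 3/2 \<le> 5 |T|.\<close>
    define A where "A = ln (5 * G * \<bar>T\<bar>) + ln S2 + 1"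
    define z where "z = s - c"
    have z: "norm z \<le> 3 / 2 - \<delta>" "z \<in> ball 0 (3 / 2)" "c + z = s"
    proof -
      have "z = of_real (Re s - 2)" by (simp add: z_def c_def T_def complex_eq_iff)
      hence "norm z = \<bar>Re s - 2\<bar>" by (simp only: norm_of_real)
      thus "norm z \<le> 3 / 2 - \<delta>" using s by simp
      thus "z \<in> ball 0 (3 / 2)" using \<delta> by simp
    qed (simp add: z_def)
    have "norm (f z) \<le> C + \<epsilon> * A"
    proof (rule C[of f A z])
      show "f holomorphic_on ball 0 (3 / 2)" unfolding f_def by (intro holomorphic_intros F)
      show "f 0 = 0" by (simp add: f_def)
      show "norm z \<le> 3 / 2 - \<delta>" by fact
      fix w :: complex
      show "Re (f w) < A" if w: "w \<in> ball 0 (3 / 2)"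
      proof -
        have "norm (zeta (c + w)) \<le> G * (1 + norm (c + w))" using Re[OF w] by (intro G) auto
        also have "norm (c + w) \<le> (2 + \<bar>T\<bar>) + 3 / 2"
          using norm_triangle_ineq[of c w] cmod_le[of c] w by (simp add: c_def)
        hence "G * (1 + norm (c + w)) \<le> G * (5 * \<bar>T\<bar>)" using T G by (intro mult_left_mono) auto
        finally have "ln (norm (zeta (c + w))) \<le> ln (5 * G * \<bar>T\<bar>)"
          using nz[OF w] G T by (subst ln_le_cancel_iff) (auto simp: mult_ac)
        thus ?thesis using l1 by (simp add: Ref[OF w] A_def)
      qed
      show "Re (f w) < A1" if w: "w \<in> ball 0 (1 / 2)"
      proof -
        have w': "w \<in> ball 0 (3 / 2)" using w by simp
        have "norm (zeta (c + w)) \<le> S3" unfolding S3_def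
          by (rule norm_zeta_le) (use w abs_Re_le_cmod[of w] in \<open>auto simp: c_def\<close>)
        hence "ln (norm (zeta (c + w))) \<le> ln S3"
          using nz[OF w'] S by (subst ln_le_cancel_iff) auto
        thus ?thesis using l1 by (simp add: Ref[OF w'] A1_def)
      qed
    qed
    moreover have "\<bar>Re (f z)\<bar> \<le> norm (f z)" by (rule abs_Re_le_cmod)
    moreover have "ln (norm (zeta s)) = Re (f z) + ln (norm (zeta c))" using Ref[OF z(2)] z(3) by simp
    ultimately have "\<bar>ln (norm (zeta s))\<bar> \<le> ln S2 + C + \<epsilon> * A" using l1 l2 by linarith
    also have "A = (ln (5 * G) + ln S2 + 1) + ln \<bar>T\<bar>"
      using G T by (simp add: A_def ln_mult)
    finally show ?thesis using nz[OF z(2)] z(3) by (simp add: K_def T_def algebra_simps)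
  qed
  thus ?thesis by blast
qed

lemma zeta_bounds:
  assumes RH: riemann_hypothesis and \<delta>: "0 < \<delta>" and \<epsilon>: "0 < \<epsilon>"
  shows "\<exists>K>0. \<forall>s. 1 / 2 + \<delta> \<le> Re s \<longrightarrow> 2 \<le> \<bar>Im s\<bar> \<longrightarrow>
           norm (zeta s) \<le> K * \<bar>Im s\<bar> powr \<epsilon> \<and> norm (1 / zeta s) \<le> K * \<bar>Im s\<bar> powr \<epsilon>"
proof -
  \<comment> \<open>\<open>log_zeta_bound\<close> asks for a value below 1/2; a smaller one covers a
    larger half-plane.\<close>
  define \<delta>' where "\<delta>' = min \<delta> (1 / 4)"
  have \<delta>': "0 < \<delta>'" "\<delta>' < 1 / 2" "\<delta>' \<le> \<delta>" using \<delta> by (auto simp: \<delta>'_def)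
  obtain K where K: "\<And>s. 1 / 2 + \<delta>' \<le> Re s \<Longrightarrow> Re s \<le> 2 \<Longrightarrow> 2 \<le> \<bar>Im s\<bar> \<Longrightarrow>
           zeta s \<noteq> 0 \<and> \<bar>ln (norm (zeta s))\<bar> \<le> K + \<epsilon> * ln \<bar>Im s\<bar>"
    using log_zeta_bound[OF RH \<delta>'(1,2) \<epsilon>] by blast
  define S2 where "S2 = (\<Sum>\<^sub>\<infinity>n::nat\<in>{1..}. real n powr (-2))"
  have S2: "0 \<le> S2" unfolding S2_def by (intro infsum_nonneg) auto
  have "norm (zeta s) \<le> (exp K + S2) * \<bar>Im s\<bar> powr \<epsilon> \<and> norm (1 / zeta s) \<le> (exp K + S2) * \<bar>Im s\<bar> powr \<epsilon>"
    if s: "1 / 2 + \<delta> \<le> Re s" "2 \<le> \<bar>Im s\<bar>" for s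
  proof (cases "Re s \<le> 2")
    case True
    have k: "zeta s \<noteq> 0" "\<bar>ln (norm (zeta s))\<bar> \<le> K + \<epsilon> * ln \<bar>Im s\<bar>" using K[of s] s True \<delta>' by auto
    have e: "exp (K + \<epsilon> * ln \<bar>Im s\<bar>) \<le> (exp K + S2) * \<bar>Im s\<bar> powr \<epsilon>"
      using s S2 by (simp add: exp_add powr_def distrib_right)
    have "norm (zeta s) = exp (ln (norm (zeta s)))" using k by simp
    also have "\<dots> \<le> exp (K + \<epsilon> * ln \<bar>Im s\<bar>)" using k(2) by (subst exp_le_cancel_iff) linarith
    finally have 1: "norm (zeta s) \<le> exp (K + \<epsilon> * ln \<bar>Im s\<bar>)" .
    have "norm (1 / zeta s) = exp (- ln (norm (zeta s)))" using k by (simp add: exp_minus norm_divide norm_inverse divide_inverse)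
    also have "\<dots> \<le> exp (K + \<epsilon> * ln \<bar>Im s\<bar>)" using k(2) by (subst exp_le_cancel_iff) linarith
    finally show ?thesis using 1 e by linarith
  next
    case False
    have "S2 * 1 \<le> (exp K + S2) * \<bar>Im s\<bar> powr \<epsilon>"
      using s S2 \<epsilon> by (intro mult_mono ge_one_powr_ge_zero) auto
    moreover have "norm (zeta s) \<le> S2" "norm (1 / zeta s) \<le> S2"
      unfolding S2_def using False by (intro norm_zeta_le norm_inverse_zeta_le; simp)+
    ultimately show ?thesis by simp
  qed
  moreover have "0 < exp K + S2" using S2 by (simp add: add_pos_nonneg)
  ultimately show ?thesis by blast
qed

text \<open>\<open>1 / \<zeta>(s)\<close>, with the correct value at \<open>s = 1\<close>, where \<open>zeta\<close> is unspecified.\<close>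

definition zinv :: "complex \<Rightarrow> complex" where
  "zinv s = (s - 1) / zeta1 s"

lemma zinv_eq: "0 < Re s \<Longrightarrow> s \<noteq> 1 \<Longrightarrow> zinv s = 1 / zeta s"
  by (simp add: zinv_def zeta1_eq)

lemma holomorphic_zinv:
  assumes RH: riemann_hypothesis shows "zinv holomorphic_on {s. 1 / 2 < Re s}"
  unfolding zinv_def[abs_def]
  by (intro holomorphic_intros holomorphic_on_subset[OF holomorphic_zeta1]) (auto simp: zeta1_nonzero[OF RH])

text \<open>Large heights are covered by \<open>zeta_bounds\<close>, the far right by absolute
  convergence, and the remaining compact rectangle by continuity, as \<open>zinv\<close> has no
  singularity at 1.\<close>

lemma zinv_bound:
  assumes RH: riemann_hypothesis and \<delta>: "0 < \<delta>" and \<epsilon>: "0 < \<epsilon>"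
  shows "\<exists>K>0. \<forall>s. 1 / 2 + \<delta> \<le> Re s \<longrightarrow> norm (zinv s) \<le> K * (1 + \<bar>Im s\<bar>) powr \<epsilon>"
proof -
  obtain K where K: "0 < K" "\<And>s. 1 / 2 + \<delta> \<le> Re s \<Longrightarrow> 2 \<le> \<bar>Im s\<bar> \<Longrightarrow> norm (1 / zeta s) \<le> K * \<bar>Im s\<bar> powr \<epsilon>"
    using zeta_bounds[OF assms] by blast
  define S2 where "S2 = (\<Sum>\<^sub>\<infinity>n::nat\<in>{1..}. real n powr (-2))"
  have S2: "0 \<le> S2" unfolding S2_def by (intro infsum_nonneg) auto
  define B where "B = cbox (Complex (1 / 2 + \<delta>) (-2)) (Complex 2 2)"
  have "continuous_on B zinv"
    by (rule holomorphic_on_imp_continuous_on[OF holomorphic_on_subset[OF holomorphic_zinv[OF RH]]])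
       (use \<delta> in \<open>auto simp: B_def in_cbox_complex_iff\<close>)
  hence "compact (zinv ` B)" by (intro compact_continuous_image) (auto simp: B_def)
  then obtain M where M: "\<And>s. s \<in> B \<Longrightarrow> norm (zinv s) \<le> M"
    using compact_imp_bounded bounded_iff by (metis imageI)
  define L where "L = K + S2 + \<bar>M\<bar>"
  have "norm (zinv s) \<le> L * (1 + \<bar>Im s\<bar>) powr \<epsilon>" if s: "1 / 2 + \<delta> \<le> Re s" for s
  proof -
    have one: "1 \<le> (1 + \<bar>Im s\<bar>) powr \<epsilon>" using \<epsilon> by (intro ge_one_powr_ge_zero) auto
    have L: "x \<le> L * (1 + \<bar>Im s\<bar>) powr \<epsilon>" if "x \<le> S2 + \<bar>M\<bar>" for x
    proof -
      have "x \<le> L * 1" using that K by (simp add: L_def)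
      also have "\<dots> \<le> L * (1 + \<bar>Im s\<bar>) powr \<epsilon>" using one K S2 by (intro mult_left_mono) (auto simp: L_def)
      finally show ?thesis .
    qed
    consider "2 \<le> \<bar>Im s\<bar>" | "\<bar>Im s\<bar> \<le> 2" "Re s \<le> 2" | "2 \<le> Re s" by linarith
    thus ?thesis
    proof cases
      case 1
      hence "s \<noteq> 1" by auto
      hence "norm (zinv s) \<le> K * \<bar>Im s\<bar> powr \<epsilon>" using K(2)[OF s 1] s \<delta> by (simp add: zinv_eq)
      also have "\<dots> \<le> L * (1 + \<bar>Im s\<bar>) powr \<epsilon>"
        using K S2 \<epsilon> by (intro mult_mono powr_mono2) (auto simp: L_def)
      finally show ?thesis .
    next
      case 2
      hence "norm (zinv s) \<le> M" using s by (intro M) (auto simp: B_def in_cbox_complex_iff)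
      thus ?thesis using S2 by (intro L) auto
    next
      case 3
      hence "s \<noteq> 1" by auto
      moreover have "norm (1 / zeta s) \<le> S2" unfolding S2_def by (rule norm_inverse_zeta_le) (use 3 in auto)
      ultimately have "norm (zinv s) \<le> S2" using 3 by (simp add: zinv_eq)
      thus ?thesis by (intro L) auto
    qed
  qed
  moreover have "0 < L" using K S2 by (simp add: L_def)
  ultimately show ?thesis by blast
qed

lemma zeta_vline_bound:
  assumes RH: riemann_hypothesis and \<sigma>: "1 / 2 < \<sigma>" "\<sigma> \<noteq> 1" and \<epsilon>: "0 < \<epsilon>"
  shows "\<exists>K>0. \<forall>s. Re s = \<sigma> \<longrightarrow> norm (zeta s) \<le> K * (1 + \<bar>Im s\<bar>) powr \<epsilon>"
proof -
  have d: "0 < \<sigma> - 1 / 2" using \<sigma> by simp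
  obtain K where K: "0 < K" "\<And>s. 1 / 2 + (\<sigma> - 1 / 2) \<le> Re s \<Longrightarrow> 2 \<le> \<bar>Im s\<bar> \<Longrightarrow> norm (zeta s) \<le> K * \<bar>Im s\<bar> powr \<epsilon>"
    using zeta_bounds[OF RH d \<epsilon>] by blast
  define B where "B = cbox (Complex \<sigma> (-2)) (Complex \<sigma> 2)"
  have "continuous_on B zeta"
    by (rule holomorphic_on_imp_continuous_on[OF holomorphic_on_subset[OF holomorphic_zeta]])
       (use \<sigma> in \<open>auto simp: B_def in_cbox_complex_iff\<close>)
  hence "compact (zeta ` B)" by (intro compact_continuous_image) (auto simp: B_def)
  then obtain M where M: "\<And>s. s \<in> B \<Longrightarrow> norm (zeta s) \<le> M"
    using compact_imp_bounded bounded_iff by (metis imageI)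
  have "norm (zeta s) \<le> (K + \<bar>M\<bar>) * (1 + \<bar>Im s\<bar>) powr \<epsilon>" if s: "Re s = \<sigma>" for s
  proof (cases "2 \<le> \<bar>Im s\<bar>")
    case True
    hence "norm (zeta s) \<le> K * \<bar>Im s\<bar> powr \<epsilon>" using K(2)[of s] s by simp
    also have "\<dots> \<le> (K + \<bar>M\<bar>) * (1 + \<bar>Im s\<bar>) powr \<epsilon>"
      using K \<epsilon> by (intro mult_mono powr_mono2) auto
    finally show ?thesis .
  next
    case False
    hence "norm (zeta s) \<le> M" using s by (intro M) (auto simp: B_def in_cbox_complex_iff)
    also have "\<dots> \<le> (K + \<bar>M\<bar>) * 1" using K by simp
    also have "\<dots> \<le> (K + \<bar>M\<bar>) * (1 + \<bar>Im s\<bar>) powr \<epsilon>"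
      using K \<epsilon> by (intro mult_left_mono ge_one_powr_ge_zero) auto
    finally show ?thesis .
  qed
  moreover have "0 < K + \<bar>M\<bar>" using K by simp
  ultimately show ?thesis by blast
qed

section \<open>The tail of the Dirichlet series of \<open>mu k\<close>\<close>

lemma nat_powr_le_shift:
  fixes u p :: real
  assumes "0 < N" "real N \<le> u" "u \<le> 2 * real N"
  shows "u powr p \<le> 2 powr \<bar>p\<bar> * real N powr p"
proof (cases "0 \<le> p")
  case True
  have "u powr p \<le> (2 * real N) powr p" using assms True by (intro powr_mono2) auto
  thus ?thesis using True by (simp add: powr_mult)
next
  case False
  have "u powr p \<le> 1 * real N powr p" using assms False by (simp add: powr_mono2')
  also have "\<dots> \<le> 2 powr \<bar>p\<bar> * real N powr p" by (intro mult_right_mono ge_one_powr_ge_zero) auto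
  finally show ?thesis .
qed

text \<open>\<open>pkern N s\<close> is the integral of u^s over [N, N + 1], whence a bound without
  loss in \<open>N\<close> but also without decay in \<open>Im s\<close>. The mean value inequality
  replaces the integral.\<close>

lemma norm_pkern_le:
  assumes N: "0 < N"
  shows "norm (pkern N s) \<le> 2 powr \<bar>Re s\<bar> * real N powr Re s"
proof (cases "s = -1")
  case True
  have "ln (real (N + 1)) - ln (real N) = ln (1 + 1 / real N)"
  proof -
    have "1 + 1 / real N = real (N + 1) / real N" using N by (simp add: field_simps)
    thus ?thesis using N by (simp add: ln_div)
  qed
  also have "\<dots> \<le> 1 / real N" using N by (intro ln_add_one_self_le_self) auto
  also have "\<dots> \<le> 2 * (1 / real N)" using N by (simp add: field_simps)
  finally have "ln (real (N + 1)) - ln (real N) \<le> 2 * (1 / real N)" .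
  moreover have "0 \<le> ln (real (N + 1)) - ln (real N)" using N by simp
  moreover have "norm (pkern N s) = norm (complex_of_real (ln (real (N + 1)) - ln (real N)))"
    using True N by (simp add: pkern_def Ln_of_nat[of "N + 1", simplified] del: of_nat_Suc)
  hence "norm (pkern N s) = \<bar>ln (real (N + 1)) - ln (real N)\<bar>" by (simp only: norm_of_real)
  ultimately have "norm (pkern N s) \<le> 2 * (1 / real N)" by linarith
  thus ?thesis using True N by (simp add: powr_minus divide_inverse)
next
  case False
  define f where "f = (\<lambda>u. u powr (s + 1) / (s + 1))"
  define S where "S = closed_segment (complex_of_real (real N)) (of_real (real (N + 1)))"
  have S: "z = of_real (Re z) \<and> real N \<le> Re z \<and> Re z \<le> real N + 1" if "z \<in> S" for z
    using that unfolding S_def closed_segment_of_real by (auto simp: closed_segment_eq_real_ivl)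
  have "norm (f (of_real (real (N + 1))) - f (of_real (real N))) \<le>
          (2 powr \<bar>Re s\<bar> * real N powr Re s) * norm (complex_of_real (real (N + 1)) - of_real (real N))"
  proof (rule field_differentiable_bound)
    show "convex S" unfolding S_def by (rule convex_closed_segment)
    fix z assume z: "z \<in> S"
    have "z \<notin> \<real>\<^sub>\<le>\<^sub>0" using S[OF z] N by (auto simp: complex_nonpos_Reals_iff)
    hence "((\<lambda>u. u powr (s + 1)) has_field_derivative (s + 1) * z powr (s + 1 - 1)) (at z)"
      by (rule has_field_derivative_powr)
    from DERIV_cdivide[OF this, of "s + 1"] have "(f has_field_derivative z powr s) (at z)"
      using False by (simp add: f_def add_eq_0_iff2)
    thus "(f has_field_derivative z powr s) (at z within S)" by (rule has_field_derivative_at_within)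
    have "norm (z powr s) = Re z powr Re s"
      using S[OF z] N by (metis norm_powr_real_powr Reals_of_real of_nat_0_le_iff order_trans)
    also have "\<dots> \<le> 2 powr \<bar>Re s\<bar> * real N powr Re s"
      using S[OF z] N by (intro nat_powr_le_shift) auto
    finally show "norm (z powr s) \<le> 2 powr \<bar>Re s\<bar> * real N powr Re s" .
  qed (auto simp: S_def)
  moreover have "f (of_real (real (N + 1))) - f (of_real (real N)) = pkern N s"
    using False by (simp add: f_def pkern_def diff_divide_distrib)
  ultimately show ?thesis by simp
qed

text \<open>The opposite trade: estimating the two powers separately keeps the denominator s + 1 and
  thus gains decay in \<open>Im s\<close>, at the cost of a factor \<open>N\<close>.\<close>

lemma norm_pkern_le':
  assumes N: "0 < N" and "Im s \<noteq> 0"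
  shows "norm (pkern N s) \<le> (real (N + 1) powr (Re s + 1) + real N powr (Re s + 1)) / \<bar>Im s\<bar>"
proof -
  have "s \<noteq> -1" using assms by auto
  hence "norm (pkern N s) = norm (of_nat (N + 1) powr (s + 1) - of_nat N powr (s + 1) :: complex) / norm (s + 1)"
    by (simp add: pkern_def norm_divide)
  also have "\<dots> \<le> (norm (of_nat (N + 1) powr (s + 1) :: complex) + norm (of_nat N powr (s + 1) :: complex)) / \<bar>Im s\<bar>"
    using assms abs_Im_le_cmod[of "s + 1"] by (intro frac_le norm_triangle_ineq4) auto
  also have "norm (of_nat (N + 1) powr (s + 1) :: complex) = real (N + 1) powr (Re s + 1)"
    by (subst norm_nat_powr) auto
  also have "norm (of_nat N powr (s + 1) :: complex) = real N powr (Re s + 1)"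
    using N by (subst norm_nat_powr) auto
  finally show ?thesis .
qed

lemma pkern_div_decay:
  assumes N: "0 < N" and s: "Re s \<le> \<sigma>" "1 \<le> \<bar>Im s\<bar>" and \<sigma>: "-1 \<le> \<sigma>"
  shows "norm (pkern N s / s) \<le> 2 * real (N + 1) powr (\<sigma> + 1) / (Im s)\<^sup>2"
proof -
  have "norm (pkern N s) \<le> (real (N + 1) powr (Re s + 1) + real N powr (Re s + 1)) / \<bar>Im s\<bar>"
    using s N by (intro norm_pkern_le') auto
  also have "\<dots> \<le> (real (N + 1) powr (\<sigma> + 1) + real (N + 1) powr (\<sigma> + 1)) / \<bar>Im s\<bar>"
  proof (intro divide_right_mono add_mono)
    show "real (N + 1) powr (Re s + 1) \<le> real (N + 1) powr (\<sigma> + 1)"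
      using s by (intro powr_mono) auto
    have "real N powr (Re s + 1) \<le> real N powr (\<sigma> + 1)"
      using s N by (intro powr_mono) auto
    also have "\<dots> \<le> real (N + 1) powr (\<sigma> + 1)"
      using \<sigma> by (intro powr_mono2) auto
    finally show "real N powr (Re s + 1) \<le> real (N + 1) powr (\<sigma> + 1)" .
  qed auto
  finally have "norm (pkern N s) / norm s \<le> (2 * real (N + 1) powr (\<sigma> + 1) / \<bar>Im s\<bar>) / \<bar>Im s\<bar>"
    using s abs_Im_le_cmod[of s] by (intro frac_le) auto
  thus ?thesis by (simp add: norm_divide power2_eq_square abs_mult_self_eq)
qed

text \<open>The two estimates of the kernel combine to N^\<sigma> min(1, N/v) with v = |Im s|, up to
  constants, and min(1, N/v) \<le> (N/v)^\<eta> for 0 < \<eta> \<le> 1. Together with 1/|s| this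
  leaves an integrable power of 1 + v at the price of N^\<eta>.\<close>

lemma pkern_div_bound:
  assumes \<sigma>: "\<sigma> \<noteq> 0" and \<eta>: "0 < \<eta>" "\<eta> \<le> 1"
  shows "\<exists>C>0. \<forall>N s. 0 < N \<longrightarrow> Re s = \<sigma> \<longrightarrow>
           norm (pkern N s / s) \<le> C * real N powr (\<sigma> + \<eta>) * (1 + \<bar>Im s\<bar>) powr (-1-\<eta>)"
proof -
  define c where "c = 2 powr (\<bar>\<sigma>\<bar> + 2)"
  have c: "0 < c" by (simp add: c_def)
  define C where "C = 2 * c * (1 + 1 / \<bar>\<sigma>\<bar>)"
  have "norm (pkern N s / s) \<le> C * real N powr (\<sigma> + \<eta>) * (1 + \<bar>Im s\<bar>) powr (-1-\<eta>)"
    if N: "0 < N" and s: "Re s = \<sigma>" for N s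
  proof -
    define v where "v = \<bar>Im s\<bar>"
    have v: "0 \<le> v" by (simp add: v_def)
    have N1: "1 \<le> real N" using N by simp
    have k1: "norm (pkern N s) \<le> c * real N powr \<sigma>"
    proof -
      have "norm (pkern N s) \<le> 2 powr \<bar>\<sigma>\<bar> * real N powr \<sigma>"
        using norm_pkern_le[OF N, of s] s by simp
      also have "\<dots> \<le> c * real N powr \<sigma>" unfolding c_def by (intro mult_right_mono powr_mono) auto
      finally show ?thesis .
    qed
    have k2: "norm (pkern N s) \<le> c * real N powr \<sigma> * (real N / v)" if "1 \<le> v"
    proof -
      have "norm (pkern N s) \<le> (real (N + 1) powr (\<sigma> + 1) + real N powr (\<sigma> + 1)) / v"
        using norm_pkern_le'[OF N, of s] that s by (auto simp: v_def)
      also have "\<dots> \<le> (2 powr (\<bar>\<sigma>\<bar> + 1) * real N powr (\<sigma> + 1) + 2 powr (\<bar>\<sigma>\<bar> + 1) * real N powr (\<sigma> + 1)) / v"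
      proof (intro divide_right_mono add_mono v)
        have le: "2 powr \<bar>\<sigma> + 1\<bar> \<le> (2::real) powr (\<bar>\<sigma>\<bar> + 1)" by (intro powr_mono) auto
        have "real (N + 1) powr (\<sigma> + 1) \<le> 2 powr \<bar>\<sigma> + 1\<bar> * real N powr (\<sigma> + 1)"
          using N by (intro nat_powr_le_shift) auto
        also have "\<dots> \<le> 2 powr (\<bar>\<sigma>\<bar> + 1) * real N powr (\<sigma> + 1)"
          using le by (intro mult_right_mono) auto
        finally show "real (N + 1) powr (\<sigma> + 1) \<le> 2 powr (\<bar>\<sigma>\<bar> + 1) * real N powr (\<sigma> + 1)" .
        have "1 * real N powr (\<sigma> + 1) \<le> 2 powr (\<bar>\<sigma>\<bar> + 1) * real N powr (\<sigma> + 1)"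
          by (intro mult_right_mono ge_one_powr_ge_zero) auto
        thus "real N powr (\<sigma> + 1) \<le> 2 powr (\<bar>\<sigma>\<bar> + 1) * real N powr (\<sigma> + 1)" by simp
      qed
      also have "\<dots> = c * real N powr \<sigma> * (real N / v)"
        using N by (simp add: c_def powr_add)
      finally show ?thesis .
    qed
    have key: "norm (pkern N s) \<le> c * real N powr (\<sigma> + \<eta>) * (2 * (1 + v) powr (-\<eta>))"
    proof (cases "1 \<le> v")
      case False
      have "(1 + v) powr \<eta> \<le> 2 powr 1" using False v \<eta> by (intro powr_mono_both) auto
      hence "1 \<le> 2 * (1 + v) powr (-\<eta>)" using v by (simp add: powr_minus field_simps)
      moreover have "real N powr \<sigma> \<le> real N powr (\<sigma> + \<eta>)" using N1 \<eta> by (intro powr_mono) auto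
      ultimately have "c * real N powr \<sigma> * 1 \<le> c * real N powr (\<sigma> + \<eta>) * (2 * (1 + v) powr (-\<eta>))"
        using c by (intro mult_mono mult_left_mono) auto
      thus ?thesis using k1 by simp
    next
      case True
      have "norm (pkern N s) \<le> c * real N powr \<sigma> * (real N / v) powr \<eta>"
      proof (cases "v \<le> real N")
        case T: True
        have "1 \<le> (real N / v) powr \<eta>" using T True \<eta> by (intro ge_one_powr_ge_zero) auto
        hence "c * real N powr \<sigma> * 1 \<le> c * real N powr \<sigma> * (real N / v) powr \<eta>"
          using c by (intro mult_left_mono) auto
        thus ?thesis using k1 by simp
      next
        case F: False
        have "(real N / v) powr 1 \<le> (real N / v) powr \<eta>"
          using F True \<eta> N by (intro powr_mono') auto
        hence "real N / v \<le> (real N / v) powr \<eta>" using N True by simp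
        hence "c * real N powr \<sigma> * (real N / v) \<le> c * real N powr \<sigma> * (real N / v) powr \<eta>"
          using c by (intro mult_left_mono) auto
        thus ?thesis using k2[OF True] by simp
      qed
      also have "(real N / v) powr \<eta> = real N powr \<eta> * v powr (-\<eta>)"
        using N True by (simp add: powr_divide powr_minus_divide)
      also have "c * real N powr \<sigma> * (real N powr \<eta> * v powr (-\<eta>)) = c * real N powr (\<sigma> + \<eta>) * v powr (-\<eta>)"
        by (simp add: powr_add)
      also have "\<dots> \<le> c * real N powr (\<sigma> + \<eta>) * (2 * (1 + v) powr (-\<eta>))"
      proof (intro mult_left_mono)
        have "(1 + v) powr \<eta> \<le> (2 * v) powr \<eta>" using True \<eta> by (intro powr_mono2) auto
        also have "\<dots> = 2 powr \<eta> * v powr \<eta>" using True by (simp add: powr_mult)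
        also have "\<dots> \<le> 2 powr 1 * v powr \<eta>" using \<eta> by (intro mult_right_mono powr_mono) auto
        finally show "v powr (-\<eta>) \<le> 2 * (1 + v) powr (-\<eta>)"
          using True by (simp add: powr_minus field_simps)
      qed (use c in auto)
      finally show ?thesis .
    qed
    \<comment> \<open>\<open>\<sigma> \<noteq> 0\<close> bounds |s| from below, so |s| dominates a
      multiple of 1 + v even near the real axis.\<close>
    have ns: "1 + v \<le> (1 + 1 / \<bar>\<sigma>\<bar>) * norm s"
    proof -
      have "\<bar>\<sigma>\<bar> \<le> norm s" "v \<le> norm s" using s abs_Re_le_cmod[of s] abs_Im_le_cmod[of s] by (auto simp: v_def)
      hence "1 \<le> 1 / \<bar>\<sigma>\<bar> * norm s" "v \<le> norm s" using \<sigma> by (simp_all add: field_simps)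
      thus ?thesis by (simp add: algebra_simps)
    qed
    have s0: "0 < norm s" using s \<sigma> by auto
    have "norm (pkern N s / s) = norm (pkern N s) * (1 / norm s)" by (simp add: norm_divide)
    also have "1 / norm s \<le> (1 + 1 / \<bar>\<sigma>\<bar>) / (1 + v)" using ns s0 v by (simp add: field_simps)
    hence "norm (pkern N s) * (1 / norm s) \<le> (c * real N powr (\<sigma> + \<eta>) * (2 * (1 + v) powr (-\<eta>))) * ((1 + 1 / \<bar>\<sigma>\<bar>) / (1 + v))"
      using key s0 c by (intro mult_mono) auto
    also have "\<dots> = C * real N powr (\<sigma> + \<eta>) * ((1 + v) powr (-\<eta>) / (1 + v))"
      by (simp add: C_def)
    also have "(1 + v) powr (-\<eta>) / (1 + v) = (1 + v) powr (-1-\<eta>)"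
      using v by (simp add: powr_diff powr_minus field_simps)
    finally show ?thesis by (simp add: v_def)
  qed
  moreover have "0 < C" using c \<sigma> by (simp add: C_def add_pos_nonneg)
  ultimately show ?thesis by blast
qed

section \<open>Powers of 1/zeta and the tail of their coefficients\<close>

lemma zinv_power_bound:
  assumes RH: riemann_hypothesis and \<delta>: "0 < \<delta>" and \<epsilon>: "0 < \<epsilon>"
  shows "\<exists>K>0. \<forall>s. 1 / 2 + \<delta> \<le> Re s \<longrightarrow> norm (zinv s ^ k) \<le> K * (1 + \<bar>Im s\<bar>) powr \<epsilon>"
proof -
  \<comment> \<open>\<open>real k + 1\<close> in the denominator covers \<open>k = 0\<close> as
    well, and k \<epsilon> / (k + 1) stays below \<epsilon>.\<close>
  have e: "0 < \<epsilon> / (real k + 1)" using \<epsilon> by simp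
  obtain K where K: "0 < K" "\<And>s. 1 / 2 + \<delta> \<le> Re s \<Longrightarrow> norm (zinv s) \<le> K * (1 + \<bar>Im s\<bar>) powr (\<epsilon> / (real k + 1))"
    using zinv_bound[OF RH \<delta> e] by blast
  have "norm (zinv s ^ k) \<le> K ^ k * (1 + \<bar>Im s\<bar>) powr \<epsilon>" if "1 / 2 + \<delta> \<le> Re s" for s
  proof -
    have "norm (zinv s ^ k) = norm (zinv s) ^ k" by (rule norm_power)
    also have "\<dots> \<le> (K * (1 + \<bar>Im s\<bar>) powr (\<epsilon> / (real k + 1))) ^ k"
      using K(2)[OF that] by (intro power_mono) auto
    also have "\<dots> = K ^ k * (1 + \<bar>Im s\<bar>) powr (\<epsilon> / (real k + 1) * real k)"
    proof -
      have "((1 + \<bar>Im s\<bar>) powr (\<epsilon> / (real k + 1))) ^ k = (1 + \<bar>Im s\<bar>) powr (\<epsilon> / (real k + 1) * real k)"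
        by (subst powr_realpow[symmetric]) (auto simp: powr_powr)
      thus ?thesis by (simp only: power_mult_distrib)
    qed
    also have "\<dots> \<le> K ^ k * (1 + \<bar>Im s\<bar>) powr \<epsilon>"
      using \<epsilon> K by (intro mult_left_mono powr_mono) (auto simp: field_simps)
    finally show ?thesis .
  qed
  moreover have "0 < K ^ k" using K by simp
  ultimately show ?thesis by blast
qed

text \<open>The continuation of \<open>\<Sum>\<^sub>d\<^sub>>\<^sub>Y mu k d d\<^sup>-\<^sup>s\<close> to \<open>Re s > 1 / 2\<close>.\<close>

definition mu_tail :: "nat \<Rightarrow> nat \<Rightarrow> complex \<Rightarrow> complex" where
  "mu_tail k Y s = zinv s ^ k - (\<Sum>d=1..Y. mu k d * of_nat d powr (-s))"

lemma has_sum_mu': "1 < Re s \<Longrightarrow> ((\<lambda>n. mu k n * of_nat n powr (-s)) has_sum (zinv s ^ k)) {1..}"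
  using has_sum_mu[of s k] by (subst zinv_eq) (auto simp: power_divide)

lemma has_sum_diff:
  fixes f g :: "'i \<Rightarrow> complex"
  assumes "(f has_sum F) I" "(g has_sum G) I"
  shows "((\<lambda>i. f i - g i) has_sum F - G) I"
  using has_sum_add[OF assms(1) has_sum_uminusI[OF assms(2)]] by simp

lemma powr_one_plus_abs_add_le:
  fixes t v e :: real
  assumes "0 \<le> e" shows "(1 + \<bar>t + v\<bar>) powr e \<le> (1 + \<bar>t\<bar>) powr e * (1 + \<bar>v\<bar>) powr e"
proof -
  have "(1 + \<bar>t\<bar>) * (1 + \<bar>v\<bar>) = 1 + \<bar>t\<bar> + \<bar>v\<bar> + \<bar>t\<bar> * \<bar>v\<bar>" by (simp add: algebra_simps)
  hence "1 + \<bar>t + v\<bar> \<le> (1 + \<bar>t\<bar>) * (1 + \<bar>v\<bar>)"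
    using abs_triangle_ineq[of t v] mult_nonneg_nonneg[OF abs_ge_zero abs_ge_zero, of t v] by linarith
  hence "(1 + \<bar>t + v\<bar>) powr e \<le> ((1 + \<bar>t\<bar>) * (1 + \<bar>v\<bar>)) powr e"
    using assms by (intro powr_mono2) auto
  thus ?thesis by (simp add: powr_mult)
qed

text \<open>Perron's formula in \<open>w\<close> for the series at s + w yields the partial sum up
  to \<open>Y\<close>, and the residue at w = 0 would be the full value \<open>g 0\<close>.
  Subtracting \<open>g 0\<close> at the index d = 1 removes this pole. The shift to Re w = 1/2 +
  \<delta> - \<sigma> < 0 then saves a power of \<open>Y\<close>.\<close>

lemma mu_tail_bound:
  assumes RH: riemann_hypothesis and \<delta>: "0 < \<delta>" "1 / 2 + \<delta> < \<sigma>" and \<epsilon>: "0 < \<epsilon>"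
  shows "\<exists>C>0. \<forall>Y s. 0 < Y \<longrightarrow> Re s = \<sigma> \<longrightarrow>
           norm (mu_tail k Y s) \<le> C * real Y powr (1 / 2 + \<delta> - \<sigma> + \<epsilon>) * (1 + \<bar>Im s\<bar>) powr \<epsilon>"
proof -
  \<comment> \<open>\<open>pkern_div_bound\<close> needs \<eta> \<le> 1. Half of \<eta> pays for the
    growth of 1/zeta, the other half remains as decay.\<close>
  define \<eta> where "\<eta> = min \<epsilon> 1"
  have \<eta>: "0 < \<eta>" "\<eta> \<le> 1" "\<eta> \<le> \<epsilon>" "0 < \<eta> / 2" using \<epsilon> by (auto simp: \<eta>_def)
  define \<sigma>' where "\<sigma>' = 1 / 2 + \<delta> - \<sigma>"
  have \<sigma>': "\<sigma>' < 0" "\<sigma>' \<noteq> 0" using \<delta> by (auto simp: \<sigma>'_def)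
  obtain K where K: "0 < K" "\<And>s. 1 / 2 + \<delta> \<le> Re s \<Longrightarrow> norm (zinv s ^ k) \<le> K * (1 + \<bar>Im s\<bar>) powr (\<eta> / 2)"
    using zinv_power_bound[OF RH \<delta>(1) \<eta>(4), of k] by blast
  obtain C where C: "0 < C" "\<And>N s. 0 < N \<Longrightarrow> Re s = \<sigma>' \<Longrightarrow>
           norm (pkern N s / s) \<le> C * real N powr (\<sigma>' + \<eta>) * (1 + \<bar>Im s\<bar>) powr (-1-\<eta>)"
    using pkern_div_bound[OF \<sigma>'(2) \<eta>(1,2)] by blast
  define C' where "C' = 2 * K * C / (\<eta> / 2)"
  have "norm (mu_tail k Y s) \<le> C' * real Y powr (1 / 2 + \<delta> - \<sigma> + \<epsilon>) * (1 + \<bar>Im s\<bar>) powr \<epsilon>"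
    if Y: "0 < Y" and s: "Re s = \<sigma>" for Y s
  proof -
    define t where "t = Im s"
    define g where "g = (\<lambda>w. zinv (s + w) ^ k)"
    define S where "S = {w. 1 / 2 - \<sigma> < Re w}"
    have g: "g holomorphic_on S"
    proof -
      have "(zinv \<circ> (\<lambda>w. s + w)) holomorphic_on S"
        by (rule holomorphic_on_compose_gen[OF _ holomorphic_zinv[OF RH]])
           (use s in \<open>auto simp: S_def intro!: holomorphic_intros\<close>)
      thus ?thesis unfolding g_def by (intro holomorphic_intros) (simp add: o_def)
    qed
    have S: "open S" unfolding S_def by (rule open_halfspace_Re_gt)
    \<comment> \<open>The kernel carries 1/w; it is absorbed into the difference quotient of
      \<open>g\<close> at 0, which extends holomorphically.\<close>
    define H where "H = (\<lambda>w. (if w = 0 then deriv g 0 else (g w - g 0) / (w - 0)) * pkern Y w)"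
    define a where "a = (\<lambda>d. mu k d * of_nat d powr (-s) - (if d = 1 then g 0 else 0))"
    define B where "B = 2 * K * C * (1 + \<bar>t\<bar>) powr (\<eta> / 2) * real Y powr (\<sigma>' + \<eta>)"
    have gb: "norm (g w - g 0) \<le> 2 * K * (1 + \<bar>t\<bar>) powr (\<eta> / 2) * (1 + \<bar>Im w\<bar>) powr (\<eta> / 2)" if "\<sigma>' \<le> Re w" for w
    proof -
      have "norm (g w) \<le> K * (1 + \<bar>t + Im w\<bar>) powr (\<eta> / 2)"
        unfolding g_def using K(2)[of "s + w"] that s by (simp add: \<sigma>'_def t_def)
      also have "\<dots> \<le> K * ((1 + \<bar>t\<bar>) powr (\<eta> / 2) * (1 + \<bar>Im w\<bar>) powr (\<eta> / 2))"
        using K \<eta> by (intro mult_left_mono powr_one_plus_abs_add_le) auto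
      finally have 1: "norm (g w) \<le> K * (1 + \<bar>t\<bar>) powr (\<eta> / 2) * (1 + \<bar>Im w\<bar>) powr (\<eta> / 2)" by simp
      have "norm (g 0) \<le> K * (1 + \<bar>t\<bar>) powr (\<eta> / 2) * 1"
        unfolding g_def using K(2)[of s] s \<delta> by (simp add: t_def)
      also have "\<dots> \<le> K * (1 + \<bar>t\<bar>) powr (\<eta> / 2) * (1 + \<bar>Im w\<bar>) powr (\<eta> / 2)"
        using K \<eta> by (intro mult_left_mono ge_one_powr_ge_zero) auto
      finally show ?thesis using 1 norm_triangle_ineq4[of "g w" "g 0"] by simp
    qed
    have H': "H w = (g w - g 0) * (pkern Y w / w)" if "w \<noteq> 0" for w
      using that by (simp add: H_def)
    have "norm (\<Sum>\<^sub>\<infinity>d\<in>{d \<in> {1..}. d \<le> Y}. a d) \<le> B / (\<eta> / 2)"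
    proof (rule perron_shift[where \<sigma> = 2 and \<sigma>' = \<sigma>' and H = H and S = S and A = "\<lambda>w. g w - g 0" and ?T0.0 = 1
          and lam = "\<lambda>d. d" and C = "2 * K * (1 + \<bar>t\<bar>) powr (\<eta> / 2) * (2 * (2 * real (Y + 1) powr (2 + 1)))"])
      fix w :: complex assume w: "Re w = 2"
      have "((\<lambda>d. mu k d * of_nat d powr (-(s + w))) has_sum g w) {1..}"
        unfolding g_def by (rule has_sum_mu') (use w s \<delta> in simp)
      moreover have "((\<lambda>d::nat. (if d = 1 then g 0 else 0)) has_sum g 0) {1..}"
        by (rule has_sum_finite_neutralI[where B = "{1}"]) auto
      ultimately have "((\<lambda>d. mu k d * of_nat d powr (-(s + w)) - (if d = 1 then g 0 else 0)) has_sum g w - g 0) {1..}"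
        by (rule has_sum_diff)
      also have "?this \<longleftrightarrow> ((\<lambda>d. a d * of_nat d powr (-w)) has_sum g w - g 0) {1..}"
        by (intro has_sum_cong) (auto simp: a_def powr_add powr_diff powr_minus field_simps)
      finally show "((\<lambda>d. a d * of_nat d powr (-w)) has_sum g w - g 0) {1..}" .
      show "H w = (g w - g 0) * (pkern Y w / w)" using w by (intro H') auto
    next
      show "H holomorphic_on S" unfolding H_def
        by (intro holomorphic_on_mult pole_lemma_open g S holomorphic_on_subset[OF holomorphic_pkern[OF Y]]) auto
      show "w \<in> S" if "\<sigma>' \<le> Re w" for w using that \<delta> by (auto simp: S_def \<sigma>'_def)
      show "norm (H w) \<le> 2 * K * (1 + \<bar>t\<bar>) powr (\<eta> / 2) * (2 * (2 * real (Y + 1) powr (2 + 1))) / \<bar>Im w\<bar>"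
        if w: "\<sigma>' \<le> Re w" "Re w \<le> 2" "1 \<le> \<bar>Im w\<bar>" for w
      proof -
        have "w \<noteq> 0" using w by auto
        hence "norm (H w) = norm (g w - g 0) * norm (pkern Y w / w)" by (simp only: H' norm_mult not_False_eq_True)
        also have "\<dots> \<le> (2 * K * (1 + \<bar>t\<bar>) powr (\<eta> / 2) * (1 + \<bar>Im w\<bar>) powr (\<eta> / 2)) * (2 * real (Y + 1) powr (2 + 1) / (Im w)\<^sup>2)"
          using w K Y by (intro mult_mono gb pkern_div_decay) auto
        also have "(1 + \<bar>Im w\<bar>) powr (\<eta> / 2) \<le> (1 + \<bar>Im w\<bar>) powr 1" using \<eta> by (intro powr_mono) auto
        also have "\<dots> \<le> 2 * \<bar>Im w\<bar>" using w by simp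
        also have "(2 * K * (1 + \<bar>t\<bar>) powr (\<eta> / 2) * (2 * \<bar>Im w\<bar>)) * (2 * real (Y + 1) powr (2 + 1) / (Im w)\<^sup>2)
             = 2 * K * (1 + \<bar>t\<bar>) powr (\<eta> / 2) * (2 * (2 * real (Y + 1) powr (2 + 1))) / \<bar>Im w\<bar>"
        proof -
          have "(Im w)\<^sup>2 = \<bar>Im w\<bar> * \<bar>Im w\<bar>" by (simp add: power2_eq_square)
          thus ?thesis using w by (simp add: divide_simps)
        qed
        finally show ?thesis using K by (simp add: mult_left_mono mult_right_mono divide_right_mono)
      qed
      show "norm (H (Complex \<sigma>' v)) \<le> B * (1 + \<bar>v\<bar>) powr (-1 - \<eta> / 2)" for v
      proof -
        define w where "w = Complex \<sigma>' v"
        have w: "w \<noteq> 0" "Re w = \<sigma>'" "Im w = v" using \<sigma>' by (auto simp: w_def complex_eq_iff)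
        have "norm (H w) = norm (g w - g 0) * norm (pkern Y w / w)" unfolding H'[OF w(1)] by (rule norm_mult)
        also have "\<dots> \<le> (2 * K * (1 + \<bar>t\<bar>) powr (\<eta> / 2) * (1 + \<bar>v\<bar>) powr (\<eta> / 2)) * (C * real Y powr (\<sigma>' + \<eta>) * (1 + \<bar>v\<bar>) powr (-1-\<eta>))"
          using w K C(2)[OF Y, of w] gb[of w] by (intro mult_mono) auto
        also have "\<dots> = B * ((1 + \<bar>v\<bar>) powr (\<eta> / 2) * (1 + \<bar>v\<bar>) powr (-1-\<eta>))" by (simp add: B_def)
        also have "(1 + \<bar>v\<bar>) powr (\<eta> / 2) * (1 + \<bar>v\<bar>) powr (-1-\<eta>) = (1 + \<bar>v\<bar>) powr (-1 - \<eta> / 2)"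
          unfolding powr_add[symmetric] by (rule arg_cong[where f = "\<lambda>p. (1 + \<bar>v\<bar>) powr p"]) simp
        finally show ?thesis by (simp add: w_def)
      qed
    qed (use Y \<sigma>' \<eta> K C in \<open>auto simp: B_def S\<close>)
    also have "{d \<in> {1..}. d \<le> Y} = {1..Y}" by auto
    \<comment> \<open>\<open>0 < Y\<close> puts the correction at d = 1 inside the truncated sum,
      which therefore is the partial sum minus the full value.\<close>
    also have "(\<Sum>\<^sub>\<infinity>d\<in>{1..Y}. a d) = - mu_tail k Y s"
      using Y by (simp add: a_def mu_tail_def sum_subtractf g_def sum.delta)
    finally have "norm (mu_tail k Y s) \<le> B / (\<eta> / 2)" by simp
    also have "\<dots> = C' * real Y powr (\<sigma>' + \<eta>) * (1 + \<bar>t\<bar>) powr (\<eta> / 2)" by (simp add: B_def C'_def)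
    also have "\<dots> \<le> C' * real Y powr (\<sigma>' + \<epsilon>) * (1 + \<bar>t\<bar>) powr \<epsilon>"
      using Y \<eta> K C by (intro mult_mono mult_left_mono powr_mono) (auto simp: C'_def)
    finally show ?thesis by (simp add: \<sigma>'_def t_def)
  qed
  moreover have "0 < C'" using K C \<eta> by (simp add: C'_def)
  ultimately show ?thesis by blast
qed

section \<open>The double sum\<close>

lemma nat_power_powr:
  assumes "0 < l" shows "(of_nat (l ^ a) :: complex) powr s = of_nat l powr (of_nat a * s)"
proof (induction a)
  case (Suc a)
  have "(of_nat (l ^ Suc a) :: complex) powr s = of_nat l powr s * of_nat (l ^ a) powr s"
    unfolding power_Suc by (rule nat_powr_mult)
  thus ?case unfolding Suc.IH by (simp add: powr_add distrib_right)
qed (use assms in auto)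

lemma holomorphic_mu_tail:
  assumes RH: riemann_hypothesis shows "mu_tail k Y holomorphic_on {s. 1 / 2 < Re s}"
  unfolding mu_tail_def[abs_def] by (intro holomorphic_intros holomorphic_zinv[OF RH]) auto

lemma has_sum_mu_tail:
  assumes "1 < Re s"
  shows "((\<lambda>d. (if Y < d then mu k d else 0) * of_nat d powr (-s)) has_sum mu_tail k Y s) {1..}"
proof -
  have "((\<lambda>d. (if d \<le> Y then mu k d else 0) * of_nat d powr (-s)) has_sum (\<Sum>d=1..Y. mu k d * of_nat d powr (-s))) {1..}"
    by (rule has_sum_finite_neutralI[where B = "{1..Y}"]) auto
  from has_sum_diff[OF has_sum_mu'[OF assms] this]
  have "((\<lambda>d. mu k d * of_nat d powr (-s) - (if d \<le> Y then mu k d else 0) * of_nat d powr (-s)) has_sum mu_tail k Y s) {1..}"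
    unfolding mu_tail_def .
  thus ?thesis by (rule has_sum_cong[THEN iffD1, rotated]) auto
qed

text \<open>Subtracting the value at \<open>c / a\<close> on the pairs with \<open>d = 1\<close> makes the Dirichlet series
  \<open>\<zeta>(as) (mu_tail k Y (cs) - mu_tail k Y (c/a))\<close> regular at the pole \<open>s = 1/a\<close> of \<open>\<zeta>(as)\<close>.\<close>

definition reg_coeff :: "nat \<Rightarrow> nat \<Rightarrow> nat \<Rightarrow> nat \<Rightarrow> nat \<Rightarrow> complex" where
  "reg_coeff k Y a c d = (if Y < d then mu k d else 0) -
     (if d = 1 then mu_tail k Y (of_nat c * (1 / of_nat a)) else 0)"

lemma has_sum_reg_pairs:
  assumes a: "0 < a" "a < c" and s: "1 < Re (of_nat a * s)"
  shows "((\<lambda>i. reg_coeff k Y a c (snd i) * of_nat (fst i ^ a * snd i ^ c) powr (-s)) has_sum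
           zeta (of_nat a * s) * (mu_tail k Y (of_nat c * s) - mu_tail k Y (of_nat c * (1 / of_nat a)))) ({1..} \<times> {1..})"
proof -
  define F where "F = mu_tail k Y (of_nat c * (1 / of_nat a))"
  have "0 < real a * Re s" using s by simp
  hence "0 < Re s" by (rule zero_less_mult_pos) (use a in simp)
  hence "real a * Re s \<le> real c * Re s" using a by (intro mult_right_mono) auto
  hence c: "1 < Re (of_nat c * s)" using s by simp
  have "((\<lambda>d::nat. (if d = 1 then F else 0)) has_sum F) {1..}"
    by (rule has_sum_finite_neutralI[where B = "{1}"]) auto
  from has_sum_diff[OF has_sum_mu_tail[OF c] this]
  have "((\<lambda>d. reg_coeff k Y a c d * of_nat d powr (-(of_nat c * s))) has_sum mu_tail k Y (of_nat c * s) - F) {1..}"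
    by (rule has_sum_cong[THEN iffD1, rotated]) (auto simp: reg_coeff_def F_def algebra_simps)
  from has_sum_product[OF has_sum_zeta[OF s] this]
  show ?thesis unfolding F_def
  proof (rule has_sum_cong[THEN iffD1, rotated])
    fix i :: "nat \<times> nat" assume "i \<in> {1..} \<times> {1..}"
    then obtain l d where [simp]: "i = (l, d)" and ld: "0 < l" "0 < d" by (cases i) auto
    show "(case i of (i, j) \<Rightarrow> of_nat i powr - (of_nat a * s) * (reg_coeff k Y a c j * of_nat j powr - (of_nat c * s)))
            = reg_coeff k Y a c (snd i) * of_nat (fst i ^ a * snd i ^ c) powr (-s)"
      unfolding nat_powr_mult using ld by (simp add: nat_power_powr del: of_nat_power)
  qed
qed

lemma reg_pairs_sum_bound:
  assumes RH: riemann_hypothesis and a: "0 < a" "a < c" and \<delta>: "0 < \<delta>" "\<delta> < 1 / 2" and \<eta>: "0 < \<eta>" "\<eta> \<le> 1"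
  shows "\<exists>C>0. \<forall>Y N. 0 < Y \<longrightarrow> 0 < N \<longrightarrow>
           norm (\<Sum>\<^sub>\<infinity>i\<in>{i \<in> {1..} \<times> {1..}. fst i ^ a * snd i ^ c \<le> N}. reg_coeff k Y a c (snd i))
             \<le> C * real N powr ((1 / 2 + \<delta>) / a + \<eta>) * real Y powr (1 / 2 + \<delta> - c * ((1 / 2 + \<delta>) / a) + \<eta> / 4)"
proof -
  define \<sigma>' where "\<sigma>' = (1 / 2 + \<delta>) / real a"
  define \<tau> where "\<tau> = real c * \<sigma>'"
  \<comment> \<open>On the new line zeta and \<open>mu_tail\<close> each grow at most like (1 +
    |v|)^e; with e = \<eta>/4 they consume half of the kernel's surplus decay \<eta>.\<close>
  define e where "e = \<eta> / 4"
  define q where "q = 1 / 2 + \<delta> - \<tau> + e"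
  have a1: "1 \<le> real a" "1 \<le> real c" using a by auto
  have \<sigma>': "0 < \<sigma>'" "\<sigma>' < 1 / real a" "1 / (2 * real a) < \<sigma>'" "real a * \<sigma>' = 1 / 2 + \<delta>"
    using a \<delta> by (auto simp: \<sigma>'_def field_simps)
  have "real a * \<sigma>' < real c * \<sigma>'" using a \<sigma>' by (intro mult_strict_right_mono) auto
  hence \<tau>: "1 / 2 + \<delta> < \<tau>" using \<sigma>' by (simp add: \<tau>_def)
  have "1 < real c / real a" using a by simp
  hence \<theta>: "1 / 2 + \<delta> < real c / real a" using \<delta> by linarith
  \<comment> \<open>The subtracted constant is the value of \<open>mu_tail\<close> at c/a, not left
    of \<tau>, so its bound in \<open>Y\<close> is no worse than that on the new line.\<close>
  have \<tau>\<theta>: "\<tau> \<le> real c / real a" using \<sigma>'(2) a by (simp add: \<tau>_def field_simps)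
  have e: "0 < e" "e \<le> 1" using \<eta> by (auto simp: e_def)
  obtain K1 where K1: "0 < K1" "\<And>s. Re s = 1 / 2 + \<delta> \<Longrightarrow> norm (zeta s) \<le> K1 * (1 + \<bar>Im s\<bar>) powr e"
    using zeta_vline_bound[OF RH _ _ e(1), of "1 / 2 + \<delta>"] \<delta> by auto
  obtain C2 where C2: "0 < C2" "\<And>Y s. 0 < Y \<Longrightarrow> Re s = \<tau> \<Longrightarrow> norm (mu_tail k Y s) \<le> C2 * real Y powr q * (1 + \<bar>Im s\<bar>) powr e"
    using mu_tail_bound[OF RH \<delta>(1) \<tau> e(1), of k] unfolding q_def by blast
  obtain C3 where C3: "0 < C3" "\<And>Y s. 0 < Y \<Longrightarrow> Re s = real c / real a \<Longrightarrow>
      norm (mu_tail k Y s) \<le> C3 * real Y powr (1 / 2 + \<delta> - real c / real a + e) * (1 + \<bar>Im s\<bar>) powr e"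
    using mu_tail_bound[OF RH \<delta>(1) \<theta> e(1), of k] by blast
  obtain C4 where C4: "0 < C4" "\<And>N s. 0 < N \<Longrightarrow> Re s = \<sigma>' \<Longrightarrow>
           norm (pkern N s / s) \<le> C4 * real N powr (\<sigma>' + \<eta>) * (1 + \<bar>Im s\<bar>) powr (-1-\<eta>)"
    using pkern_div_bound[of \<sigma>' \<eta>] \<sigma>'(1) \<eta> by auto
  \<comment> \<open>Exponents 1/2 suffice for the horizontal sides: zeta and \<open>mu_tail\<close>
    together grow at most like |Im s|, against a kernel of order |Im s|^-2.\<close>
  obtain K5 where K5: "0 < K5" "\<And>s. 1 / 2 + \<delta> \<le> Re s \<Longrightarrow> 2 \<le> \<bar>Im s\<bar> \<Longrightarrow> norm (zeta s) \<le> K5 * \<bar>Im s\<bar> powr (1 / 2)"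
    using zeta_bounds[OF RH \<delta>(1), of "1 / 2"] by auto
  obtain K6 where K6: "0 < K6" "\<And>s. 1 / 2 + \<delta> \<le> Re s \<Longrightarrow> norm (zinv s ^ k) \<le> K6 * (1 + \<bar>Im s\<bar>) powr (1 / 2)"
    using zinv_power_bound[OF RH \<delta>(1), of "1 / 2" k] by auto
  define C where "C = K1 * real a * (C2 * real c + C3) * C4 / (\<eta> / 2)"
  have scale: "(1 + \<bar>m * v\<bar>) powr p \<le> m * (1 + \<bar>v\<bar>) powr p" if "1 \<le> m" "0 \<le> p" "p \<le> 1" for m v p :: real
  proof -
    have "(1 + \<bar>m * v\<bar>) powr p \<le> (m * (1 + \<bar>v\<bar>)) powr p"
      using that by (intro powr_mono2) (auto simp: abs_mult algebra_simps)
    also have "\<dots> = m powr p * (1 + \<bar>v\<bar>) powr p" using that by (simp add: powr_mult)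
    also have "\<dots> \<le> m powr 1 * (1 + \<bar>v\<bar>) powr p" using that by (intro mult_right_mono powr_mono) auto
    finally show ?thesis using that by simp
  qed
  have "norm (\<Sum>\<^sub>\<infinity>i\<in>{i \<in> {1..} \<times> {1..}. fst i ^ a * snd i ^ c \<le> N}. reg_coeff k Y a c (snd i))
             \<le> C * real N powr (\<sigma>' + \<eta>) * real Y powr q"
    if Y: "0 < Y" and N: "0 < N" for Y N
  proof -
    define p :: complex where "p = 1 / of_nat a"
    define G where "G = (\<lambda>s. mu_tail k Y (of_nat c * s))"
    define S where "S = {s. 1 / (2 * real a) < Re s}"
    have S: "open S" unfolding S_def by (rule open_halfspace_Re_gt)
    have ReS: "1 / 2 < real a * Re s" "1 / 2 < real c * Re s" "0 < Re s" if "s \<in> S" for s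
    proof -
      show 1: "1 / 2 < real a * Re s" using that a by (simp add: S_def field_simps)
      show 2: "0 < Re s" using that a by (auto simp: S_def intro: order.strict_trans[rotated])
      have "real a * Re s \<le> real c * Re s" using 2 a by (intro mult_right_mono) auto
      thus "1 / 2 < real c * Re s" using 1 by simp
    qed
    have G: "G holomorphic_on S"
    proof -
      have "(mu_tail k Y \<circ> (\<lambda>s. of_nat c * s)) holomorphic_on S"
        by (rule holomorphic_on_compose_gen[OF _ holomorphic_mu_tail[OF RH]])
           (use ReS in \<open>auto intro!: holomorphic_intros\<close>)
      thus ?thesis unfolding G_def by (simp add: o_def)
    qed
    \<comment> \<open>\<open>zeta1 (of_nat a * s) / of_nat a\<close> is (s - 1/a) \<zeta>(as); its
      zero factor cancels the denominator of the difference quotient, and the pole of zeta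
      disappears.\<close>
    define H where "H = (\<lambda>s. zeta1 (of_nat a * s) / of_nat a * (if s = p then deriv G p else (G s - G p) / (s - p)) * (pkern N s / s))"
    have H': "H s = zeta (of_nat a * s) * (G s - G p) * (pkern N s / s)" if "s \<noteq> p" "0 < Re s" for s
    proof -
      have "of_nat a * s \<noteq> 1" using that a by (auto simp: p_def field_simps)
      hence "zeta1 (of_nat a * s) = (of_nat a * s - 1) * zeta (of_nat a * s)"
        using that a by (intro zeta1_eq) auto
      also have "of_nat a * s - 1 = of_nat a * (s - p)" using a by (simp add: p_def field_simps)
      finally show ?thesis using that a by (simp add: H_def)
    qed
    \<comment> \<open>A crude bound for the finite sum in \<open>mu_tail\<close>. It depends on
      \<open>Y\<close>, which is harmless on the horizontal sides.\<close>
    define M where "M = (\<Sum>d=1..Y. norm (mu k d))"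
    have M: "0 \<le> M" unfolding M_def by (intro sum_nonneg) auto
    define D where "D = K5 * real a * (K6 * (2 * real c) + M + norm (G p))"
    define B where "B = K1 * real a * ((C2 * real c + C3) * real Y powr q) * (C4 * real N powr (\<sigma>' + \<eta>))"
    have "norm (\<Sum>\<^sub>\<infinity>i\<in>{i \<in> {1..} \<times> {1..}. fst i ^ a * snd i ^ c \<le> N}. reg_coeff k Y a c (snd i)) \<le> B / (\<eta> / 2)"
    proof (rule perron_shift[where \<sigma> = "2 / real a" and \<sigma>' = \<sigma>' and H = H and S = S and ?T0.0 = 2
          and A = "\<lambda>s. zeta (of_nat a * s) * (G s - G p)"
          and lam = "\<lambda>i. fst i ^ a * snd i ^ c" and C = "D * (2 * real (N + 1) powr (2 / real a + 1))"])
      fix s assume s: "Re s = 2 / real a"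
      show "((\<lambda>i. reg_coeff k Y a c (snd i) * of_nat (fst i ^ a * snd i ^ c) powr (-s)) has_sum
              zeta (of_nat a * s) * (G s - G p)) ({1..} \<times> {1..})"
        unfolding G_def p_def by (rule has_sum_reg_pairs) (use s a in auto)
      have "s \<noteq> p" using s a by (auto simp: p_def)
      thus "H s = zeta (of_nat a * s) * (G s - G p) * (pkern N s / s)" using s a by (intro H') auto
    next
      have "(zeta1 \<circ> (\<lambda>s. of_nat a * s)) holomorphic_on S"
        by (rule holomorphic_on_compose_gen[OF _ holomorphic_zeta1])
           (use ReS in \<open>force intro!: holomorphic_intros\<close>)+
      moreover have "(0::complex) \<notin> S" by (auto simp: S_def)
      ultimately show "H holomorphic_on S" unfolding H_def
        by (intro holomorphic_on_mult holomorphic_on_divide pole_lemma_open G S holomorphic_on_const holomorphic_on_ident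
             holomorphic_on_subset[OF holomorphic_pkern[OF N]]) (use a in \<open>auto simp: o_def\<close>)
      show "s \<in> S" if "\<sigma>' \<le> Re s" for s using that \<sigma>' by (auto simp: S_def)
      show "norm (H s) \<le> D * (2 * real (N + 1) powr (2 / real a + 1)) / \<bar>Im s\<bar>"
        if s: "\<sigma>' \<le> Re s" "Re s \<le> 2 / real a" "2 \<le> \<bar>Im s\<bar>" for s
      proof -
        define v where "v = \<bar>Im s\<bar>"
        have v: "2 \<le> v" using s by (simp add: v_def)
        have sS: "s \<in> S" using s \<sigma>' by (auto simp: S_def)
        have sp: "s \<noteq> p" using s by (auto simp: p_def)
        have as: "1 / 2 + \<delta> \<le> real a * Re s" using s \<sigma>'(4) a by (metis mult_left_mono of_nat_0_le_iff)
        have "real a * Re s \<le> real c * Re s" using ReS(3)[OF sS] a by (intro mult_right_mono) auto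
        hence cs: "1 / 2 + \<delta> \<le> real c * Re s" using as by linarith
        have half: "(m * v) powr (1 / 2) \<le> m * v powr (1 / 2)" if "1 \<le> m" for m
        proof -
          have "m powr (1 / 2) \<le> m powr 1" using that by (intro powr_mono) auto
          thus ?thesis using that v by (simp add: powr_mult mult_right_mono)
        qed
        have "norm (zeta (of_nat a * s)) \<le> K5 * \<bar>Im (of_nat a * s)\<bar> powr (1 / 2)"
        proof (rule K5(2))
          have "1 * 2 \<le> real a * \<bar>Im s\<bar>" using s a1 by (intro mult_mono) auto
          thus "2 \<le> \<bar>Im (of_nat a * s)\<bar>" by (simp add: abs_mult)
        qed (use as in simp)
        also have "\<bar>Im (of_nat a * s)\<bar> = real a * v" by (simp add: abs_mult v_def)
        also have "K5 * (real a * v) powr (1 / 2) \<le> K5 * (real a * v powr (1 / 2))"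
          using K5 a1 by (intro mult_left_mono half) auto
        finally have z: "norm (zeta (of_nat a * s)) \<le> K5 * real a * v powr (1 / 2)" by simp
        have one: "1 \<le> v powr (1 / 2)" using v by (intro ge_one_powr_ge_zero) auto
        have "norm (G s) \<le> norm (zinv (of_nat c * s) ^ k) + norm (\<Sum>d=1..Y. mu k d * of_nat d powr (-(of_nat c * s)))"
          unfolding G_def mu_tail_def by (rule norm_triangle_ineq4)
        also have "norm (\<Sum>d=1..Y. mu k d * of_nat d powr (-(of_nat c * s))) \<le> M"
          unfolding M_def
        proof (rule sum_norm_le)
          fix d assume d: "d \<in> {1..Y}"
          have "real d powr (- (real c * Re s)) \<le> real d powr 0"
            using d cs \<delta> by (intro powr_mono) auto
          thus "norm (mu k d * of_nat d powr (-(of_nat c * s))) \<le> norm (mu k d)"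
            using d by (simp add: norm_mult norm_nat_powr mult_left_le)
        qed
        also have "norm (zinv (of_nat c * s) ^ k) \<le> K6 * (1 + \<bar>Im (of_nat c * s)\<bar>) powr (1 / 2)"
          by (rule K6(2)) (use cs in simp)
        also have "(1 + \<bar>Im (of_nat c * s)\<bar>) powr (1 / 2) \<le> ((2 * real c) * v) powr (1 / 2)"
        proof (intro powr_mono2)
          have "1 * 1 \<le> real c * v" using a1 v by (intro mult_mono) auto
          thus "1 + \<bar>Im (of_nat c * s)\<bar> \<le> 2 * real c * v" by (simp add: abs_mult v_def)
        qed auto
        also have "\<dots> \<le> (2 * real c) * v powr (1 / 2)" using a1 by (intro half) auto
        finally have g0: "norm (G s) \<le> K6 * ((2 * real c) * v powr (1 / 2)) + M" using K6 by simp
        have g: "norm (G s - G p) \<le> (K6 * (2 * real c) + M + norm (G p)) * v powr (1 / 2)"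
        proof -
          have "M * 1 \<le> M * v powr (1 / 2)" "norm (G p) * 1 \<le> norm (G p) * v powr (1 / 2)"
            using one M by (intro mult_left_mono; simp)+
          thus ?thesis using g0 norm_triangle_ineq4[of "G s" "G p"] by (simp add: algebra_simps)
        qed
        have "norm (H s) = norm (zeta (of_nat a * s)) * norm (G s - G p) * norm (pkern N s / s)"
          unfolding H'[OF sp ReS(3)[OF sS]] norm_mult ..
        also have "\<dots> \<le> (K5 * real a * v powr (1 / 2)) * ((K6 * (2 * real c) + M + norm (G p)) * v powr (1 / 2))
                         * (2 * real (N + 1) powr (2 / real a + 1) / (Im s)\<^sup>2)"
          using s N K5 K6 M a by (intro mult_mono z g pkern_div_decay mult_nonneg_nonneg add_nonneg_nonneg) (auto intro: order_trans[of _ 0])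
        also have "\<dots> = D * (v powr (1 / 2) * v powr (1 / 2)) * (2 * real (N + 1) powr (2 / real a + 1)) / (v * v)"
          by (simp add: D_def v_def power2_eq_square)
        also have "v powr (1 / 2) * v powr (1 / 2) = v" using v by (simp add: powr_add[symmetric])
        also have "D * v * (2 * real (N + 1) powr (2 / real a + 1)) / (v * v) = D * (2 * real (N + 1) powr (2 / real a + 1)) / v"
          using v by simp
        finally show ?thesis by (simp add: v_def)
      qed
      show "norm (H (Complex \<sigma>' v)) \<le> B * (1 + \<bar>v\<bar>) powr (-1 - \<eta> / 2)" for v
      proof -
        define s where "s = Complex \<sigma>' v"
        have s: "Re s = \<sigma>'" "Im s = v" by (auto simp: s_def)
        have sp: "s \<noteq> p" using \<sigma>'(2) s by (auto simp: p_def)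
        have "norm (zeta (of_nat a * s)) \<le> K1 * (1 + \<bar>Im (of_nat a * s)\<bar>) powr e"
          by (rule K1(2)) (use s \<sigma>'(4) in simp)
        also have "\<dots> \<le> K1 * (real a * (1 + \<bar>v\<bar>) powr e)"
          using scale[OF a1(1) _ e(2), of v] e K1 s by (intro mult_left_mono) auto
        finally have z: "norm (zeta (of_nat a * s)) \<le> K1 * real a * (1 + \<bar>v\<bar>) powr e" by simp
        have "norm (G s) \<le> C2 * real Y powr q * (1 + \<bar>Im (of_nat c * s)\<bar>) powr e"
          unfolding G_def by (rule C2(2)[OF Y]) (use s in \<open>simp add: \<tau>_def\<close>)
        also have "\<dots> \<le> C2 * real Y powr q * (real c * (1 + \<bar>v\<bar>) powr e)"
          using scale[OF a1(2) _ e(2), of v] e C2 s by (intro mult_left_mono) auto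
        finally have g1: "norm (G s) \<le> C2 * real Y powr q * (real c * (1 + \<bar>v\<bar>) powr e)" .
        have cp: "of_nat c * p = of_real (real c / real a)" by (simp add: p_def)
        have "norm (G p) \<le> C3 * real Y powr (1 / 2 + \<delta> - real c / real a + e) * (1 + \<bar>Im (of_nat c * p)\<bar>) powr e"
          unfolding G_def by (rule C3(2)[OF Y]) (simp only: cp Re_complex_of_real)
        also have "\<dots> = C3 * real Y powr (1 / 2 + \<delta> - real c / real a + e) * 1"
          by (simp only: cp Im_complex_of_real) simp
        also have "\<dots> \<le> C3 * real Y powr q * (1 + \<bar>v\<bar>) powr e"
          using C3 Y \<tau>\<theta> e by (intro mult_mono mult_left_mono powr_mono ge_one_powr_ge_zero) (auto simp: q_def)
        finally have g2: "norm (G p) \<le> C3 * real Y powr q * (1 + \<bar>v\<bar>) powr e" .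
        have g: "norm (G s - G p) \<le> ((C2 * real c + C3) * real Y powr q) * (1 + \<bar>v\<bar>) powr e"
          using g1 g2 norm_triangle_ineq4[of "G s" "G p"] by (simp add: algebra_simps)
        have "norm (H s) = norm (zeta (of_nat a * s)) * norm (G s - G p) * norm (pkern N s / s)"
          unfolding H'[OF sp, unfolded s, OF \<sigma>'(1)] norm_mult ..
        also have "\<dots> \<le> (K1 * real a * (1 + \<bar>v\<bar>) powr e) * (((C2 * real c + C3) * real Y powr q) * (1 + \<bar>v\<bar>) powr e)
                        * (C4 * real N powr (\<sigma>' + \<eta>) * (1 + \<bar>v\<bar>) powr (-1-\<eta>))"
          using C4(2)[OF N s(1)] K1 C2 C3 C4 s by (intro mult_mono z g) auto
        also have "\<dots> = B * ((1 + \<bar>v\<bar>) powr e * (1 + \<bar>v\<bar>) powr e * (1 + \<bar>v\<bar>) powr (-1-\<eta>))"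
          by (simp add: B_def)
        also have "(1 + \<bar>v\<bar>) powr e * (1 + \<bar>v\<bar>) powr e * (1 + \<bar>v\<bar>) powr (-1-\<eta>) = (1 + \<bar>v\<bar>) powr (-1 - \<eta> / 2)"
          unfolding powr_add[symmetric] by (rule arg_cong[where f = "\<lambda>p. (1 + \<bar>v\<bar>) powr p"]) (simp add: e_def)
        finally show ?thesis by (simp add: s_def)
      qed
    qed (use N a \<sigma>' \<eta> K1 C2 C3 C4 S in \<open>auto simp: B_def field_simps\<close>)
    also have "\<dots> = C * real N powr (\<sigma>' + \<eta>) * real Y powr q" by (simp add: B_def C_def)
    finally show ?thesis .
  qed
  moreover have "0 < C" using K1 C2 C3 C4 a \<eta> by (simp add: C_def add_pos_pos)
  ultimately show ?thesis unfolding \<sigma>'_def q_def \<tau>_def e_def by blast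
qed

section \<open>Counting pairs and balancing the cut\<close>

lemma card_powers_le:
  fixes z :: real
  assumes "0 < a" "0 \<le> z"
  shows "\<bar>real (card {l::nat. 1 \<le> l \<and> real (l ^ a) \<le> z}) - z powr (1 / a)\<bar> \<le> 1"
proof -
  define r where "r = z powr (1 / a)"
  have ra: "r ^ a = z"
    using assms by (cases "z = 0") (simp_all add: r_def powr_realpow[symmetric] powr_powr)
  have "r \<ge> 0" by (simp add: r_def)
  have iff: "real (l ^ a) \<le> z \<longleftrightarrow> real l \<le> r" for l :: nat
    unfolding ra[symmetric] of_nat_power using assms \<open>r \<ge> 0\<close> by (intro power_mono_iff) auto
  have "{l::nat. 1 \<le> l \<and> real (l ^ a) \<le> z} = {1..nat \<lfloor>r\<rfloor>}"
    unfolding iff using \<open>r \<ge> 0\<close> by (auto simp: le_nat_iff le_floor_iff)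
  hence "real (card {l::nat. 1 \<le> l \<and> real (l ^ a) \<le> z}) = of_int \<lfloor>r\<rfloor>"
    using \<open>r \<ge> 0\<close> by simp
  thus ?thesis unfolding r_def[symmetric] by linarith
qed

theorem corollary1p2:
  fixes a c k :: nat and \<epsilon> :: real
  assumes "riemann_hypothesis"
    and "0 < a" and "a < c" and "0 < k"
    and "0 < \<epsilon>"
  shows "\<exists>C. \<forall>x::real. x \<ge> 2 \<longrightarrow>
           norm (Delta k a c x) \<le> C * x powr (1 / real (a + c) + \<epsilon>)"
proof -
  note RH = assms(1) and a = assms(2,3)
  \<comment> \<open>\<epsilon>/4 leaves room for three losses of at most \<delta> each in the
    exponent of x; 1/4 keeps 1/2 + \<delta> below 1.\<close>
  define \<delta> where "\<delta> = min (\<epsilon> / 4) (1 / 4)"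
  have \<delta>: "0 < \<delta>" "\<delta> < 1 / 2" "\<delta> \<le> 1" "\<delta> \<le> \<epsilon> / 4" using assms(5) by (auto simp: \<delta>_def)
  define \<theta> where "\<theta> = real c / real a"
  have \<theta>: "1 < \<theta>" using a by (simp add: \<theta>_def)
  have \<theta>': "1 / 2 + \<delta> < \<theta>" using \<theta> \<delta> by linarith
  define p where "p = 1 / 2 + \<delta> - c * ((1 / 2 + \<delta>) / a) + \<delta> / 4"
  obtain C1 where C1: "0 < C1" "\<And>Y N. 0 < Y \<Longrightarrow> 0 < N \<Longrightarrow>
      norm (\<Sum>\<^sub>\<infinity>i\<in>{i \<in> {1..} \<times> {1..}. fst i ^ a * snd i ^ c \<le> N}. reg_coeff k Y a c (snd i))
             \<le> C1 * real N powr ((1 / 2 + \<delta>) / a + \<delta>) * real Y powr p"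
    using reg_pairs_sum_bound[OF RH a \<delta>(1,2,1,3), of k] unfolding p_def by blast
  obtain C2 where C2: "0 < C2" "\<And>Y s. 0 < Y \<Longrightarrow> Re s = \<theta> \<Longrightarrow>
           norm (mu_tail k Y s) \<le> C2 * real Y powr (1 / 2 + \<delta> - \<theta> + \<delta>) * (1 + \<bar>Im s\<bar>) powr \<delta>"
    using mu_tail_bound[OF RH \<delta>(1) \<theta>' \<delta>(1), of k] by blast
  define M where "M = (\<Sum>\<^sub>\<infinity>d\<in>{1..}. norm (mu k d * of_nat d powr (-of_real (1 + \<epsilon>))))"
  have summ: "(\<lambda>d. norm (mu k d * of_nat d powr (-of_real (1 + \<epsilon>)))) summable_on {1..}"
    using has_sum_mu[of "of_real (1 + \<epsilon>)" k] assms(5)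
    by (auto simp: summable_on_iff_abs_summable_on_complex[symmetric] dest!: has_sum_imp_summable)
  have M: "0 \<le> M" unfolding M_def by (intro infsum_nonneg) auto
  \<comment> \<open>Rankin's trick: (Y/d)^(1+\<epsilon>) is at least 1 for d \<le> Y.\<close>
  have absmu: "(\<Sum>d=1..Y. norm (mu k d)) \<le> M * real Y powr (1 + \<epsilon>)" for Y
  proof -
    have "(\<Sum>d=1..Y. norm (mu k d)) \<le> (\<Sum>d=1..Y. norm (mu k d * of_nat d powr (-of_real (1 + \<epsilon>))) * real Y powr (1 + \<epsilon>))"
    proof (rule sum_mono)
      fix d assume d: "d \<in> {1..Y}"
      have "1 \<le> real d powr (-(1 + \<epsilon>)) * real Y powr (1 + \<epsilon>)"
      proof -
        have "real d powr (1 + \<epsilon>) \<le> real Y powr (1 + \<epsilon>)" using d assms(5) by (intro powr_mono2) auto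
        thus ?thesis using d unfolding powr_minus_divide by (simp add: divide_simps)
      qed
      hence "norm (mu k d) * 1 \<le> norm (mu k d) * (real d powr (-(1 + \<epsilon>)) * real Y powr (1 + \<epsilon>))"
        by (intro mult_left_mono) auto
      also have "\<dots> = norm (mu k d * of_nat d powr (-of_real (1 + \<epsilon>))) * real Y powr (1 + \<epsilon>)"
        using d by (simp add: norm_mult norm_nat_powr)
      finally show "norm (mu k d) \<le> norm (mu k d * of_nat d powr (-of_real (1 + \<epsilon>))) * real Y powr (1 + \<epsilon>)" by simp
    qed
    also have "\<dots> = (\<Sum>d=1..Y. norm (mu k d * of_nat d powr (-of_real (1 + \<epsilon>)))) * real Y powr (1 + \<epsilon>)"
      by (rule sum_distrib_right[symmetric])
    also have "\<dots> \<le> M * real Y powr (1 + \<epsilon>)"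
      unfolding M_def by (intro mult_right_mono finite_sum_le_infsum summ) auto
    finally show ?thesis .
  qed
  define C where "C = M + C1 * 2 powr \<bar>p\<bar> + C2"
  have "norm (Delta k a c x) \<le> C * x powr (1 / real (a + c) + \<epsilon>)" if x: "x \<ge> 2" for x
  proof -
    define N where "N = nat \<lfloor>x\<rfloor>"
    have N: "0 < N" "real N \<le> x" using x by (auto simp: N_def le_nat_iff le_floor_iff)
    have leN: "n \<le> N \<longleftrightarrow> real n \<le> x" for n using x by (simp add: N_def le_nat_iff le_floor_iff)
    \<comment> \<open>The cut at which the rounding error, about \<open>Y\<close>, meets the Perron
      bound. Its integer part \<open>Y\<close> satisfies \<open>y \<le> 2 * real Y\<close>, which
      transfers negative powers from \<open>Y\<close> to \<open>y\<close>.\<close>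
    define y where "y = x powr (1 / real (a + c))"
    have y1: "1 \<le> y" unfolding y_def using x by (intro ge_one_powr_ge_zero) auto
    define Y where "Y = nat \<lfloor>y\<rfloor>"
    have Y: "0 < Y" "real Y \<le> y" "y \<le> 2 * real Y"
    proof -
      show "0 < Y" using y1 by (simp add: Y_def le_floor_iff)
      show "real Y \<le> y" using y1 by (simp add: Y_def)
      have "1 \<le> Y" using \<open>0 < Y\<close> by simp
      moreover have "y < real Y + 1" unfolding Y_def using y1 by linarith
      ultimately show "y \<le> 2 * real Y" by linarith
    qed
    define P where "P = {i \<in> {1..} \<times> {1..}. fst i ^ a * snd i ^ c \<le> N}"
    have finP: "finite P"
    proof (rule finite_subset)
      show "P \<subseteq> {..N} \<times> {..N}"
      proof
        fix i assume "i \<in> P"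
        then obtain l d where i: "i = (l, d)" "1 \<le> l" "1 \<le> d" "l ^ a * d ^ c \<le> N" by (cases i) (auto simp: P_def)
        have "l \<le> l ^ a" "d \<le> d ^ c" using i a by (auto intro: self_le_power)
        moreover have "l ^ a * 1 \<le> l ^ a * d ^ c" "1 * d ^ c \<le> l ^ a * d ^ c"
          using i by (intro mult_le_mono; simp)+
        ultimately have "l \<le> N" "d \<le> N" using i(4) by (linarith, linarith)
        thus "i \<in> {..N} \<times> {..N}" using i(1) by simp
      qed
    qed simp
    define L where "L = (\<lambda>d. real (card {l::nat. 1 \<le> l \<and> l ^ a * d ^ c \<le> N}))"
    define X where "X = x powr (1 / real a)"
    \<comment> \<open>The number of \<open>l\<close> belonging to \<open>d\<close> is the integer
      part of \<open>X * real d powr (-\<theta>)\<close>, whence an error of at most 1 for each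
      \<open>d\<close>.\<close>
    have L: "\<bar>L d - X * real d powr (-\<theta>)\<bar> \<le> 1" if "1 \<le> d" for d
    proof -
      have "l ^ a * d ^ c \<le> N \<longleftrightarrow> real (l ^ a) \<le> x / real d ^ c" for l
        unfolding leN using that by (simp add: pos_le_divide_eq)
      hence "L d = real (card {l::nat. 1 \<le> l \<and> real (l ^ a) \<le> x / real d ^ c})" by (simp add: L_def)
      moreover have "(x / real d ^ c) powr (1 / real a) = X * real d powr (-\<theta>)"
      proof -
        have "(real d ^ c) powr (1 / real a) = real d powr \<theta>"
          using that by (simp add: powr_realpow[symmetric] powr_powr \<theta>_def)
        thus ?thesis using x that by (simp add: powr_divide X_def powr_minus_divide)
      qed
      ultimately show ?thesis using card_powers_le[of a "x / real d ^ c"] a x by simp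
    qed
    have fiber: "(\<Sum>i\<in>{i \<in> P. snd i = d}. f (snd i)) = f d * of_real (L d)" if "1 \<le> d" for d and f :: "nat \<Rightarrow> complex"
    proof -
      have "(\<Sum>i\<in>{i \<in> P. snd i = d}. f (snd i)) = (\<Sum>i\<in>{i \<in> P. snd i = d}. f d)"
        by (intro sum.cong) auto
      also have "\<dots> = of_nat (card {i \<in> P. snd i = d}) * f d" by simp
      also have "card {i \<in> P. snd i = d} = card {l::nat. 1 \<le> l \<and> l ^ a * d ^ c \<le> N}"
        by (rule bij_betw_same_card[of fst], rule bij_betwI[of _ _ _ "\<lambda>l. (l, d)"]) (use that in \<open>auto simp: P_def\<close>)
      finally show ?thesis by (simp add: L_def)
    qed
    have "(\<Sum>n | 1 \<le> n \<and> real n \<le> x. u k a c n) = (\<Sum>n\<in>{1..N}. \<Sum>i\<in>{i \<in> P. fst i ^ a * snd i ^ c = n}. mu k (snd i))"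
    proof (intro sum.cong)
      show "{n. 1 \<le> n \<and> real n \<le> x} = {1..N}" by (auto simp: leN)
      fix n assume n: "n \<in> {1..N}"
      have "{(l, d). 0 < l \<and> 0 < d \<and> l ^ a * d ^ c = n} = {i \<in> P. fst i ^ a * snd i ^ c = n}"
        using n by (auto simp: P_def)
      thus "u k a c n = (\<Sum>i\<in>{i \<in> P. fst i ^ a * snd i ^ c = n}. mu k (snd i))"
        by (simp add: u_def case_prod_unfold)
    qed
    also have "\<dots> = (\<Sum>i\<in>P. mu k (snd i))"
      by (rule sum.group[OF finP]) (auto simp: P_def Suc_le_eq)
    also have "\<dots> = (\<Sum>i\<in>P. if snd i \<le> Y then mu k (snd i) else 0) + (\<Sum>i\<in>P. if Y < snd i then mu k (snd i) else 0)"
      by (subst sum.distrib[symmetric]) (intro sum.cong, auto)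
    also have "(\<Sum>i\<in>P. if snd i \<le> Y then mu k (snd i) else 0) = (\<Sum>d=1..Y. mu k d * of_real (L d))"
    proof -
      have "(\<Sum>i\<in>P. if snd i \<le> Y then mu k (snd i) else 0) = (\<Sum>i\<in>{i \<in> P. snd i \<le> Y}. mu k (snd i))"
        by (rule sum.inter_filter[symmetric, OF finP])
      also have "\<dots> = (\<Sum>d\<in>{1..Y}. \<Sum>i\<in>{i \<in> {i \<in> P. snd i \<le> Y}. snd i = d}. mu k (snd i))"
      proof (rule sum.group[symmetric])
        show "finite {i \<in> P. snd i \<le> Y}" using finP by simp
      qed (auto simp: P_def)
      also have "\<dots> = (\<Sum>d=1..Y. mu k d * of_real (L d))"
      proof (intro sum.cong refl)
        fix d assume d: "d \<in> {1..Y}"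
        have "{i \<in> {i \<in> P. snd i \<le> Y}. snd i = d} = {i \<in> P. snd i = d}" using d by auto
        thus "(\<Sum>i\<in>{i \<in> {i \<in> P. snd i \<le> Y}. snd i = d}. mu k (snd i)) = mu k d * of_real (L d)"
          using fiber[of d "mu k"] d by simp
      qed
      finally show ?thesis .
    qed
    finally have sum_u: "(\<Sum>n | 1 \<le> n \<and> real n \<le> x. u k a c n) =
        (\<Sum>d=1..Y. mu k d * of_real (L d)) + (\<Sum>i\<in>P. if Y < snd i then mu k (snd i) else 0)" .
    have \<theta>c: "of_nat c * (1 / of_nat a) = complex_of_real \<theta>" by (simp add: \<theta>_def)
    define F where "F = mu_tail k Y (of_real \<theta>)"
    define E where "E = (\<Sum>i\<in>P. reg_coeff k Y a c (snd i))"
    \<comment> \<open>The correction sits on the pairs with second entry 1, of which there are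
      \<open>L 1\<close>.\<close>
    have E: "E = (\<Sum>i\<in>P. if Y < snd i then mu k (snd i) else 0) - F * of_real (L 1)"
    proof -
      have "E = (\<Sum>i\<in>P. if Y < snd i then mu k (snd i) else 0) - (\<Sum>i\<in>P. if snd i = 1 then F else 0)"
        unfolding E_def reg_coeff_def \<theta>c F_def by (rule sum_subtractf)
      also have "(\<Sum>i\<in>P. if snd i = 1 then F else 0) = (\<Sum>i\<in>{i \<in> P. snd i = 1}. F)"
        by (rule sum.inter_filter[symmetric, OF finP])
      also have "\<dots> = F * of_real (L 1)" by (rule fiber[of 1 "\<lambda>_. F"]) simp
      finally show ?thesis .
    qed
    \<comment> \<open>The coefficient of the main term is split at \<open>Y\<close> like the sum, so
      that each d \<le> Y and the tail \<open>F\<close> receive their own share of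
      \<open>X\<close>.\<close>
    have zF: "1 / zeta (of_real (real c / real a)) ^ k = (\<Sum>d=1..Y. mu k d * of_real (real d powr (-\<theta>))) + F"
    proof -
      have "zinv (of_real \<theta>) = 1 / zeta (of_real \<theta>)" using \<theta> by (intro zinv_eq) auto
      moreover have "(\<Sum>d=1..Y. mu k d * of_nat d powr (-of_real \<theta>)) = (\<Sum>d=1..Y. mu k d * of_real (real d powr (-\<theta>)))"
      proof (intro sum.cong refl)
        fix d
        have "of_real (real d powr (-\<theta>)) = (of_real (real d) powr of_real (-\<theta>) :: complex)"
          by (rule powr_of_real[symmetric]) simp
        thus "mu k d * of_nat d powr (-of_real \<theta>) = mu k d * of_real (real d powr (-\<theta>))" by simp
      qed
      ultimately show ?thesis by (simp add: F_def mu_tail_def \<theta>_def power_divide)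
    qed
    have "Delta k a c x = (\<Sum>d=1..Y. mu k d * of_real (L d)) + (\<Sum>i\<in>P. if Y < snd i then mu k (snd i) else 0)
            - of_real X * ((\<Sum>d=1..Y. mu k d * of_real (real d powr (-\<theta>))) + F)"
      unfolding Delta_def sum_u zF[symmetric] X_def by simp
    \<comment> \<open>The share \<open>X * F\<close> of the main term and the correction
      \<open>F * L 1\<close> inside \<open>E\<close> differ by a rounding error only, so no residue
      of zeta has to be evaluated.\<close>
    also have "\<dots> = (\<Sum>d=1..Y. mu k d * of_real (L d - X * real d powr (-\<theta>))) + E + F * of_real (L 1 - X)"
      unfolding E by (simp add: algebra_simps sum_subtractf sum_distrib_left)
    also have "norm \<dots> \<le> (\<Sum>d=1..Y. norm (mu k d)) + norm E + norm F"
    proof -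
      have "norm (\<Sum>d=1..Y. mu k d * of_real (L d - X * real d powr (-\<theta>))) \<le> (\<Sum>d=1..Y. norm (mu k d))"
      proof (rule sum_norm_le)
        fix d assume "d \<in> {1..Y}"
        hence "norm (mu k d) * \<bar>L d - X * real d powr (-\<theta>)\<bar> \<le> norm (mu k d) * 1"
          by (intro mult_left_mono L) auto
        thus "norm (mu k d * of_real (L d - X * real d powr (-\<theta>))) \<le> norm (mu k d)"
          unfolding norm_mult norm_of_real by simp
      qed
      moreover have "norm (F * of_real (L 1 - X)) \<le> norm F"
      proof -
        have "norm F * \<bar>L 1 - X\<bar> \<le> norm F * 1" using L[of 1] by (intro mult_left_mono) auto
        thus ?thesis unfolding norm_mult norm_of_real by simp
      qed
      ultimately show ?thesis
        using norm_triangle_ineq[of "(\<Sum>d=1..Y. mu k d * of_real (L d - X * real d powr (-\<theta>))) + E" "F * of_real (L 1 - X)"]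
          norm_triangle_ineq[of "\<Sum>d=1..Y. mu k d * of_real (L d - X * real d powr (-\<theta>))" E] by linarith
    qed
    also have "(\<Sum>d=1..Y. norm (mu k d)) \<le> M * x powr (1 / real (a + c) + \<epsilon>)"
    proof -
      have "real Y powr (1 + \<epsilon>) \<le> y powr (1 + \<epsilon>)" using Y y1 assms(5) by (intro powr_mono2) auto
      also have "\<dots> = x powr (1 / real (a + c) * (1 + \<epsilon>))" unfolding y_def by (rule powr_powr)
      also have "\<dots> \<le> x powr (1 / real (a + c) + \<epsilon>)"
      proof (rule powr_mono)
        have "1 / real (a + c) * \<epsilon> \<le> 1 * \<epsilon>" using assms(5) a by (intro mult_right_mono) auto
        thus "1 / real (a + c) * (1 + \<epsilon>) \<le> 1 / real (a + c) + \<epsilon>" by (simp add: distrib_left)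
      qed (use x in simp)
      finally show ?thesis using order_trans[OF absmu[of Y] mult_left_mono[OF _ M]] by blast
    qed
    also have "norm E \<le> C1 * 2 powr \<bar>p\<bar> * x powr (1 / real (a + c) + \<epsilon>)"
    proof -
      define q where "q = (1 / 2 + \<delta>) / real a + \<delta>"
      have q: "0 \<le> q" using \<delta> a by (simp add: q_def)
      have "norm E \<le> C1 * real N powr q * real Y powr p"
        using C1(2)[OF Y(1) N(1)] finP by (simp add: E_def P_def q_def)
      also have "\<dots> \<le> C1 * x powr q * (2 powr \<bar>p\<bar> * y powr p)"
      proof (intro mult_mono mult_left_mono)
        show "real N powr q \<le> x powr q" using N q by (intro powr_mono2) auto
        \<comment> \<open>\<open>p\<close> equals (1/2 + \<delta>)(1 - c/a) + \<delta>/4 and may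
          have either sign; a negative one calls for \<open>y \<le> 2 * real Y\<close>.\<close>
        show "real Y powr p \<le> 2 powr \<bar>p\<bar> * y powr p"
        proof (cases "0 \<le> p")
          case True
          have "1 * real Y powr p \<le> 2 powr \<bar>p\<bar> * y powr p"
            using Y True by (intro mult_mono powr_mono2 ge_one_powr_ge_zero) auto
          thus ?thesis by simp
        next
          case False
          have "(2 * real Y) powr p \<le> y powr p" using False Y y1 by (intro powr_mono2') auto
          hence "2 powr \<bar>p\<bar> * (2 powr p * real Y powr p) \<le> 2 powr \<bar>p\<bar> * y powr p"
            by (intro mult_left_mono) (auto simp: powr_mult)
          moreover have "2 powr \<bar>p\<bar> * (2 powr p * real Y powr p) = real Y powr p"
            using False by (simp add: powr_minus)
          ultimately show ?thesis by simp
        qed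
      qed (use C1 in auto)
      also have "\<dots> = C1 * 2 powr \<bar>p\<bar> * x powr (q + 1 / real (a + c) * p)"
        unfolding y_def powr_powr powr_add by simp
      also have "\<dots> \<le> C1 * 2 powr \<bar>p\<bar> * x powr (1 / real (a + c) + \<epsilon>)"
      proof (intro mult_left_mono powr_mono)
        define A where "A = real a"
        define B where "B = real c"
        have AB: "1 \<le> A" "A < B" "0 < A + B" using a by (auto simp: A_def B_def)
        \<comment> \<open>At \<delta> = 0 this is 1/(2A) + (A - B)/(2A(A + B)) = 1/(A + B), the
          balance that determines the cut; the other terms are the losses in \<delta>.\<close>
        have "q + 1 / (A + B) * p = 1 / (A + B) + \<delta> / A + \<delta> - \<delta> * (B - A) / (A * (A + B)) + \<delta> / (4 * (A + B))"
          using AB unfolding q_def p_def A_def[symmetric] B_def[symmetric] by (simp add: divide_simps) (simp add: algebra_simps)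
        moreover have "\<delta> / A \<le> \<delta>" using AB \<delta> by (simp add: divide_le_eq)
        moreover have "0 \<le> \<delta> * (B - A) / (A * (A + B))" using AB \<delta> by simp
        moreover have "\<delta> / (4 * (A + B)) \<le> \<delta>" using AB \<delta> by (simp add: divide_le_eq)
        ultimately show "q + 1 / real (a + c) * p \<le> 1 / real (a + c) + \<epsilon>"
          using \<delta>(1,4) unfolding of_nat_add A_def[symmetric] B_def[symmetric] by linarith
      qed (use x C1 in auto)
      finally show ?thesis .
    qed
    also have "norm F \<le> C2 * x powr (1 / real (a + c) + \<epsilon>)"
    proof -
      have "norm F \<le> C2 * real Y powr (1 / 2 + \<delta> - \<theta> + \<delta>)"
        using C2(2)[OF Y(1), of "of_real \<theta>"] by (simp add: F_def)
      \<comment> \<open>The exponent of \<open>Y\<close> is negative, as 1/2 + 2\<delta> \<le> 1 <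
        \<theta>, so comparison with \<open>y\<close> is generous.\<close>
      also have "\<dots> \<le> C2 * y powr 1"
      proof (intro mult_left_mono)
        have "real Y powr (1 / 2 + \<delta> - \<theta> + \<delta>) \<le> real Y powr 1"
          using Y \<delta> \<theta> by (intro powr_mono) auto
        also have "\<dots> \<le> y powr 1" using Y by (intro powr_mono2) auto
        finally show "real Y powr (1 / 2 + \<delta> - \<theta> + \<delta>) \<le> y powr 1" .
      qed (use C2 in auto)
      also have "\<dots> \<le> C2 * x powr (1 / real (a + c) + \<epsilon>)"
        unfolding y_def powr_powr using x C2 assms(5) by (intro mult_left_mono powr_mono) auto
      finally show ?thesis .
    qed
    finally show ?thesis by (simp add: C_def algebra_simps)
  qed
  thus ?thesis by blast
qed

end
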